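(* Let $\mathcal{C}$ be a braided $*$-autonomous category with braiding $c$ and dualizing object $D$, and let $H$ be a Hopf algebra in $\mathcal{C}$ with multiplication $\mu$, unit $\eta$, comultiplication $\Delta$, counit $\varepsilon$ and invertible antipode $s:H\to H$. Let $T=H\otimes -:\mathcal{C}\to\mathcal{C}$ be the opmonoidal monad with multiplication $\mu\otimes 1_X$, unit $\eta\otimes 1_X$, opmonoidal structure $\psi_{X,Y}=(1\otimes c_{H,X}\otimes 1)\circ(\Delta\otimes 1\otimes 1):H\otimes X\otimes Y\to H\otimes X\otimes H\otimes Y$ and $\psi_0=\varepsilon:H\to I$, and let $G=(-)^H$ be the right adjoint of $T$ with its corresponding monoidal comonad structure. Consider the natural transformations $TSTX\to SX$ and $TS'TX\to S'X$ given by $$\nu^T_X=\bigl(H\otimes S(H\otimes X)\xrightarrow{\;c\;}S(H\otimes X)\otimes H\xrightarrow{1\otimes s}S(H\otimes X)\otimes H\xrightarrow{e_{H,X}}SX\bigr),$$ $$\nu'^T_X=\bigl(H\otimes S'(H\otimes X)\xrightarrow{s^{-1}\otimes S'(c_{H,X}^{-1})}H\otimes S'(X\otimes H)\xrightarrow{e'}S'X\bigr).$$ Then $G$, equipped with the natural transformations $\nu:S\to GSG$ and $\nu':S'\to GS'G$ corresponding to $\nu^T$ and $\nu'^T$, is a $*$-autonomous monoidal comonad on $\mathcal{C}$.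
   Context: Monoidal categories are written as if strict. $\mathcal{C}$ is $*$-autonomous when equipped with a dualizing object $D$: for every $B$ there is a chosen object $SB={}^B D$ with isomorphisms $\varpi_{A,B}:\mathcal{C}(A,SB)\to\mathcal{C}(A\otimes B,D)$ natural in $A$, and the resulting functor $S:\mathcal{C}^{\mathrm{op}}\to\mathcal{C}$ (the unique one making $\varpi$ natural in $B$) is an equivalence; one chooses $SI=D$, $\varpi_{A,I}=1$. Put $\omega_{A,B,C}=\varpi_{A\otimes B,C}^{-1}\circ\varpi_{A,B\otimes C}$; $e_{B,C}=\omega_{S(B\otimes C),B,C}(1):S(B\otimes C)\otimes B\to SC$; $\rho_{A,B}=\omega_{I,A,B}^{-1}:\mathcal{C}(A,SB)\to\mathcal{C}(I,S(A\otimes B))$; $n_I=\rho_{SI,I}(1):I\to SSI$. $S$ has a left adjoint $S':\mathcal{C}\to\mathcal{C}^{\mathrm{op}}$, where $S'A=D^A$ represents $\mathcal{C}(A\otimes -,D)$, with unit $\alpha_A:A\to SS'A$ and counit $\beta_B:B\to S'SB$ regarded as morphisms of $\mathcal{C}$. The morphism $e':H\otimes S'(X\otimes H)\to S'X$ corresponds, under $\mathcal{C}(X\otimes-,D)\cong\mathcal{C}(-,S'X)$, to the evaluation $X\otimes H\otimes S'(X\otimes H)\to D$. $X^H$ denotes the right internal hom, representing $\mathcal{C}(H\otimes-,X)$, with evaluation $\mathrm{ev}_X:H\otimes X^H\to X$; $GX=X^H$. The comonad and monoidal structure on $G$ corresponding to that of $T$ under $T\dashv G$ is: $\epsilon_X=\mathrm{ev}_X\circ(\eta\otimes1)$;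 $\delta_X:GX\to GGX$ is the (double) transpose of $\mathrm{ev}_X\circ(\mu\otimes1):H\otimes H\otimes GX\to X$; $\phi_{A,B}:GA\otimes GB\to G(A\otimes B)$ is the transpose of $(\mathrm{ev}_A\otimes\mathrm{ev}_B)\circ\psi_{GA,GB}$; $\phi_0:I\to GI$ is the transpose of $\psi_0$. The natural transformation $\nu_X:SX\to GSGX$ corresponding to $\nu^T$ is the transpose under $T\dashv G$ of $\nu^T_{GX}\circ TS(\mathrm{ev}_X):TSX\to TSTGX\to SGX$; likewise for $\nu'$ with $S'$ in place of $S$. A monoidal comonad $(G,\delta,\epsilon,\phi,\phi_0)$ (a comonad with $G$ lax monoidal and $\delta,\epsilon$ monoidal natural transformations) on a $*$-autonomous $\mathcal{C}$ is $*$-autonomous when equipped with natural transformations $\nu_A:SA\to GSGA$ and $\nu'_A:S'A\to GS'GA$ satisfying: (1) $\epsilon_{SGA}\circ\nu_A=S(\epsilon_A)$, and the same for $(S',\nu')$; (2) $\delta_{SGA}\circ\nu_A=GGS(\delta_A)\circ G(\nu_{GA})\circ\nu_A$, and the same for $(S',\nu')$; (3) $\nu_B\circ e_{A,B}\circ(1\otimes\epsilon_A)=G(e_{GA,GB})\circ G(S(\phi_{A,B})\otimes 1)\circ\phi_{SG(A\otimes B),GA}\circ(\nu_{A\otimes B}\otimes\delta_A)$; (4) $G(n_I)\circ\phi_0=GS(\nu_I)\circ GSGS(\phi_0)\circ\nu_{SI}\circ n_I$; (5) $GS(\nu'_A)\circ\nu_{S'GA}\circ\alpha_{GA}=G(\alpha_A)$;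 (6) $GS'(\nu_A)\circ\nu'_{SGA}\circ\beta_{GA}=G(\beta_A)$. *)

theory Defs
  imports Main
begin

section \<open>Categories, functors, natural transformations\<close>

record ('o, 'm) category =
  Obj :: "'o set"
  Arr :: "'m set"
  Dom :: "'m \<Rightarrow> 'o"
  Cod :: "'m \<Rightarrow> 'o"
  ident :: "'o \<Rightarrow> 'm"  ("\<one>\<index>")
  cmp :: "'m \<Rightarrow> 'm \<Rightarrow> 'm"  (infixr "\<cdot>\<index>" 55)

definition Hom :: "('o, 'm, 'x) category_scheme \<Rightarrow> 'o \<Rightarrow> 'o \<Rightarrow> 'm set" where
  "Hom C A B = {f \<in> Arr C. Dom C f = A \<and> Cod C f = B}"

locale category =
  fixes C :: "('o, 'm, 'x) category_scheme" (structure)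
  assumes Dom_Obj: "f \<in> Arr C \<Longrightarrow> Dom C f \<in> Obj C"
    and Cod_Obj: "f \<in> Arr C \<Longrightarrow> Cod C f \<in> Obj C"
    and ident_Hom: "A \<in> Obj C \<Longrightarrow> \<one> A \<in> Hom C A A"
    and cmp_Hom: "\<lbrakk>f \<in> Hom C X Y; g \<in> Hom C Y Z\<rbrakk> \<Longrightarrow> g \<cdot> f \<in> Hom C X Z"
    and ident_left: "f \<in> Hom C X Y \<Longrightarrow> \<one> Y \<cdot> f = f"
    and ident_right: "f \<in> Hom C X Y \<Longrightarrow> f \<cdot> \<one> X = f"
    and cmp_assoc: "\<lbrakk>f \<in> Hom C W X; g \<in> Hom C X Y; h \<in> Hom C Y Z\<rbrakk>
          \<Longrightarrow> (h \<cdot> g) \<cdot> f = h \<cdot> (g \<cdot> f)"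

definition inverse_arrows :: "('o, 'm, 'x) category_scheme \<Rightarrow> 'm \<Rightarrow> 'm \<Rightarrow> bool" where
  "inverse_arrows C f g \<longleftrightarrow>
     f \<in> Arr C \<and> g \<in> Hom C (Cod C f) (Dom C f) \<and>
     g \<cdot>\<^bsub>C\<^esub> f = \<one>\<^bsub>C\<^esub> (Dom C f) \<and> f \<cdot>\<^bsub>C\<^esub> g = \<one>\<^bsub>C\<^esub> (Cod C f)"

definition iso_arrow :: "('o, 'm, 'x) category_scheme \<Rightarrow> 'm \<Rightarrow> bool" where
  "iso_arrow C f \<longleftrightarrow> (\<exists>g. inverse_arrows C f g)"

definition inv_arrow :: "('o, 'm, 'x) category_scheme \<Rightarrow> 'm \<Rightarrow> 'm"  ("inv\<index> _" [81] 80) where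
  "inv\<^bsub>C\<^esub> f = (THE g. inverse_arrows C f g)"

definition op_cat :: "('o, 'm, 'x) category_scheme \<Rightarrow> ('o, 'm) category" where
  "op_cat C = \<lparr>Obj = Obj C, Arr = Arr C, Dom = Cod C, Cod = Dom C,
                ident = ident C, cmp = (\<lambda>g f. f \<cdot>\<^bsub>C\<^esub> g)\<rparr>"

definition is_functor :: "('o, 'm, 'x) category_scheme \<Rightarrow> ('p, 'n, 'y) category_scheme
    \<Rightarrow> ('o \<Rightarrow> 'p) \<Rightarrow> ('m \<Rightarrow> 'n) \<Rightarrow> bool" where
  "is_functor C E F0 F1 \<longleftrightarrow>
     (\<forall>A\<in>Obj C. F0 A \<in> Obj E \<and> F1 (\<one>\<^bsub>C\<^esub> A) = \<one>\<^bsub>E\<^esub> (F0 A)) \<and>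
     (\<forall>f\<in>Arr C. F1 f \<in> Hom E (F0 (Dom C f)) (F0 (Cod C f))) \<and>
     (\<forall>f\<in>Arr C. \<forall>g\<in>Arr C. Dom C g = Cod C f \<longrightarrow> F1 (g \<cdot>\<^bsub>C\<^esub> f) = F1 g \<cdot>\<^bsub>E\<^esub> F1 f)"

definition is_nat_trans :: "('o, 'm, 'x) category_scheme \<Rightarrow> ('p, 'n, 'y) category_scheme
    \<Rightarrow> ('o \<Rightarrow> 'p) \<Rightarrow> ('m \<Rightarrow> 'n) \<Rightarrow> ('o \<Rightarrow> 'p) \<Rightarrow> ('m \<Rightarrow> 'n) \<Rightarrow> ('o \<Rightarrow> 'n) \<Rightarrow> bool" where
  "is_nat_trans C E F0 F1 K0 K1 t \<longleftrightarrow>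
     (\<forall>A\<in>Obj C. t A \<in> Hom E (F0 A) (K0 A)) \<and>
     (\<forall>f\<in>Arr C. t (Cod C f) \<cdot>\<^bsub>E\<^esub> F1 f = K1 f \<cdot>\<^bsub>E\<^esub> t (Dom C f))"

definition is_nat_iso :: "('o, 'm, 'x) category_scheme \<Rightarrow> ('p, 'n, 'y) category_scheme
    \<Rightarrow> ('o \<Rightarrow> 'p) \<Rightarrow> ('m \<Rightarrow> 'n) \<Rightarrow> ('o \<Rightarrow> 'p) \<Rightarrow> ('m \<Rightarrow> 'n) \<Rightarrow> ('o \<Rightarrow> 'n) \<Rightarrow> bool" where
  "is_nat_iso C E F0 F1 K0 K1 t \<longleftrightarrow>
     is_nat_trans C E F0 F1 K0 K1 t \<and> (\<forall>A\<in>Obj C. iso_arrow E (t A))"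

definition is_equivalence :: "('o, 'm, 'x) category_scheme \<Rightarrow> ('p, 'n, 'y) category_scheme
    \<Rightarrow> ('o \<Rightarrow> 'p) \<Rightarrow> ('m \<Rightarrow> 'n) \<Rightarrow> bool" where
  "is_equivalence C E F0 F1 \<longleftrightarrow> is_functor C E F0 F1 \<and>
     (\<exists>K0 K1. is_functor E C K0 K1 \<and>
        (\<exists>t. is_nat_iso C C (\<lambda>A. A) (\<lambda>f. f) (\<lambda>A. K0 (F0 A)) (\<lambda>f. K1 (F1 f)) t) \<and>
        (\<exists>t. is_nat_iso E E (\<lambda>A. F0 (K0 A)) (\<lambda>f. F1 (K1 f)) (\<lambda>A. A) (\<lambda>f. f) t))"


section \<open>Monoidal categories and braidings\<close>

text \<open>
  Monoidal categories are not assumed strict. Where the source, writing as if they were, omits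
  coherence isomorphisms, they are inserted in the definitions below:
  \<open>\<a> A B X : (A \<otimes> B) \<otimes> X \<rightarrow> A \<otimes> (B \<otimes> X)\<close>, \<open>\<l> A : I \<otimes> A \<rightarrow> A\<close>, \<open>\<r> A : A \<otimes> I \<rightarrow> A\<close>.
\<close>

record ('o, 'm) monoidal_category = "('o, 'm) category" +
  tensor :: "'o \<Rightarrow> 'o \<Rightarrow> 'o"  (infixr "\<otimes>\<index>" 70)
  tensor_arr :: "'m \<Rightarrow> 'm \<Rightarrow> 'm"  (infixr "\<boxtimes>\<index>" 70)
  unit_obj :: "'o"  ("\<I>\<index>")
  associator :: "'o \<Rightarrow> 'o \<Rightarrow> 'o \<Rightarrow> 'm"  ("\<a>\<index>")
  left_unitor :: "'o \<Rightarrow> 'm"  ("\<l>\<index>")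
  right_unitor :: "'o \<Rightarrow> 'm"  ("\<r>\<index>")

locale monoidal_category = category C
  for C :: "('o, 'm, 'x) monoidal_category_scheme" (structure) +
  assumes unit_Obj: "\<I> \<in> Obj C"
    and tensor_Obj: "\<lbrakk>A \<in> Obj C; B \<in> Obj C\<rbrakk> \<Longrightarrow> A \<otimes> B \<in> Obj C"
    and tensor_Hom: "\<lbrakk>f \<in> Hom C A A'; g \<in> Hom C B B'\<rbrakk> \<Longrightarrow> f \<boxtimes> g \<in> Hom C (A \<otimes> B) (A' \<otimes> B')"
    and tensor_ident: "\<lbrakk>A \<in> Obj C; B \<in> Obj C\<rbrakk> \<Longrightarrow> \<one> A \<boxtimes> \<one> B = \<one> (A \<otimes> B)"
    and tensor_cmp: "\<lbrakk>f \<in> Hom C A A'; f' \<in> Hom C A' A''; g \<in> Hom C B B'; g' \<in> Hom C B' B''\<rbrakk>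
          \<Longrightarrow> (f' \<cdot> f) \<boxtimes> (g' \<cdot> g) = (f' \<boxtimes> g') \<cdot> (f \<boxtimes> g)"
    and assoc_Hom: "\<lbrakk>A \<in> Obj C; B \<in> Obj C; X \<in> Obj C\<rbrakk>
          \<Longrightarrow> \<a> A B X \<in> Hom C ((A \<otimes> B) \<otimes> X) (A \<otimes> (B \<otimes> X))"
    and assoc_iso: "\<lbrakk>A \<in> Obj C; B \<in> Obj C; X \<in> Obj C\<rbrakk> \<Longrightarrow> iso_arrow C (\<a> A B X)"
    and assoc_natural: "\<lbrakk>f \<in> Hom C A A'; g \<in> Hom C B B'; h \<in> Hom C X X'\<rbrakk>
          \<Longrightarrow> \<a> A' B' X' \<cdot> ((f \<boxtimes> g) \<boxtimes> h) = (f \<boxtimes> (g \<boxtimes> h)) \<cdot> \<a> A B X"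
    and lunit_Hom: "A \<in> Obj C \<Longrightarrow> \<l> A \<in> Hom C (\<I> \<otimes> A) A"
    and lunit_iso: "A \<in> Obj C \<Longrightarrow> iso_arrow C (\<l> A)"
    and lunit_natural: "f \<in> Hom C A B \<Longrightarrow> \<l> B \<cdot> (\<one> \<I> \<boxtimes> f) = f \<cdot> \<l> A"
    and runit_Hom: "A \<in> Obj C \<Longrightarrow> \<r> A \<in> Hom C (A \<otimes> \<I>) A"
    and runit_iso: "A \<in> Obj C \<Longrightarrow> iso_arrow C (\<r> A)"
    and runit_natural: "f \<in> Hom C A B \<Longrightarrow> \<r> B \<cdot> (f \<boxtimes> \<one> \<I>) = f \<cdot> \<r> A"
    and pentagon: "\<lbrakk>A \<in> Obj C; B \<in> Obj C; X \<in> Obj C; Y \<in> Obj C\<rbrakk>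
          \<Longrightarrow> (\<one> A \<boxtimes> \<a> B X Y) \<cdot> \<a> A (B \<otimes> X) Y \<cdot> (\<a> A B X \<boxtimes> \<one> Y)
            = \<a> A B (X \<otimes> Y) \<cdot> \<a> (A \<otimes> B) X Y"
    and triangle: "\<lbrakk>A \<in> Obj C; B \<in> Obj C\<rbrakk>
          \<Longrightarrow> (\<one> A \<boxtimes> \<l> B) \<cdot> \<a> A \<I> B = \<r> A \<boxtimes> \<one> B"

locale braided_monoidal_category = monoidal_category C
  for C :: "('o, 'm, 'x) monoidal_category_scheme" (structure) and c :: "'o \<Rightarrow> 'o \<Rightarrow> 'm" +
  assumes braid_Hom: "\<lbrakk>A \<in> Obj C; B \<in> Obj C\<rbrakk> \<Longrightarrow> c A B \<in> Hom C (A \<otimes> B) (B \<otimes> A)"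
    and braid_iso: "\<lbrakk>A \<in> Obj C; B \<in> Obj C\<rbrakk> \<Longrightarrow> iso_arrow C (c A B)"
    and braid_natural: "\<lbrakk>f \<in> Hom C A A'; g \<in> Hom C B B'\<rbrakk>
          \<Longrightarrow> c A' B' \<cdot> (f \<boxtimes> g) = (g \<boxtimes> f) \<cdot> c A B"
    and hexagon_right: "\<lbrakk>A \<in> Obj C; B \<in> Obj C; X \<in> Obj C\<rbrakk>
          \<Longrightarrow> \<a> B X A \<cdot> c A (B \<otimes> X) \<cdot> \<a> A B X
            = (\<one> B \<boxtimes> c A X) \<cdot> \<a> B A X \<cdot> (c A B \<boxtimes> \<one> X)"
    and hexagon_left: "\<lbrakk>A \<in> Obj C; B \<in> Obj C; X \<in> Obj C\<rbrakk>
          \<Longrightarrow> inv (\<a> X A B) \<cdot> c (A \<otimes> B) X \<cdot> inv (\<a> A B X)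
            = (c A X \<boxtimes> \<one> B) \<cdot> inv (\<a> A X B) \<cdot> (\<one> A \<boxtimes> c B X)"

context
  fixes C :: "('o, 'm, 'x) monoidal_category_scheme" (structure)
    and c :: "'o \<Rightarrow> 'o \<Rightarrow> 'm"
begin

text \<open>\<open>1 \<otimes> c \<otimes> 1 : (A \<otimes> B) \<otimes> (X \<otimes> Y) \<rightarrow> (A \<otimes> X) \<otimes> (B \<otimes> Y)\<close>\<close>

definition mid_braid :: "'o \<Rightarrow> 'o \<Rightarrow> 'o \<Rightarrow> 'o \<Rightarrow> 'm" where
  "mid_braid A B X Y =
     inv (\<a> A X (B \<otimes> Y))
     \<cdot> (\<one> A \<boxtimes> (\<a> X B Y \<cdot> (c B X \<boxtimes> \<one> Y) \<cdot> inv (\<a> B X Y)))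
     \<cdot> \<a> A B (X \<otimes> Y)"

end


section \<open>Hopf algebras in a braided monoidal category\<close>

locale hopf_algebra = braided_monoidal_category C c
  for C :: "('o, 'm, 'x) monoidal_category_scheme" (structure) and c :: "'o \<Rightarrow> 'o \<Rightarrow> 'm" +
  fixes H :: "'o" and \<mu> \<eta> \<Delta> \<epsilon> s :: "'m"
  assumes carr_Obj: "H \<in> Obj C"
    and mult_Hom: "\<mu> \<in> Hom C (H \<otimes> H) H"
    and unt_Hom: "\<eta> \<in> Hom C \<I> H"
    and comult_Hom: "\<Delta> \<in> Hom C H (H \<otimes> H)"
    and counit_Hom: "\<epsilon> \<in> Hom C H \<I>"
    and antipode_Hom: "s \<in> Hom C H H"
    and mult_assoc: "\<mu> \<cdot> (\<mu> \<boxtimes> \<one> H)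
          = \<mu> \<cdot> (\<one> H \<boxtimes> \<mu>) \<cdot> \<a> H H H"
    and mult_unt_left: "\<mu> \<cdot> (\<eta> \<boxtimes> \<one> H) = \<l> H"
    and mult_unt_right: "\<mu> \<cdot> (\<one> H \<boxtimes> \<eta>) = \<r> H"
    and comult_coassoc: "\<a> H H H \<cdot> (\<Delta> \<boxtimes> \<one> H) \<cdot> \<Delta>
          = (\<one> H \<boxtimes> \<Delta>) \<cdot> \<Delta>"
    and comult_counit_left: "\<l> H \<cdot> (\<epsilon> \<boxtimes> \<one> H) \<cdot> \<Delta> = \<one> H"
    and comult_counit_right: "\<r> H \<cdot> (\<one> H \<boxtimes> \<epsilon>) \<cdot> \<Delta> = \<one> H"
    and comult_mult: "\<Delta> \<cdot> \<mu>
          = (\<mu> \<boxtimes> \<mu>) \<cdot> mid_braid C c H H H H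
            \<cdot> (\<Delta> \<boxtimes> \<Delta>)"
    and comult_unt: "\<Delta> \<cdot> \<eta> = (\<eta> \<boxtimes> \<eta>) \<cdot> inv (\<l> \<I>)"
    and counit_mult: "\<epsilon> \<cdot> \<mu> = \<l> \<I> \<cdot> (\<epsilon> \<boxtimes> \<epsilon>)"
    and counit_unt: "\<epsilon> \<cdot> \<eta> = \<one> \<I>"
    and antipode_left: "\<mu> \<cdot> (s \<boxtimes> \<one> H) \<cdot> \<Delta> = \<eta> \<cdot> \<epsilon>"
    and antipode_right: "\<mu> \<cdot> (\<one> H \<boxtimes> s) \<cdot> \<Delta> = \<eta> \<cdot> \<epsilon>"


section \<open>$*$-autonomous categories\<close>

text \<open>
  \<open>\<pi> A B : C(A, SB) \<rightarrow> C(A \<otimes> B, D)\<close> and \<open>\<pi>' A B : C(B, S'A) \<rightarrow> C(A \<otimes> B, D)\<close>. Composing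
  them gives the adjunction bijection \<open>C(B, S'A) \<cong> C(A, SB)\<close>, so choosing the
  representations \<open>\<pi>'\<close> is the same as choosing a left adjoint \<open>S'\<close> of \<open>S\<close>; one always exists
  because \<open>S\<close> is an equivalence.
\<close>

record ('o, 'm) star_category = "('o, 'm) monoidal_category" +
  dualizing :: "'o"
  S_obj :: "'o \<Rightarrow> 'o"  ("\<S>\<index>")
  varpi :: "'o \<Rightarrow> 'o \<Rightarrow> 'm \<Rightarrow> 'm"  ("\<pi>\<index>")
  S'_obj :: "'o \<Rightarrow> 'o"  ("\<S>''\<index>")
  varpi' :: "'o \<Rightarrow> 'o \<Rightarrow> 'm \<Rightarrow> 'm"  ("\<pi>''\<index>")

context
  fixes C :: "('o, 'm, 'x) star_category_scheme" (structure)
begin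

text \<open>The actions of \<open>S\<close> and \<open>S'\<close> on arrows are the ones making \<open>\<pi> A B\<close> natural in \<open>B\<close> and
  \<open>\<pi>' A B\<close> natural in \<open>A\<close>.\<close>

definition S_arr :: "'m \<Rightarrow> 'm" where
  "S_arr f = (THE g. g \<in> Hom C (\<S> (Cod C f)) (\<S> (Dom C f)) \<and>
     (\<forall>A\<in>Obj C. \<forall>h\<in>Hom C A (\<S> (Cod C f)).
        \<pi> A (Dom C f) (g \<cdot> h) = \<pi> A (Cod C f) h \<cdot> (\<one> A \<boxtimes> f)))"

definition S'_arr :: "'m \<Rightarrow> 'm" where
  "S'_arr f = (THE g. g \<in> Hom C (\<S>' (Cod C f)) (\<S>' (Dom C f)) \<and>
     (\<forall>B\<in>Obj C. \<forall>h\<in>Hom C B (\<S>' (Cod C f)).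
        \<pi>' (Dom C f) B (g \<cdot> h) = \<pi>' (Cod C f) B h \<cdot> (f \<boxtimes> \<one> B)))"

definition varpi_inv :: "'o \<Rightarrow> 'o \<Rightarrow> 'm \<Rightarrow> 'm" where
  "varpi_inv A B = the_inv_into (Hom C A (\<S> B)) (\<pi> A B)"

definition varpi'_inv :: "'o \<Rightarrow> 'o \<Rightarrow> 'm \<Rightarrow> 'm" where
  "varpi'_inv A B = the_inv_into (Hom C B (\<S>' A)) (\<pi>' A B)"

text \<open>\<open>\<omega> : C(A, S(B \<otimes> X)) \<rightarrow> C(A \<otimes> B, SX)\<close>\<close>

definition omega :: "'o \<Rightarrow> 'o \<Rightarrow> 'o \<Rightarrow> 'm \<Rightarrow> 'm" where
  "omega A B X f = varpi_inv (A \<otimes> B) X (\<pi> A (B \<otimes> X) f \<cdot> \<a> A B X)"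

definition omega_inv :: "'o \<Rightarrow> 'o \<Rightarrow> 'o \<Rightarrow> 'm \<Rightarrow> 'm" where
  "omega_inv A B X = the_inv_into (Hom C A (\<S> (B \<otimes> X))) (omega A B X)"

text \<open>\<open>e : S(B \<otimes> X) \<otimes> B \<rightarrow> SX\<close>\<close>

definition e_arr :: "'o \<Rightarrow> 'o \<Rightarrow> 'm" where
  "e_arr B X = omega (\<S> (B \<otimes> X)) B X (\<one> (\<S> (B \<otimes> X)))"

text \<open>\<open>\<rho> : C(A, SB) \<rightarrow> C(I, S(A \<otimes> B))\<close>\<close>

definition rho :: "'o \<Rightarrow> 'o \<Rightarrow> 'm \<Rightarrow> 'm" where
  "rho A B f = omega_inv \<I> A B (f \<cdot> \<l> A)"

text \<open>\<open>n\<^sub>I : I \<rightarrow> SSI\<close>, where \<open>S(SI \<otimes> I)\<close> is identified with \<open>SSI\<close> along \<open>\<r>\<close>.\<close>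

definition n_unit :: "'m" where
  "n_unit = S_arr (inv (\<r> (\<S> \<I>))) \<cdot> rho (\<S> \<I>) \<I> (\<one> (\<S> \<I>))"

text \<open>Unit \<open>\<alpha> : A \<rightarrow> SS'A\<close> and counit \<open>\<beta> : B \<rightarrow> S'SB\<close> of the adjunction \<open>C(B, S'A) \<cong> C(A, SB)\<close>.\<close>

definition adj_unit :: "'o \<Rightarrow> 'm" where
  "adj_unit A = varpi_inv A (\<S>' A) (\<pi>' A (\<S>' A) (\<one> (\<S>' A)))"

definition adj_counit :: "'o \<Rightarrow> 'm" where
  "adj_counit B = varpi'_inv (\<S> B) B (\<pi> (\<S> B) B (\<one> (\<S> B)))"

text \<open>\<open>e' : Y \<otimes> S'(X \<otimes> Y) \<rightarrow> S'X\<close>\<close>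

definition e'_arr :: "'o \<Rightarrow> 'o \<Rightarrow> 'm" where
  "e'_arr X Y = varpi'_inv X (Y \<otimes> \<S>' (X \<otimes> Y))
     (\<pi>' (X \<otimes> Y) (\<S>' (X \<otimes> Y)) (\<one> (\<S>' (X \<otimes> Y))) \<cdot> inv (\<a> X Y (\<S>' (X \<otimes> Y))))"

end

locale star_autonomous_category = monoidal_category C
  for C :: "('o, 'm, 'x) star_category_scheme" (structure) +
  assumes dualizing_Obj: "dualizing C \<in> Obj C"
    and S_Obj: "B \<in> Obj C \<Longrightarrow> \<S> B \<in> Obj C"
    and varpi_bij: "\<lbrakk>A \<in> Obj C; B \<in> Obj C\<rbrakk>
          \<Longrightarrow> bij_betw (\<pi> A B) (Hom C A (\<S> B)) (Hom C (A \<otimes> B) (dualizing C))"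
    and varpi_natural: "\<lbrakk>B \<in> Obj C; k \<in> Hom C A' A; f \<in> Hom C A (\<S> B)\<rbrakk>
          \<Longrightarrow> \<pi> A' B (f \<cdot> k) = \<pi> A B f \<cdot> (k \<boxtimes> \<one> B)"
    and S_equivalence: "is_equivalence (op_cat C) C (S_obj C) (S_arr C)"
    and S_unit: "\<S> \<I> = dualizing C"
    and varpi_unit: "f \<in> Hom C A (\<S> \<I>) \<Longrightarrow> \<pi> A \<I> f = f \<cdot> \<r> A"
    and S'_Obj: "A \<in> Obj C \<Longrightarrow> \<S>' A \<in> Obj C"
    and varpi'_bij: "\<lbrakk>A \<in> Obj C; B \<in> Obj C\<rbrakk>
          \<Longrightarrow> bij_betw (\<pi>' A B) (Hom C B (\<S>' A)) (Hom C (A \<otimes> B) (dualizing C))"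
    and varpi'_natural: "\<lbrakk>A \<in> Obj C; k \<in> Hom C B' B; f \<in> Hom C B (\<S>' A)\<rbrakk>
          \<Longrightarrow> \<pi>' A B' (f \<cdot> k) = \<pi>' A B f \<cdot> (\<one> A \<boxtimes> k)"


section \<open>Monoidal comonads\<close>

locale monoidal_comonad = monoidal_category C
  for C :: "('o, 'm, 'x) monoidal_category_scheme" (structure) +
  fixes G :: "'o \<Rightarrow> 'o" and G1 :: "'m \<Rightarrow> 'm"
    and \<delta> \<epsilon> :: "'o \<Rightarrow> 'm" and \<phi> :: "'o \<Rightarrow> 'o \<Rightarrow> 'm" and \<phi>0 :: "'m"
  assumes G_functor: "is_functor C C G G1"
    and delta_natural: "is_nat_trans C C G G1 (\<lambda>A. G (G A)) (\<lambda>f. G1 (G1 f)) \<delta>"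
    and epsilon_natural: "is_nat_trans C C G G1 (\<lambda>A. A) (\<lambda>f. f) \<epsilon>"
    and delta_coassoc: "A \<in> Obj C \<Longrightarrow> G1 (\<delta> A) \<cdot> \<delta> A = \<delta> (G A) \<cdot> \<delta> A"
    and epsilon_G_delta: "A \<in> Obj C \<Longrightarrow> \<epsilon> (G A) \<cdot> \<delta> A = \<one> (G A)"
    and G_epsilon_delta: "A \<in> Obj C \<Longrightarrow> G1 (\<epsilon> A) \<cdot> \<delta> A = \<one> (G A)"
    and phi_Hom: "\<lbrakk>A \<in> Obj C; B \<in> Obj C\<rbrakk> \<Longrightarrow> \<phi> A B \<in> Hom C (G A \<otimes> G B) (G (A \<otimes> B))"
    and phi_natural: "\<lbrakk>f \<in> Hom C A A'; g \<in> Hom C B B'\<rbrakk>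
          \<Longrightarrow> \<phi> A' B' \<cdot> (G1 f \<boxtimes> G1 g) = G1 (f \<boxtimes> g) \<cdot> \<phi> A B"
    and phi0_Hom: "\<phi>0 \<in> Hom C \<I> (G \<I>)"
    and phi_assoc: "\<lbrakk>A \<in> Obj C; B \<in> Obj C; X \<in> Obj C\<rbrakk>
          \<Longrightarrow> G1 (\<a> A B X) \<cdot> \<phi> (A \<otimes> B) X \<cdot> (\<phi> A B \<boxtimes> \<one> (G X))
            = \<phi> A (B \<otimes> X) \<cdot> (\<one> (G A) \<boxtimes> \<phi> B X) \<cdot> \<a> (G A) (G B) (G X)"
    and phi_lunit: "A \<in> Obj C \<Longrightarrow> G1 (\<l> A) \<cdot> \<phi> \<I> A \<cdot> (\<phi>0 \<boxtimes> \<one> (G A)) = \<l> (G A)"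
    and phi_runit: "A \<in> Obj C \<Longrightarrow> G1 (\<r> A) \<cdot> \<phi> A \<I> \<cdot> (\<one> (G A) \<boxtimes> \<phi>0) = \<r> (G A)"
    and delta_phi: "\<lbrakk>A \<in> Obj C; B \<in> Obj C\<rbrakk>
          \<Longrightarrow> \<delta> (A \<otimes> B) \<cdot> \<phi> A B = G1 (\<phi> A B) \<cdot> \<phi> (G A) (G B) \<cdot> (\<delta> A \<boxtimes> \<delta> B)"
    and delta_phi0: "\<delta> \<I> \<cdot> \<phi>0 = G1 \<phi>0 \<cdot> \<phi>0"
    and epsilon_phi: "\<lbrakk>A \<in> Obj C; B \<in> Obj C\<rbrakk> \<Longrightarrow> \<epsilon> (A \<otimes> B) \<cdot> \<phi> A B = \<epsilon> A \<boxtimes> \<epsilon> B"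
    and epsilon_phi0: "\<epsilon> \<I> \<cdot> \<phi>0 = \<one> \<I>"

locale star_autonomous_comonad =
  star_autonomous_category C + monoidal_comonad C G G1 \<delta> \<epsilon> \<phi> \<phi>0
  for C :: "('o, 'm, 'x) star_category_scheme" (structure)
    and G :: "'o \<Rightarrow> 'o" and G1 :: "'m \<Rightarrow> 'm"
    and \<delta> \<epsilon> :: "'o \<Rightarrow> 'm" and \<phi> :: "'o \<Rightarrow> 'o \<Rightarrow> 'm" and \<phi>0 :: "'m" +
  fixes \<nu> \<nu>' :: "'o \<Rightarrow> 'm"
  assumes nu_natural: "is_nat_trans (op_cat C) C (S_obj C) (S_arr C)
          (\<lambda>A. G (\<S> (G A))) (\<lambda>f. G1 (S_arr C (G1 f))) \<nu>"
    and nu'_natural: "is_nat_trans (op_cat C) C (S'_obj C) (S'_arr C)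
          (\<lambda>A. G (\<S>' (G A))) (\<lambda>f. G1 (S'_arr C (G1 f))) \<nu>'"
    and nu_epsilon: "A \<in> Obj C \<Longrightarrow> \<epsilon> (\<S> (G A)) \<cdot> \<nu> A = S_arr C (\<epsilon> A)"
    and nu'_epsilon: "A \<in> Obj C \<Longrightarrow> \<epsilon> (\<S>' (G A)) \<cdot> \<nu>' A = S'_arr C (\<epsilon> A)"
    and nu_delta: "A \<in> Obj C
          \<Longrightarrow> \<delta> (\<S> (G A)) \<cdot> \<nu> A = G1 (G1 (S_arr C (\<delta> A))) \<cdot> G1 (\<nu> (G A)) \<cdot> \<nu> A"
    and nu'_delta: "A \<in> Obj C
          \<Longrightarrow> \<delta> (\<S>' (G A)) \<cdot> \<nu>' A = G1 (G1 (S'_arr C (\<delta> A))) \<cdot> G1 (\<nu>' (G A)) \<cdot> \<nu>' A"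
    and nu_e: "\<lbrakk>A \<in> Obj C; B \<in> Obj C\<rbrakk>
          \<Longrightarrow> \<nu> B \<cdot> e_arr C A B \<cdot> (\<one> (\<S> (A \<otimes> B)) \<boxtimes> \<epsilon> A)
            = G1 (e_arr C (G A) (G B)) \<cdot> G1 (S_arr C (\<phi> A B) \<boxtimes> \<one> (G A))
              \<cdot> \<phi> (\<S> (G (A \<otimes> B))) (G A) \<cdot> (\<nu> (A \<otimes> B) \<boxtimes> \<delta> A)"
    and nu_n: "G1 (n_unit C) \<cdot> \<phi>0
          = G1 (S_arr C (\<nu> \<I>)) \<cdot> G1 (S_arr C (G1 (S_arr C \<phi>0))) \<cdot> \<nu> (\<S> \<I>) \<cdot> n_unit C"
    and nu_alpha: "A \<in> Obj C
          \<Longrightarrow> G1 (S_arr C (\<nu>' A)) \<cdot> \<nu> (\<S>' (G A)) \<cdot> adj_unit C (G A) = G1 (adj_unit C A)"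
    and nu'_beta: "A \<in> Obj C
          \<Longrightarrow> G1 (S'_arr C (\<nu> A)) \<cdot> \<nu>' (\<S> (G A)) \<cdot> adj_counit C (G A) = G1 (adj_counit C A)"


section \<open>The right adjoint of tensoring with a Hopf algebra\<close>

locale right_internal_hom = monoidal_category C
  for C :: "('o, 'm, 'x) monoidal_category_scheme" (structure) +
  fixes H :: "'o" and G :: "'o \<Rightarrow> 'o" and ev :: "'o \<Rightarrow> 'm"
  assumes base_Obj: "H \<in> Obj C"
    and ihom_Obj: "X \<in> Obj C \<Longrightarrow> G X \<in> Obj C"
    and ev_Hom: "X \<in> Obj C \<Longrightarrow> ev X \<in> Hom C (H \<otimes> G X) X"
    and ev_universal: "\<lbrakk>A \<in> Obj C; X \<in> Obj C; f \<in> Hom C (H \<otimes> A) X\<rbrakk>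
          \<Longrightarrow> \<exists>!g. g \<in> Hom C A (G X) \<and> ev X \<cdot> (\<one> H \<boxtimes> g) = f"

context
  fixes C :: "('o, 'm, 'x) monoidal_category_scheme" (structure)
    and H :: "'o" and G :: "'o \<Rightarrow> 'o" and ev :: "'o \<Rightarrow> 'm"
begin

text \<open>\<open>hom_transpose A X : C(H \<otimes> A, X) \<rightarrow> C(A, GX)\<close>\<close>

definition hom_transpose :: "'o \<Rightarrow> 'o \<Rightarrow> 'm \<Rightarrow> 'm" where
  "hom_transpose A X f = (THE g. g \<in> Hom C A (G X) \<and> ev X \<cdot> (\<one> H \<boxtimes> g) = f)"

definition hom_arr :: "'m \<Rightarrow> 'm" where
  "hom_arr f = hom_transpose (G (Dom C f)) (Cod C f) (f \<cdot> ev (Dom C f))"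

definition hom_epsilon :: "'m \<Rightarrow> 'o \<Rightarrow> 'm" where
  "hom_epsilon \<eta> X = ev X \<cdot> (\<eta> \<boxtimes> \<one> (G X)) \<cdot> inv (\<l> (G X))"

definition hom_delta :: "'m \<Rightarrow> 'o \<Rightarrow> 'm" where
  "hom_delta \<mu> X = hom_transpose (G X) (G X)
     (hom_transpose (H \<otimes> G X) X (ev X \<cdot> (\<mu> \<boxtimes> \<one> (G X)) \<cdot> inv (\<a> H H (G X))))"

text \<open>\<open>\<psi> X Y : H \<otimes> (X \<otimes> Y) \<rightarrow> (H \<otimes> X) \<otimes> (H \<otimes> Y)\<close>\<close>

definition hopf_psi :: "('o \<Rightarrow> 'o \<Rightarrow> 'm) \<Rightarrow> 'm \<Rightarrow> 'o \<Rightarrow> 'o \<Rightarrow> 'm" where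
  "hopf_psi c \<Delta> X Y = mid_braid C c H H X Y \<cdot> (\<Delta> \<boxtimes> \<one> (X \<otimes> Y))"

definition hom_phi :: "('o \<Rightarrow> 'o \<Rightarrow> 'm) \<Rightarrow> 'm \<Rightarrow> 'o \<Rightarrow> 'o \<Rightarrow> 'm" where
  "hom_phi c \<Delta> A B = hom_transpose (G A \<otimes> G B) (A \<otimes> B) ((ev A \<boxtimes> ev B) \<cdot> hopf_psi c \<Delta> (G A) (G B))"

definition hom_phi0 :: "'m \<Rightarrow> 'm" where
  "hom_phi0 \<epsilon> = hom_transpose \<I> \<I> (\<epsilon> \<cdot> \<r> H)"

end

context
  fixes C :: "('o, 'm, 'x) star_category_scheme" (structure)
    and H :: "'o" and G :: "'o \<Rightarrow> 'o" and ev :: "'o \<Rightarrow> 'm"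
    and c :: "'o \<Rightarrow> 'o \<Rightarrow> 'm" and s :: "'m"
begin

definition nuT :: "'o \<Rightarrow> 'm" where
  "nuT X = e_arr C H X \<cdot> (\<one> (\<S> (H \<otimes> X)) \<boxtimes> s) \<cdot> c H (\<S> (H \<otimes> X))"

definition nu'T :: "'o \<Rightarrow> 'm" where
  "nu'T X = e'_arr C X H \<cdot> (inv s \<boxtimes> S'_arr C (inv (c H X)))"

definition hom_nu :: "'o \<Rightarrow> 'm" where
  "hom_nu X = hom_transpose C H G ev (\<S> X) (\<S> (G X)) (nuT (G X) \<cdot> (\<one> H \<boxtimes> S_arr C (ev X)))"

definition hom_nu' :: "'o \<Rightarrow> 'm" where
  "hom_nu' X = hom_transpose C H G ev (\<S>' X) (\<S>' (G X)) (nu'T (G X) \<cdot> (\<one> H \<boxtimes> S'_arr C (ev X)))"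

end

end

theory Submission
  imports Defs
begin

text \<open>
  All structure on \<open>G\<close> is transported along the adjunction \<open>T \<stileturn> G\<close> with \<open>T = H \<otimes> -\<close>, so every axiom
  is at heart an identity in the Hopf algebra. An arrow into \<open>G X\<close> is determined by its composite with
  evaluation \<open>H \<otimes> G X \<rightarrow> X\<close>, an arrow into \<open>S X\<close> by its composite with the universal pairing
  \<open>S X \<otimes> X \<rightarrow> D\<close>, and an arrow into \<open>S' X\<close> by the pairing \<open>X \<otimes> S' X \<rightarrow> D\<close>. Testing in this way, and
  writing elements for readability, \<open>\<nu>\<close> sends \<open>f\<close> to the functional with
  \<open>\<nu>(f)(h)(a) = f(a(s h))\<close>, where \<open>h\<close> passes \<open>f\<close> by the braiding, and \<open>\<nu>'\<close> sends \<open>f\<close> to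
  \<open>f(a(s\<^sup>-\<^sup>1 h))\<close>, where \<open>h\<close> passes \<open>a\<close> by the inverse braiding (\<open>pairS_nu\<close>, \<open>pairS'_nu\<close>).

  The laws of a monoidal comonad for \<open>G\<close> are the transposes of the statement that \<open>T\<close> is an opmonoidal
  monad (\<open>psi_assoc\<close>, \<open>psi_lunit\<close>, \<open>psi_runit\<close>, \<open>psi_mult\<close>, \<open>psi_unt\<close>). The remaining axioms reduce as
  follows. Compatibility with \<open>\<epsilon>\<close> is \<open>s(1) = 1\<close> (\<open>antipode_unit\<close>). Compatibility with \<open>\<delta>\<close> says that
  the antipode reverses products up to the braiding (\<open>antipode_mult\<close>). Compatibility with the
  evaluations \<open>e\<close> is \<open>s(h\<^sub>1)\<^sub>1 h\<^sub>2 \<otimes> s(h\<^sub>1)\<^sub>2 = 1 \<otimes> s(h)\<close> (\<open>antipode_comult\<close>). Compatibility with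
  \<open>n\<close> is \<open>\<epsilon>(s h) = \<epsilon>(h)\<close> (\<open>counit_antipode\<close>). In the two conditions on the unit and counit relating \<open>S\<close>
  and \<open>S'\<close>, \<open>s\<close> meets its inverse and the braiding meets the inverse braiding.

  To keep associators out of these computations, words are bracketed to the right, and the structure maps
  of \<open>H\<close> and the crossings act on the first letters of a word, naturally in the rest of it. The Hopf
  algebra axioms then become equations between natural transformations of powers of \<open>T\<close>.
\<close>

section \<open>Arrows with total composition\<close>

text \<open>
  An arrow that carries its source and target. An ill-typed composite has no underlying arrow but still the
  source and target of its ends, so both are read off without conditions and composition is associative
  unconditionally. With \<open>Dom\<close> and \<open>Cod\<close> instead, each use of associativity would need the typing of
  every arrow in the chain to be derived again.
\<close>
datatype ('o, 'm) tarr = Tarr (src: 'o) (raw: "'m option") (trg: 'o)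

context category
begin

lemma Hom_iff: "f \<in> Hom C A B \<longleftrightarrow> f \<in> Arr C \<and> Dom C f = A \<and> Cod C f = B"
  by (auto simp: Hom_def)

lemma cmp_typ:
  assumes "f \<in> Arr C" "g \<in> Arr C" "Dom C g = Cod C f"
  shows "g \<cdot> f \<in> Arr C" "Dom C (g \<cdot> f) = Dom C f" "Cod C (g \<cdot> f) = Cod C g"
  using cmp_Hom[of f "Dom C f" "Cod C f" g "Cod C g"] assms by (auto simp: Hom_iff)

lemma ident_typ: "A \<in> Obj C \<Longrightarrow> \<one> A \<in> Arr C" "A \<in> Obj C \<Longrightarrow> Dom C (\<one> A) = A" "A \<in> Obj C \<Longrightarrow> Cod C (\<one> A) = A"
  using ident_Hom[of A] by (auto simp: Hom_iff)

definition val :: "('o, 'm) tarr \<Rightarrow> bool" where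
  "val t \<longleftrightarrow> (\<exists>f \<in> Hom C (src t) (trg t). raw t = Some f)"

text \<open>
  An arrow with an underlying element that does not fit its source and target is not proper; composition
  erases such an element, so only proper arrows satisfy the identity laws.
\<close>
definition proper :: "('o, 'm) tarr \<Rightarrow> bool" where
  "proper t \<longleftrightarrow> val t \<or> raw t = None"

definition lft :: "'m \<Rightarrow> ('o, 'm) tarr" where
  "lft f = Tarr (Dom C f) (if f \<in> Arr C then Some f else None) (Cod C f)"

definition tid :: "'o \<Rightarrow> ('o, 'm) tarr" where
  "tid A = Tarr A (if A \<in> Obj C then Some (\<one> A) else None) A"

definition tcmp :: "('o, 'm) tarr \<Rightarrow> ('o, 'm) tarr \<Rightarrow> ('o, 'm) tarr"  (infixr "**" 55) where
  "g ** f = Tarr (src f) (if val g \<and> val f \<and> src g = trg f then Some (the (raw g) \<cdot> the (raw f)) else None) (trg g)"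

definition tinv :: "('o, 'm) tarr \<Rightarrow> ('o, 'm) tarr" where
  "tinv f = Tarr (trg f) (if val f \<and> iso_arrow C (the (raw f)) then Some (inv (the (raw f))) else None) (src f)"

definition tiso :: "('o, 'm) tarr \<Rightarrow> bool" where
  "tiso f \<longleftrightarrow> val f \<and> iso_arrow C (the (raw f))"

lemma val_lft [simp]: "val (lft f) \<longleftrightarrow> f \<in> Arr C"
  by (auto simp: val_def lft_def Hom_iff)

lemma src_trg_lft [simp]: "src (lft f) = Dom C f" "trg (lft f) = Cod C f"
  by (auto simp: lft_def)

lemma raw_lft: "f \<in> Arr C \<Longrightarrow> raw (lft f) = Some f"
  by (simp add: lft_def)

lemma val_raw: "val t \<Longrightarrow> raw t \<noteq> None"
  by (auto simp: val_def)

lemma valE: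
  assumes "val t" obtains f where "t = lft f" "f \<in> Arr C" "src t = Dom C f" "trg t = Cod C f"
proof -
  obtain f where "f \<in> Hom C (src t) (trg t)" "raw t = Some f" using assms by (auto simp: val_def)
  then have "t = lft f" "f \<in> Arr C" by (auto simp: lft_def Hom_iff tarr.expand)
  then show ?thesis using that by simp
qed

lemma val_Obj: "val f \<Longrightarrow> src f \<in> Obj C" "val f \<Longrightarrow> trg f \<in> Obj C"
  by (auto elim!: valE simp: Dom_Obj Cod_Obj)

lemma tid_Obj: "A \<in> Obj C \<Longrightarrow> tid A = lft (\<one> A)"
  using ident_Hom[of A] by (auto simp: tid_def lft_def Hom_iff)

lemma val_tid [simp]: "val (tid A) \<longleftrightarrow> A \<in> Obj C"
  using ident_Hom[of A] by (auto simp: tid_def val_def Hom_iff)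

lemma src_trg [simp]:
  "src (tid A) = A" "trg (tid A) = A" "src (g ** f) = src f" "trg (g ** f) = trg g"
  "src (tinv f) = trg f" "trg (tinv f) = src f"
  by (auto simp: tid_def tcmp_def tinv_def)

lemma lft_cmp:
  assumes "f \<in> Arr C" "g \<in> Arr C" "Dom C g = Cod C f" shows "lft (g \<cdot> f) = lft g ** lft f"
proof (rule tarr.expand, intro conjI)
  have "val (lft g)" "val (lft f)" using assms by simp_all
  then show "raw (lft (g \<cdot> f)) = raw (lft g ** lft f)"
    unfolding tcmp_def using assms by (simp add: lft_def cmp_typ)
qed (use assms in \<open>auto simp: cmp_typ\<close>)

lemma val_cmp [simp]: "val (g ** f) \<longleftrightarrow> val g \<and> val f \<and> src g = trg f"
proof
  assume "val g \<and> val f \<and> src g = trg f"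
  then show "val (g ** f)" by (auto elim!: valE simp: lft_cmp[symmetric] cmp_typ)
qed (drule val_raw, simp add: tcmp_def split: if_splits)

lemma lft_inv: "iso_arrow C f \<Longrightarrow> lft (inv f) = tinv (lft f)" and iso_Arr: "iso_arrow C f \<Longrightarrow> f \<in> Arr C"
  and inv_typ: "iso_arrow C f \<Longrightarrow> inv f \<in> Arr C" "iso_arrow C f \<Longrightarrow> Dom C (inv f) = Cod C f"
    "iso_arrow C f \<Longrightarrow> Cod C (inv f) = Dom C f"
  and inv_left: "iso_arrow C f \<Longrightarrow> inv f \<cdot> f = \<one> (Dom C f)"
  and inv_right: "iso_arrow C f \<Longrightarrow> f \<cdot> inv f = \<one> (Cod C f)"
  and iso_inv: "iso_arrow C f \<Longrightarrow> iso_arrow C (inv f)"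
proof -
  assume "iso_arrow C f"
  then obtain g where g: "inverse_arrows C f g" by (auto simp: iso_arrow_def)
  have "h = g" if h: "inverse_arrows C f h" for h
  proof -
    have "h = h \<cdot> f \<cdot> g" using g h ident_right[of h] by (auto simp: inverse_arrows_def Hom_iff)
    also have "\<dots> = (h \<cdot> f) \<cdot> g"
      by (rule cmp_assoc[symmetric]) (use g h in \<open>auto simp: inverse_arrows_def Hom_iff\<close>)
    also have "\<dots> = g" using g h ident_left[of g] by (auto simp: inverse_arrows_def Hom_iff)
    finally show ?thesis .
  qed
  then have i: "inv f = g" unfolding inv_arrow_def using g by (blast intro: the_equality)
  show a: "f \<in> Arr C" "inv f \<in> Arr C" "Dom C (inv f) = Cod C f" "Cod C (inv f) = Dom C f"
    "inv f \<cdot> f = \<one> (Dom C f)" "f \<cdot> inv f = \<one> (Cod C f)"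
    using g i by (auto simp: inverse_arrows_def Hom_iff)
  show "iso_arrow C (inv f)"
    unfolding iso_arrow_def[of C "inv f"] inverse_arrows_def using a by (auto simp: Hom_iff)
  show "lft (inv f) = tinv (lft f)"
    by (rule tarr.expand) (simp add: a(1-4) tinv_def raw_lft \<open>iso_arrow C f\<close>)
qed

lemma tiso_lft [simp]: "tiso (lft f) \<longleftrightarrow> iso_arrow C f"
  using iso_Arr[of f] raw_lft[of f] by (auto simp: tiso_def)

lemma tisoE:
  assumes "tiso t" obtains f where "t = lft f" "iso_arrow C f" "f \<in> Arr C" "src t = Dom C f" "trg t = Cod C f"
proof -
  have "val t" using assms by (simp add: tiso_def)
  then obtain f where f: "t = lft f" "f \<in> Arr C" "src t = Dom C f" "trg t = Cod C f" by (rule valE)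
  show ?thesis by (rule that[OF f(1) _ f(2-4)]) (use assms f(1) in simp)
qed

lemma val_tinv [simp]: "val (tinv f) \<longleftrightarrow> tiso f"
proof
  assume "tiso f"
  then obtain g where "f = lft g" "iso_arrow C g" by (rule tisoE)
  then show "val (tinv f)" by (simp add: lft_inv[symmetric] inv_typ)
qed (drule val_raw, simp add: tinv_def tiso_def split: if_splits)

lemma tinv_iso [simp]: "tiso f \<Longrightarrow> tiso (tinv f)"
  by (erule tisoE) (simp add: lft_inv[symmetric] iso_inv)

lemma proper_simps [simp]: "proper (lft x)" "proper (tid A)" "proper (g ** f)" "proper (tinv f)"
  unfolding proper_def by (auto simp: val_raw, simp_all add: lft_def tid_def tcmp_def tinv_def tiso_def split: if_splits)

lemma tiso_val [simp]: "tiso f \<Longrightarrow> val f" by (simp add: tiso_def)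

lemma val_proper: "val f \<Longrightarrow> proper f" by (simp add: proper_def)

lemma tiso_proper [simp]: "tiso f \<Longrightarrow> proper f" by (simp add: val_proper)

lemma teqI:
  assumes "proper t" "proper u" "src t = src u" "trg t = trg u" "val t \<longleftrightarrow> val u"
    "val t \<Longrightarrow> val u \<Longrightarrow> t = u" shows "t = u"
  using assms by (auto simp: proper_def intro: tarr.expand)

text \<open>
  If \<open>f\<close> is ill-typed, both sides of an equation natural in \<open>f\<close> are ill-typed with the same ends, hence equal.
  This frees naturality rules of typing conditions.
\<close>
lemma eq_by_val:
  assumes "src t = src u" "trg t = trg u" "proper t" "proper u" "val t \<Longrightarrow> val f" "val u \<Longrightarrow> val f" "val f \<Longrightarrow> t = u"
  shows "t = u"
  using assms by (metis teqI)

lemma lft_inject: "lft f = lft g \<Longrightarrow> f \<in> Arr C \<Longrightarrow> f = g"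
  by (auto simp: lft_def split: if_splits)

lemma tcmp_assoc [simp]: "(h ** g) ** f = h ** g ** f"
proof (rule teqI)
  assume "val ((h ** g) ** f)"
  then have "val h" "val g" "val f" and m: "src g = trg f" "src h = trg g" by auto
  then obtain h' g' f' where *: "h = lft h'" "h' \<in> Arr C" "g = lft g'" "g' \<in> Arr C" "f = lft f'" "f' \<in> Arr C"
    by (metis valE)
  then show "(h ** g) ** f = h ** g ** f"
    using m by (simp add: lft_cmp[symmetric] cmp_typ cmp_assoc[of f' "Dom C f'" "Cod C f'" g' "Cod C g'" h' "Cod C h'"] Hom_iff)
qed auto

lemma tcmp_tid [simp]:
  "trg f = A \<Longrightarrow> proper f \<Longrightarrow> tid A ** f = f" "src f = B \<Longrightarrow> proper f \<Longrightarrow> f ** tid B = f"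
proof -
  show "trg f = A \<Longrightarrow> proper f \<Longrightarrow> tid A ** f = f"
    by (rule teqI) (auto simp: val_Obj tid_Obj Cod_Obj lft_cmp[symmetric] ident_Hom ident_left Hom_iff elim!: valE
      dest!: ident_Hom[unfolded Hom_iff] intro!: arg_cong[of _ _ lft] ident_left[unfolded Hom_iff])
  show "src f = B \<Longrightarrow> proper f \<Longrightarrow> f ** tid B = f"
    by (rule teqI) (auto simp: val_Obj tid_Obj Dom_Obj lft_cmp[symmetric] ident_Hom ident_right Hom_iff elim!: valE
      dest!: ident_Hom[unfolded Hom_iff] intro!: arg_cong[of _ _ lft] ident_right[unfolded Hom_iff])
qed

lemma tinv_cmp [simp]:
  assumes "tiso f" shows "tinv f ** f = tid (src f)" "f ** tinv f = tid (trg f)"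
  using assms by (auto elim!: tisoE simp: lft_inv[symmetric] lft_cmp[symmetric] inv_typ inv_left inv_right
      tid_Obj Dom_Obj Cod_Obj)

lemma tinv_cmp_chain [simp]:
  assumes "tiso f" "proper k"
  shows "trg k = src f \<Longrightarrow> tinv f ** f ** k = k" "trg k = trg f \<Longrightarrow> f ** tinv f ** k = k"
  using assms tcmp_assoc[of "tinv f" f k] tcmp_assoc[of f "tinv f" k] by (simp_all del: tcmp_assoc)

lemma tiso_tid [simp]: "A \<in> Obj C \<Longrightarrow> tiso (tid A)"
  unfolding tiso_def
proof
  assume A: "A \<in> Obj C"
  then have "inverse_arrows C (\<one> A) (\<one> A)"
    using ident_Hom[OF A] ident_left[OF ident_Hom[OF A]] by (auto simp: inverse_arrows_def Hom_iff)
  then show "iso_arrow C (the (raw (tid A)))" using A by (auto simp: tid_def iso_arrow_def)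
qed simp

lemma tisoI:
  assumes "val f" "val g" "g ** f = tid (src f)" "f ** g = tid (trg f)" shows "tiso f"
proof -
  obtain f' g' where *: "f = lft f'" "f' \<in> Arr C" "g = lft g'" "g' \<in> Arr C" using assms by (metis valE)
  have m: "src g = trg f" "trg g = src f" using assms(3,4) by (metis src_trg)+
  have "g' \<cdot> f' = \<one> (Dom C f')" "f' \<cdot> g' = \<one> (Cod C f')"
    using assms(3,4) * m by (auto simp: lft_cmp[symmetric] tid_Obj Dom_Obj Cod_Obj cmp_typ dest!: lft_inject)
  then show ?thesis using * m by (auto simp: iso_arrow_def inverse_arrows_def Hom_iff)
qed

lemma tiso_cmp [simp]: "tiso f \<Longrightarrow> tiso g \<Longrightarrow> src g = trg f \<Longrightarrow> tiso (g ** f)"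
  by (rule tisoI[of _ "tinv f ** tinv g"]) (auto simp: val_proper)

lemma cancel_right:
  assumes "f ** h = g ** h" "tiso h" "proper f" "proper g" "src f = trg h" "src g = trg h"
  shows "f = g"
proof -
  have "f = (f ** h) ** tinv h" using assms(2-) by simp
  also have "\<dots> = (g ** h) ** tinv h" by (simp only: assms(1))
  also have "\<dots> = g" using assms(2-) by simp
  finally show ?thesis .
qed

lemma cancel_left:
  assumes "h ** f = h ** g" "tiso h" "proper f" "proper g" "trg f = src h" "trg g = src h"
  shows "f = g"
proof -
  have "f = tinv h ** h ** f" using assms(2-) by simp
  also have "\<dots> = tinv h ** h ** g" by (simp only: assms(1))
  also have "\<dots> = g" using assms(2-) by simp
  finally show ?thesis .
qed

lemma iso_conj:
  assumes "h ** f = g ** k" "tiso h" "tiso k" "proper f" "proper g" "src h = trg f" "src g = trg k"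
  shows "f ** tinv k = tinv h ** g"
proof -
  have "src f = src k" "trg h = trg g" using arg_cong[OF assms(1), of src] arg_cong[OF assms(1), of trg] by auto
  then have "f ** tinv k = tinv h ** (h ** f) ** tinv k" using assms(2-) by simp
  also have "\<dots> = tinv h ** (g ** k) ** tinv k" by (simp only: assms(1))
  also have "\<dots> = tinv h ** g" using assms(2-) by simp
  finally show ?thesis .
qed

text \<open>
  Composites are bracketed to the right, so a rule for \<open>g ** f\<close> meets an instance inside a longer chain only
  in a form with an arbitrary tail \<open>k\<close>.
\<close>
lemma chain2: "g ** f = r \<Longrightarrow> g ** f ** k = r ** k"
  by (metis tcmp_assoc)
lemma chain3: "h ** g ** f = r \<Longrightarrow> h ** g ** f ** k = r ** k"
  by (metis tcmp_assoc)
lemma chain4: "i ** h ** g ** f = r \<Longrightarrow> i ** h ** g ** f ** k = r ** k"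
  by (metis tcmp_assoc)

end

section \<open>Coherence in monoidal categories\<close>

context monoidal_category
begin

definition ttens :: "('o, 'm) tarr \<Rightarrow> ('o, 'm) tarr \<Rightarrow> ('o, 'm) tarr"  (infixr "\<odot>" 70) where
  "f \<odot> g = Tarr (src f \<otimes> src g) (if val f \<and> val g then Some (the (raw f) \<boxtimes> the (raw g)) else None) (trg f \<otimes> trg g)"

abbreviation pre (infixr "|>" 72) where "A |> f \<equiv> tid A \<odot> f"
abbreviation suf (infixl "<|" 71) where "f <| A \<equiv> f \<odot> tid A"

text \<open>
  Prescribing the ends, here and for the unitors and the braiding, makes them known to the simplifier even
  before the objects are known to be objects of \<open>C\<close>.
\<close>
definition assoc :: "'o \<Rightarrow> 'o \<Rightarrow> 'o \<Rightarrow> ('o, 'm) tarr" where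
  "assoc A B X = Tarr ((A \<otimes> B) \<otimes> X) (raw (lft (\<a> A B X))) (A \<otimes> B \<otimes> X)"

lemmas unit_Obj' [simp] = unit_Obj
lemmas tensor_Obj' [simp] = tensor_Obj

lemma tensor_typ:
  assumes "f \<in> Arr C" "g \<in> Arr C"
  shows "f \<boxtimes> g \<in> Arr C" "Dom C (f \<boxtimes> g) = Dom C f \<otimes> Dom C g" "Cod C (f \<boxtimes> g) = Cod C f \<otimes> Cod C g"
  using tensor_Hom[of f "Dom C f" "Cod C f" g "Dom C g" "Cod C g"] assms by (auto simp: Hom_iff)

lemma assoc_typ: "A \<in> Obj C \<Longrightarrow> B \<in> Obj C \<Longrightarrow> X \<in> Obj C \<Longrightarrow> \<a> A B X \<in> Arr C"
  "A \<in> Obj C \<Longrightarrow> B \<in> Obj C \<Longrightarrow> X \<in> Obj C \<Longrightarrow> Dom C (\<a> A B X) = (A \<otimes> B) \<otimes> X"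
  "A \<in> Obj C \<Longrightarrow> B \<in> Obj C \<Longrightarrow> X \<in> Obj C \<Longrightarrow> Cod C (\<a> A B X) = A \<otimes> B \<otimes> X"
  using assoc_Hom[of A B X] by (auto simp: Hom_iff)

lemma src_trg_tens [simp]: "src (f \<odot> g) = src f \<otimes> src g" "trg (f \<odot> g) = trg f \<otimes> trg g"
  by (simp_all add: ttens_def)

lemma lft_tens: "f \<in> Arr C \<Longrightarrow> g \<in> Arr C \<Longrightarrow> lft (f \<boxtimes> g) = lft f \<odot> lft g"
  by (rule tarr.expand) (simp add: ttens_def tensor_typ, simp add: lft_def tensor_typ)

lemma val_tens [simp]: "val (f \<odot> g) \<longleftrightarrow> val f \<and> val g"
proof
  assume "val f \<and> val g"
  then show "val (f \<odot> g)" by (auto elim!: valE simp: lft_tens[symmetric] tensor_typ)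
qed (drule val_raw, simp add: ttens_def split: if_splits)

lemma proper_tens [simp]: "proper (f \<odot> g)"
  unfolding proper_def by (simp, simp add: ttens_def)

lemma tid_tens [simp]: "A \<in> Obj C \<Longrightarrow> B \<in> Obj C \<Longrightarrow> tid A \<odot> tid B = tid (A \<otimes> B)"
  using ident_Hom[of A] ident_Hom[of B] by (simp add: tid_Obj lft_tens[symmetric] tensor_ident Hom_iff)

lemma tens_cmp:
  assumes "src f' = trg f" "src g' = trg g"
  shows "(f' \<odot> g') ** (f \<odot> g) = (f' ** f) \<odot> (g' ** g)"
proof (rule teqI)
  assume "val ((f' \<odot> g') ** (f \<odot> g))"
  then have "val f" "val f'" "val g" "val g'" by auto
  then obtain a a' b b' where *: "f = lft a" "a \<in> Arr C" "f' = lft a'" "a' \<in> Arr C" "g = lft b" "b \<in> Arr C" "g' = lft b'" "b' \<in> Arr C"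
    by (metis valE)
  then show "(f' \<odot> g') ** (f \<odot> g) = (f' ** f) \<odot> (g' ** g)"
    using assms tensor_cmp[of a "Dom C a" "Cod C a" a' "Cod C a'" b "Dom C b" "Cod C b" b' "Cod C b'"]
    by (simp add: lft_cmp[symmetric] lft_tens[symmetric] tensor_typ cmp_typ Hom_iff)
qed (use assms in auto)

lemma pre_cmp [simp]: "src g = trg f \<Longrightarrow> A |> (g ** f) = A |> g ** A |> f"
  and suf_cmp [simp]: "src g = trg f \<Longrightarrow> (g ** f) <| A = g <| A ** f <| A"
  by (simp_all add: tens_cmp)

text \<open>
  Used as a rewrite rule this moves arrows acting on the right factor to the front of a chain;
  \<open>interchange_rev\<close> gives the opposite normal form.
\<close>
lemma interchange:
  assumes "trg g = Y" "src f = A"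
  shows "f <| Y ** A |> g = trg f |> g ** f <| src g"
proof (rule teqI)
  assume "val (f <| Y ** A |> g)"
  then show "f <| Y ** A |> g = trg f |> g ** f <| src g"
    using assms by (simp add: tens_cmp val_proper del: pre_cmp suf_cmp)
qed (use assms in \<open>auto simp: val_Obj\<close>)

lemma interchange_rev: "src g = Y \<Longrightarrow> trg f = A \<Longrightarrow> proper f \<Longrightarrow> proper g \<Longrightarrow> A |> g ** f <| Y = f <| trg g ** src f |> g"
  by (auto simp: tens_cmp)

lemma interchange':
  assumes "proper f" "proper g"
  shows "f \<odot> g = trg f |> g ** f <| src g" "f \<odot> g = f <| trg g ** src f |> g"
  using assms by (auto simp: tens_cmp)

lemma tens_iso [simp]: "tiso f \<Longrightarrow> tiso g \<Longrightarrow> tiso (f \<odot> g)"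
  by (rule tisoI[of _ "tinv f \<odot> tinv g"]) (auto simp: tens_cmp val_Obj)

lemma tinv_unique: "g ** f = tid (src f) \<Longrightarrow> proper g \<Longrightarrow> src g = trg f \<Longrightarrow> tiso f \<Longrightarrow> tinv f = g"
  by (rule cancel_right[of _ f]) auto

lemma tinv_tens: "tiso f \<Longrightarrow> tiso g \<Longrightarrow> tinv (f \<odot> g) = tinv f \<odot> tinv g"
  by (rule tinv_unique) (auto simp: tens_cmp val_Obj)

lemma assoc_lft: "A \<in> Obj C \<Longrightarrow> B \<in> Obj C \<Longrightarrow> X \<in> Obj C \<Longrightarrow> assoc A B X = lft (\<a> A B X)"
  using assoc_Hom[of A B X] by (auto simp: assoc_def Hom_iff lft_def)

lemma src_trg_assoc [simp]: "src (assoc A B X) = (A \<otimes> B) \<otimes> X" "trg (assoc A B X) = A \<otimes> B \<otimes> X"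
  by (auto simp: assoc_def)

lemma tiso_assoc [simp]: "A \<in> Obj C \<Longrightarrow> B \<in> Obj C \<Longrightarrow> X \<in> Obj C \<Longrightarrow> tiso (assoc A B X)"
  by (simp add: assoc_lft assoc_iso)

definition lunit :: "'o \<Rightarrow> ('o, 'm) tarr" where "lunit A = Tarr (\<I> \<otimes> A) (raw (lft (\<l> A))) A"
definition runit :: "'o \<Rightarrow> ('o, 'm) tarr" where "runit A = Tarr (A \<otimes> \<I>) (raw (lft (\<r> A))) A"

abbreviation assoc_inv :: "'o \<Rightarrow> 'o \<Rightarrow> 'o \<Rightarrow> ('o, 'm) tarr" where "assoc_inv A B X \<equiv> tinv (assoc A B X)"

lemma lunit_lft: "A \<in> Obj C \<Longrightarrow> lunit A = lft (\<l> A)"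
  using lunit_Hom[of A] by (auto simp: lunit_def Hom_iff lft_def)
lemma runit_lft: "A \<in> Obj C \<Longrightarrow> runit A = lft (\<r> A)"
  using runit_Hom[of A] by (auto simp: runit_def Hom_iff lft_def)
lemma src_trg_unitor [simp]: "src (lunit A) = \<I> \<otimes> A" "trg (lunit A) = A" "src (runit A) = A \<otimes> \<I>" "trg (runit A) = A"
  by (auto simp: lunit_def runit_def)
lemma tiso_unitor [simp]: "A \<in> Obj C \<Longrightarrow> tiso (lunit A)" "A \<in> Obj C \<Longrightarrow> tiso (runit A)"
  by (simp_all add: lunit_lft runit_lft lunit_iso runit_iso)

lemma assoc_nat:
  assumes "trg f = A'" "trg g = B'" "trg h = X'"
  shows "assoc A' B' X' ** ((f \<odot> g) \<odot> h) = (f \<odot> (g \<odot> h)) ** assoc (src f) (src g) (src h)"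
proof (rule teqI)
  assume "val (assoc A' B' X' ** ((f \<odot> g) \<odot> h))"
  then have "val f" "val g" "val h" by auto
  then obtain a b d where *: "f = lft a" "a \<in> Arr C" "g = lft b" "b \<in> Arr C" "h = lft d" "d \<in> Arr C"
    by (metis valE)
  have "\<a> (Cod C a) (Cod C b) (Cod C d) \<cdot> ((a \<boxtimes> b) \<boxtimes> d) = (a \<boxtimes> (b \<boxtimes> d)) \<cdot> \<a> (Dom C a) (Dom C b) (Dom C d)"
    using assoc_natural[of a _ _ b _ _ d] * by (simp add: Hom_iff)
  then have "lft (\<a> (Cod C a) (Cod C b) (Cod C d) \<cdot> ((a \<boxtimes> b) \<boxtimes> d)) = lft ((a \<boxtimes> (b \<boxtimes> d)) \<cdot> \<a> (Dom C a) (Dom C b) (Dom C d))"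
    by simp
  moreover have "\<a> A B X \<in> Hom C ((A \<otimes> B) \<otimes> X) (A \<otimes> B \<otimes> X)" if "A \<in> Obj C" "B \<in> Obj C" "X \<in> Obj C" for A B X
    using assoc_Hom[OF that] .
  ultimately show "assoc A' B' X' ** ((f \<odot> g) \<odot> h) = (f \<odot> (g \<odot> h)) ** assoc (src f) (src g) (src h)"
    using * assms[symmetric] by (simp add: lft_cmp lft_tens tensor_typ assoc_lft Dom_Obj Cod_Obj Hom_iff)
qed (use assms in \<open>auto simp: val_Obj\<close>)

lemma assoc_nat_deep:
  assumes "trg h = X'" "A \<in> Obj C" "B \<in> Obj C"
  shows "assoc A B X' ** (A \<otimes> B) |> h = A |> B |> h ** assoc A B (src h)"
  using assoc_nat[of "tid A" A "tid B" B h X'] assms by simp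

lemma lunit_nat: "trg f = A \<Longrightarrow> lunit A ** \<I> |> f = f ** lunit (src f)"
proof (rule teqI)
  assume A: "trg f = A" and "val (lunit A ** \<I> |> f)"
  then obtain a where *: "f = lft a" "a \<in> Arr C" by (auto elim: valE)
  have "lft (\<l> (Cod C a) \<cdot> (\<one> \<I> \<boxtimes> a)) = lft (a \<cdot> \<l> (Dom C a))"
    using lunit_natural[of a] * by (simp add: Hom_iff)
  moreover have "\<l> B \<in> Hom C (\<I> \<otimes> B) B" if "B \<in> Obj C" for B using lunit_Hom[OF that] .
  ultimately show "lunit A ** \<I> |> f = f ** lunit (src f)"
    using * A[symmetric] ident_Hom[of \<I>] by (simp add: lft_cmp lft_tens tensor_typ lunit_lft Dom_Obj Cod_Obj Hom_iff tid_Obj)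
qed (auto simp: val_Obj)

lemma runit_nat: "trg f = A \<Longrightarrow> runit A ** f <| \<I> = f ** runit (src f)"
proof (rule teqI)
  assume A: "trg f = A" and "val (runit A ** f <| \<I>)"
  then obtain a where *: "f = lft a" "a \<in> Arr C" by (auto elim: valE)
  have "lft (\<r> (Cod C a) \<cdot> (a \<boxtimes> \<one> \<I>)) = lft (a \<cdot> \<r> (Dom C a))"
    using runit_natural[of a] * by (simp add: Hom_iff)
  moreover have "\<r> B \<in> Hom C (B \<otimes> \<I>) B" if "B \<in> Obj C" for B using runit_Hom[OF that] .
  ultimately show "runit A ** f <| \<I> = f ** runit (src f)"
    using * A[symmetric] ident_Hom[of \<I>] by (simp add: lft_cmp lft_tens tensor_typ runit_lft Dom_Obj Cod_Obj Hom_iff tid_Obj)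
qed (auto simp: val_Obj)

lemma assoc_pentagon:
  assumes "A \<in> Obj C" "B \<in> Obj C" "X \<in> Obj C" "Y \<in> Obj C"
  shows "A |> assoc B X Y ** assoc A (B \<otimes> X) Y ** assoc A B X <| Y = assoc A B (X \<otimes> Y) ** assoc (A \<otimes> B) X Y"
proof -
  have "\<a> A B X \<in> Hom C ((A \<otimes> B) \<otimes> X) (A \<otimes> B \<otimes> X)" if "A \<in> Obj C" "B \<in> Obj C" "X \<in> Obj C" for A B X
    using assoc_Hom[OF that] .
  then show ?thesis using arg_cong[OF pentagon[OF assms], of lft] assms ident_Hom
    by (simp add: lft_cmp lft_tens tensor_typ cmp_typ assoc_lft Hom_iff tid_Obj)
qed

lemma assoc_triangle:
  assumes "A \<in> Obj C" "B \<in> Obj C"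
  shows "A |> lunit B ** assoc A \<I> B = runit A <| B"
  using arg_cong[OF triangle[OF assms], of lft] assms ident_Hom assoc_Hom[of A \<I> B] lunit_Hom[of B] runit_Hom[of A]
  by (simp add: lft_cmp lft_tens tensor_typ cmp_typ assoc_lft lunit_lft runit_lft Hom_iff tid_Obj)

lemma assoc_inv_nat:
  assumes "trg f = A'" "trg g = B'" "trg h = X'" "val f" "val g" "val h"
  shows "assoc_inv A' B' X' ** (f \<odot> (g \<odot> h)) = ((f \<odot> g) \<odot> h) ** assoc_inv (src f) (src g) (src h)"
  by (rule iso_conj[symmetric]) (use assms assoc_nat in \<open>auto simp: val_Obj\<close>)

lemma unit_pre_faithful:
  assumes "\<I> |> f = \<I> |> g" "val f" "val g" "src f = src g" "trg f = trg g"
  shows "f = g"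
proof (rule cancel_right)
  show "f ** lunit (src f) = g ** lunit (src f)" using lunit_nat[of f] lunit_nat[of g] assms by simp
qed (use assms in \<open>auto simp: val_Obj val_proper\<close>)

lemma unit_suf_faithful:
  assumes "f <| \<I> = g <| \<I>" "val f" "val g" "src f = src g" "trg f = trg g"
  shows "f = g"
proof (rule cancel_right)
  show "f ** runit (src f) = g ** runit (src f)" using runit_nat[of f] runit_nat[of g] assms by simp
qed (use assms in \<open>auto simp: val_Obj val_proper\<close>)

lemma pre_eq2: "g ** f = r \<Longrightarrow> src g = trg f \<Longrightarrow> A |> g ** A |> f = A |> r"
  by auto
lemma pre_eq3: "h ** g ** f = r \<Longrightarrow> src g = trg f \<Longrightarrow> src h = trg g \<Longrightarrow> A |> h ** A |> g ** A |> f = A |> r"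
  by auto

lemma pre_inv [simp]:
  assumes "tiso f" "A \<in> Obj C"
  shows "A |> f ** A |> tinv f = tid (A \<otimes> trg f)" "A |> tinv f ** A |> f = tid (A \<otimes> src f)"
  using assms pre_eq2[of f "tinv f" _ A] pre_eq2[of "tinv f" f _ A] by (simp_all add: val_Obj)

lemma suf_inv [simp]:
  assumes "tiso f" "A \<in> Obj C"
  shows "f <| A ** tinv f <| A = tid (trg f \<otimes> A)" "tinv f <| A ** f <| A = tid (src f \<otimes> A)"
  using assms suf_cmp[of f "tinv f" A] suf_cmp[of "tinv f" f A] by (simp_all add: val_Obj del: suf_cmp)

lemma pre_inv_chain [simp]:
  assumes "tiso f" "A \<in> Obj C" "proper k"
  shows "trg k = A \<otimes> trg f \<Longrightarrow> A |> f ** A |> tinv f ** k = k"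
    "trg k = A \<otimes> src f \<Longrightarrow> A |> tinv f ** A |> f ** k = k"
  using assms by (simp_all add: chain2[OF pre_inv(1)] chain2[OF pre_inv(2)])

lemma suf_inv_chain [simp]:
  assumes "tiso f" "A \<in> Obj C" "proper k"
  shows "trg k = trg f \<otimes> A \<Longrightarrow> f <| A ** tinv f <| A ** k = k"
    "trg k = src f \<otimes> A \<Longrightarrow> tinv f <| A ** f <| A ** k = k"
  using assms by (simp_all add: chain2[OF suf_inv(1)] chain2[OF suf_inv(2)])

lemma pre_inv2 [simp]:
  assumes "tiso f" "A \<in> Obj C" "B \<in> Obj C"
  shows "A |> B |> f ** A |> B |> tinv f = tid (A \<otimes> B \<otimes> trg f)"
    "proper k \<Longrightarrow> trg k = A \<otimes> B \<otimes> trg f \<Longrightarrow> A |> B |> f ** A |> B |> tinv f ** k = k"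
proof -
  show e: "A |> B |> f ** A |> B |> tinv f = tid (A \<otimes> B \<otimes> trg f)"
    using pre_eq2[OF pre_inv(1)[OF assms(1,3)], of A] assms by (simp add: val_Obj)
  show "proper k \<Longrightarrow> trg k = A \<otimes> B \<otimes> trg f \<Longrightarrow> A |> B |> f ** A |> B |> tinv f ** k = k"
    using chain2[OF e, of k] by simp
qed

text \<open>
  Kelly's argument: tensoring with the unit on the left is faithful, and there the equation is the
  pentagon for \<open>I, I, A, B\<close> with the triangle applied to two of its edges.
\<close>
lemma lunit_tensor:
  assumes [simp]: "A \<in> Obj C" "B \<in> Obj C"
  shows "lunit (A \<otimes> B) ** assoc \<I> A B = lunit A <| B"
proof (rule unit_pre_faithful)
  let ?k = "assoc \<I> (\<I> \<otimes> A) B ** assoc \<I> \<I> A <| B"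
  have "\<I> |> (lunit (A \<otimes> B) ** assoc \<I> A B) ** ?k = \<I> |> lunit (A \<otimes> B) ** assoc \<I> \<I> (A \<otimes> B) ** assoc (\<I> \<otimes> \<I>) A B"
    by (simp add: assoc_pentagon)
  also have "\<dots> = (runit \<I> <| (A \<otimes> B)) ** assoc (\<I> \<otimes> \<I>) A B"
    by (simp add: chain2[OF assoc_triangle])
  also have "\<dots> = assoc \<I> A B ** runit \<I> <| A <| B"
    by (simp add: assoc_nat)
  also have "\<dots> = assoc \<I> A B ** (\<I> |> lunit A ** assoc \<I> \<I> A) <| B"
    by (simp only: assoc_triangle assms unit_Obj)
  also have "\<dots> = \<I> |> (lunit A <| B) ** ?k"
    by (simp add: chain2[OF assoc_nat])
  finally show "\<I> |> (lunit (A \<otimes> B) ** assoc \<I> A B) = \<I> |> (lunit A <| B)"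
    by (rule cancel_right) simp_all
qed simp_all

text \<open>
  Dual to \<open>lunit_tensor\<close>, from the pentagon for \<open>A, B, I, I\<close>.
\<close>
lemma runit_tensor:
  assumes [simp]: "A \<in> Obj C" "B \<in> Obj C"
  shows "A |> runit B ** assoc A B \<I> = runit (A \<otimes> B)"
proof (rule unit_suf_faithful)
  have "assoc A B \<I> ** (A |> runit B ** assoc A B \<I>) <| \<I> = A |> (runit B <| \<I>) ** assoc A (B \<otimes> \<I>) \<I> ** assoc A B \<I> <| \<I>"
    by (simp add: chain2[OF assoc_nat])
  also have "\<dots> = A |> (B |> lunit \<I> ** assoc B \<I> \<I>) ** assoc A (B \<otimes> \<I>) \<I> ** assoc A B \<I> <| \<I>"
    by (simp only: assoc_triangle assms unit_Obj)
  also have "\<dots> = A |> B |> lunit \<I> ** assoc A B (\<I> \<otimes> \<I>) ** assoc (A \<otimes> B) \<I> \<I>"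
    by (simp add: assoc_pentagon)
  also have "\<dots> = assoc A B \<I> ** (A \<otimes> B) |> lunit \<I> ** assoc (A \<otimes> B) \<I> \<I>"
    by (simp add: chain2[OF assoc_nat_deep])
  also have "\<dots> = assoc A B \<I> ** runit (A \<otimes> B) <| \<I>" by (simp add: assoc_triangle)
  finally show "(A |> runit B ** assoc A B \<I>) <| \<I> = runit (A \<otimes> B) <| \<I>"
    by (rule cancel_left) simp_all
qed simp_all

text \<open>
  Naturality of the left unitor at itself gives \<open>I \<otimes> \<l> I = \<l> (I \<otimes> I)\<close>; the triangle then compares
  both unitors tensored with \<open>I\<close>.
\<close>
lemma unitors_unit: "lunit \<I> = runit \<I>"
proof (rule unit_suf_faithful)
  have "lunit \<I> ** \<I> |> lunit \<I> = lunit \<I> ** lunit (\<I> \<otimes> \<I>)" by (simp add: lunit_nat)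
  then have "\<I> |> lunit \<I> = lunit (\<I> \<otimes> \<I>)" by (rule cancel_left) simp_all
  then show "lunit \<I> <| \<I> = runit \<I> <| \<I>"
    using lunit_tensor[of \<I> \<I>] assoc_triangle[of \<I> \<I>] by simp
qed simp_all

lemma lunit_inv_nat: "trg f = A \<Longrightarrow> val f \<Longrightarrow> tinv (lunit A) ** f = \<I> |> f ** tinv (lunit (src f))"
  by (rule iso_conj[symmetric]) (auto simp: lunit_nat val_Obj val_proper)

lemma assoc_nat_left: "trg f = A \<Longrightarrow> B \<in> Obj C \<Longrightarrow> X \<in> Obj C \<Longrightarrow> assoc A B X ** f <| B <| X = f <| (B \<otimes> X) ** assoc (src f) B X"
  by (simp add: assoc_nat)

lemma assoc_left: "src f = A \<Longrightarrow> B \<in> Obj C \<Longrightarrow> X \<in> Obj C \<Longrightarrow> f <| (B \<otimes> X) ** assoc A B X = assoc (trg f) B X ** f <| B <| X"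
  by (simp add: assoc_nat)

lemmas struct_nat = interchange chain2[OF interchange] assoc_nat chain2[OF assoc_nat] assoc_nat_deep chain2[OF assoc_nat_deep]

lemma tinv_cmp_distrib: "tiso f \<Longrightarrow> tiso g \<Longrightarrow> src g = trg f \<Longrightarrow> tinv (g ** f) = tinv f ** tinv g"
  by (rule tinv_unique) auto
lemma tinv_tinv: "tiso f \<Longrightarrow> tinv (tinv f) = f"
  by (rule tinv_unique) auto
lemma tinv_tid: "A \<in> Obj C \<Longrightarrow> tinv (tid A) = tid A"
  by (rule tinv_unique) auto
lemmas tinv_dist = tinv_cmp_distrib tinv_tens tinv_tinv tinv_tid

end

section \<open>Crossings on right-nested words\<close>

context braided_monoidal_category
begin

definition tbraid :: "'o \<Rightarrow> 'o \<Rightarrow> ('o, 'm) tarr" where "tbraid A B = Tarr (A \<otimes> B) (raw (lft (c A B))) (B \<otimes> A)"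

lemma tbraid_lft: "A \<in> Obj C \<Longrightarrow> B \<in> Obj C \<Longrightarrow> tbraid A B = lft (c A B)"
  using braid_Hom[of A B] by (auto simp: tbraid_def Hom_iff lft_def)
lemma src_trg_tbraid [simp]: "src (tbraid A B) = A \<otimes> B" "trg (tbraid A B) = B \<otimes> A"
  by (auto simp: tbraid_def)
lemma tiso_tbraid [simp]: "A \<in> Obj C \<Longrightarrow> B \<in> Obj C \<Longrightarrow> tiso (tbraid A B)"
  by (simp add: tbraid_lft braid_iso)

lemma tbraid_nat:
  assumes "trg f = A'" "trg g = B'"
  shows "tbraid A' B' ** (f \<odot> g) = (g \<odot> f) ** tbraid (src f) (src g)"
proof (rule teqI)
  assume "val (tbraid A' B' ** (f \<odot> g))"
  then have "val f" "val g" by auto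
  then obtain a b where *: "f = lft a" "a \<in> Arr C" "g = lft b" "b \<in> Arr C" by (metis valE)
  have "lft (c (Cod C a) (Cod C b) \<cdot> (a \<boxtimes> b)) = lft ((b \<boxtimes> a) \<cdot> c (Dom C a) (Dom C b))"
    using braid_natural[of a _ _ b] * by (simp add: Hom_iff)
  moreover have "c A B \<in> Hom C (A \<otimes> B) (B \<otimes> A)" if "A \<in> Obj C" "B \<in> Obj C" for A B using braid_Hom[OF that] .
  ultimately show "tbraid A' B' ** (f \<odot> g) = (g \<odot> f) ** tbraid (src f) (src g)"
    using * assms[symmetric] by (simp add: lft_cmp lft_tens tensor_typ tbraid_lft Dom_Obj Cod_Obj Hom_iff)
qed (use assms in \<open>auto simp: val_Obj\<close>)

lemma tbraid_hexagon_right: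
  assumes "A \<in> Obj C" "B \<in> Obj C" "X \<in> Obj C"
  shows "assoc B X A ** tbraid A (B \<otimes> X) ** assoc A B X = B |> tbraid A X ** assoc B A X ** tbraid A B <| X"
proof -
  have "\<a> A B X \<in> Hom C ((A \<otimes> B) \<otimes> X) (A \<otimes> B \<otimes> X)" if "A \<in> Obj C" "B \<in> Obj C" "X \<in> Obj C" for A B X
    using assoc_Hom[OF that] .
  moreover have "c A B \<in> Hom C (A \<otimes> B) (B \<otimes> A)" if "A \<in> Obj C" "B \<in> Obj C" for A B using braid_Hom[OF that] .
  ultimately show ?thesis
    using arg_cong[OF hexagon_right[OF assms], of lft] assms ident_Hom
    by (simp add: lft_cmp lft_tens tensor_typ cmp_typ assoc_lft tbraid_lft Hom_iff tid_Obj)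
qed

lemma tbraid_hexagon_left:
  assumes "A \<in> Obj C" "B \<in> Obj C" "X \<in> Obj C"
  shows "assoc_inv X A B ** tbraid (A \<otimes> B) X ** assoc_inv A B X = tbraid A X <| B ** assoc_inv A X B ** A |> tbraid B X"
proof -
  have "\<a> A B X \<in> Hom C ((A \<otimes> B) \<otimes> X) (A \<otimes> B \<otimes> X)" if "A \<in> Obj C" "B \<in> Obj C" "X \<in> Obj C" for A B X
    using assoc_Hom[OF that] .
  moreover have "c A B \<in> Hom C (A \<otimes> B) (B \<otimes> A)" if "A \<in> Obj C" "B \<in> Obj C" for A B using braid_Hom[OF that] .
  ultimately show ?thesis
    using arg_cong[OF hexagon_left[OF assms], of lft] assms ident_Hom
    by (simp add: lft_cmp lft_inv[symmetric] lft_tens tensor_typ cmp_typ inv_typ assoc_iso assoc_lft tbraid_lft Hom_iff tid_Obj)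
qed

text \<open>
  The braiding of the first two letters of a word. In this form a hexagon says that passing a product is
  passing its factors one after the other, with associators only opening brackets.
\<close>
definition braid :: "'o \<Rightarrow> 'o \<Rightarrow> 'o \<Rightarrow> ('o, 'm) tarr" where
  "braid A B X = assoc B A X ** tbraid A B <| X ** assoc_inv A B X"

lemma src_trg_braid [simp]: "src (braid A B X) = A \<otimes> B \<otimes> X" "trg (braid A B X) = B \<otimes> A \<otimes> X" "proper (braid A B X)"
  by (auto simp: braid_def)

lemma tiso_braid [simp]: "A \<in> Obj C \<Longrightarrow> B \<in> Obj C \<Longrightarrow> X \<in> Obj C \<Longrightarrow> tiso (braid A B X)"
  by (auto simp: braid_def)

lemma braid_assoc: "A \<in> Obj C \<Longrightarrow> B \<in> Obj C \<Longrightarrow> X \<in> Obj C \<Longrightarrow> braid A B X ** assoc A B X = assoc B A X ** tbraid A B <| X"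
  by (simp add: braid_def)

lemma braid_nat:
  assumes "trg f = A'" "trg g = B'" "trg h = X'"
  shows "braid A' B' X' ** (f \<odot> (g \<odot> h)) = (g \<odot> (f \<odot> h)) ** braid (src f) (src g) (src h)"
proof (rule teqI)
  assume v: "val (braid A' B' X' ** (f \<odot> (g \<odot> h)))"
  then have w: "val f" "val g" "val h" by auto
  have "(tbraid A' B' <| X') ** ((f \<odot> g) \<odot> h) = ((g \<odot> f) \<odot> h) ** (tbraid (src f) (src g) <| src h)"
    using w assms by (simp add: tens_cmp tbraid_nat val_proper del: pre_cmp suf_cmp)
  then show "braid A' B' X' ** (f \<odot> (g \<odot> h)) = (g \<odot> (f \<odot> h)) ** braid (src f) (src g) (src h)"
    using assms w by (simp add: braid_def assoc_inv_nat chain2[OF assoc_nat] chain2[of "tbraid A' B' <| X'"])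
qed (use assms in \<open>auto simp: val_Obj braid_def\<close>)

lemma braid_nat_deep:
  assumes "trg h = X'" "A \<in> Obj C" "B \<in> Obj C"
  shows "braid A B X' ** A |> B |> h = B |> A |> h ** braid A B (src h)"
  using braid_nat[of "tid A" A "tid B" B h X'] assms by simp

lemma braid_hexagon_right:
  assumes [simp]: "A \<in> Obj C" "B \<in> Obj C" "E \<in> Obj C" "X \<in> Obj C"
  shows "assoc B E (A \<otimes> X) ** braid A (B \<otimes> E) X = B |> braid A E X ** braid A B (E \<otimes> X) ** A |> assoc B E X"
proof -
  let ?k = "assoc A (B \<otimes> E) X ** assoc A B E <| X"
  have "(assoc B E (A \<otimes> X) ** braid A (B \<otimes> E) X) ** ?k
      = assoc B E (A \<otimes> X) ** assoc (B \<otimes> E) A X ** tbraid A (B \<otimes> E) <| X ** assoc A B E <| X"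
    by (simp add: chain2[OF braid_assoc])
  also have "\<dots> = B |> assoc E A X ** assoc B (E \<otimes> A) X ** (assoc B E A ** tbraid A (B \<otimes> E) ** assoc A B E) <| X"
    by (simp add: chain2[OF assoc_pentagon[symmetric]])
  also have "\<dots> = B |> assoc E A X ** assoc B (E \<otimes> A) X ** (B |> tbraid A E ** assoc B A E ** tbraid A B <| E) <| X"
    by (simp only: tbraid_hexagon_right assms)
  also have "\<dots> = B |> (braid A E X ** assoc A E X) ** assoc B (A \<otimes> E) X ** assoc B A E <| X ** (tbraid A B <| E) <| X"
    by (simp add: braid_assoc chain2[OF assoc_nat])
  also have "\<dots> = B |> braid A E X ** assoc B A (E \<otimes> X) ** assoc (B \<otimes> A) E X ** (tbraid A B <| E) <| X"
    by (simp add: chain3[OF assoc_pentagon])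
  also have "\<dots> = B |> braid A E X ** braid A B (E \<otimes> X) ** assoc A B (E \<otimes> X) ** assoc (A \<otimes> B) E X"
    by (simp add: assoc_nat chain2[OF braid_assoc])
  also have "\<dots> = (B |> braid A E X ** braid A B (E \<otimes> X) ** A |> assoc B E X) ** ?k"
    by (simp add: assoc_pentagon)
  finally show ?thesis by (rule cancel_right) auto
qed

lemma braid_hexagon_left:
  assumes [simp]: "A \<in> Obj C" "B \<in> Obj C" "E \<in> Obj C" "X \<in> Obj C"
  shows "E |> assoc A B X ** braid (A \<otimes> B) E X = braid A E (B \<otimes> X) ** A |> braid B E X ** assoc A B (E \<otimes> X)"
proof -
  have hex: "assoc_inv E A B ** tbraid (A \<otimes> B) E = tbraid A E <| B ** assoc_inv A E B ** A |> tbraid B E ** assoc A B E"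
    using chain3[OF tbraid_hexagon_left[of A B E], of "assoc A B E"] by simp
  let ?k = "assoc (A \<otimes> B) E X"
  have "(E |> assoc A B X ** braid (A \<otimes> B) E X) ** ?k = E |> assoc A B X ** assoc E (A \<otimes> B) X ** tbraid (A \<otimes> B) E <| X"
    by (simp add: braid_assoc)
  also have "\<dots> = (E |> assoc A B X ** assoc E (A \<otimes> B) X ** assoc E A B <| X) ** (assoc_inv E A B ** tbraid (A \<otimes> B) E) <| X"
    by simp
  also have "\<dots> = assoc E A (B \<otimes> X) ** assoc (E \<otimes> A) B X ** (tbraid A E <| B ** assoc_inv A E B ** A |> tbraid B E ** assoc A B E) <| X"
    by (simp only: hex assoc_pentagon assms tcmp_assoc)
  also have "\<dots> = assoc E A (B \<otimes> X) ** tbraid A E <| (B \<otimes> X) ** assoc (A \<otimes> E) B X ** assoc_inv A E B <| X ** (A |> tbraid B E) <| X ** assoc A B E <| X"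
    by (simp add: chain2[OF assoc_nat])
  also have "\<dots> = braid A E (B \<otimes> X) ** (assoc A E (B \<otimes> X) ** assoc (A \<otimes> E) B X) ** assoc_inv A E B <| X ** (A |> tbraid B E) <| X ** assoc A B E <| X"
    by (simp add: chain2[OF braid_assoc])
  also have "\<dots> = braid A E (B \<otimes> X) ** A |> assoc E B X ** assoc A (E \<otimes> B) X ** (assoc A E B ** assoc_inv A E B) <| X ** (A |> tbraid B E) <| X ** assoc A B E <| X"
    by (simp only: assoc_pentagon[symmetric] assms) simp
  also have "\<dots> = braid A E (B \<otimes> X) ** A |> (assoc E B X ** tbraid B E <| X) ** assoc A (B \<otimes> E) X ** assoc A B E <| X"
    by (simp add: chain2[OF assoc_nat])
  also have "\<dots> = braid A E (B \<otimes> X) ** A |> (braid B E X ** assoc B E X) ** assoc A (B \<otimes> E) X ** assoc A B E <| X"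
    by (simp only: braid_assoc assms)
  also have "\<dots> = (braid A E (B \<otimes> X) ** A |> braid B E X ** assoc A B (E \<otimes> X)) ** ?k"
    by (simp add: assoc_pentagon)
  finally show ?thesis by (rule cancel_right) auto
qed

text \<open>
  Tensoring a crossing on the right only lengthens the untouched rest of the word.
\<close>
lemma braid_whisker:
  assumes [simp]: "A \<in> Obj C" "B \<in> Obj C" "X \<in> Obj C" "Y \<in> Obj C"
  shows "B |> assoc A X Y ** assoc B (A \<otimes> X) Y ** braid A B X <| Y = braid A B (X \<otimes> Y) ** A |> assoc B X Y ** assoc A (B \<otimes> X) Y"
proof -
  let ?k = "assoc A B X <| Y"
  have "(B |> assoc A X Y ** assoc B (A \<otimes> X) Y ** braid A B X <| Y) ** ?k
    = B |> assoc A X Y ** assoc B (A \<otimes> X) Y ** (braid A B X ** assoc A B X) <| Y" by simp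
  also have "\<dots> = B |> assoc A X Y ** assoc B (A \<otimes> X) Y ** assoc B A X <| Y ** (tbraid A B <| X) <| Y"
    by (simp add: braid_assoc)
  also have "\<dots> = assoc B A (X \<otimes> Y) ** tbraid A B <| (X \<otimes> Y) ** assoc (A \<otimes> B) X Y"
    by (simp add: chain3[OF assoc_pentagon] assoc_nat)
  also have "\<dots> = braid A B (X \<otimes> Y) ** (assoc A B (X \<otimes> Y) ** assoc (A \<otimes> B) X Y)"
    by (simp add: chain2[OF braid_assoc])
  also have "\<dots> = (braid A B (X \<otimes> Y) ** A |> assoc B X Y ** assoc A (B \<otimes> X) Y) ** ?k"
    by (simp add: assoc_pentagon)
  finally show ?thesis by (rule cancel_right) auto
qed

text \<open>
  The hexagon with two unit letters, compared by means of the unitors of \<open>I\<close>, leaves the crossing tensored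
  with the unit, and tensoring with the unit is faithful. The same proof gives \<open>braid_unit_left\<close>.
\<close>
lemma braid_unit_right:
  assumes [simp]: "A \<in> Obj C" "X \<in> Obj C"
  shows "lunit (A \<otimes> X) ** braid A \<I> X = A |> lunit X"
proof (rule unit_pre_faithful)
  let ?k = "braid A \<I> (\<I> \<otimes> X) ** A |> assoc \<I> \<I> X"
  have u: "lunit \<I> <| Y = \<I> |> lunit Y ** assoc \<I> \<I> Y" if "Y \<in> Obj C" for Y
    using that by (simp add: assoc_triangle unitors_unit)
  have "\<I> |> A |> lunit X ** ?k = braid A \<I> X ** A |> (\<I> |> lunit X ** assoc \<I> \<I> X)"
    by (simp add: chain2[OF braid_nat_deep])
  also have "\<dots> = braid A \<I> X ** A |> (lunit \<I> <| X)" by (simp add: u)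
  also have "\<dots> = lunit \<I> <| (A \<otimes> X) ** braid A (\<I> \<otimes> \<I>) X" by (simp add: braid_nat)
  also have "\<dots> = \<I> |> (lunit (A \<otimes> X) ** braid A \<I> X) ** ?k"
    by (simp add: u braid_hexagon_right)
  finally show "\<I> |> (lunit (A \<otimes> X) ** braid A \<I> X) = \<I> |> A |> lunit X"
    by (rule cancel_right[OF sym]) simp_all
qed auto

lemma braid_unit_left:
  assumes [simp]: "A \<in> Obj C" "X \<in> Obj C"
  shows "A |> lunit X ** braid \<I> A X = lunit (A \<otimes> X)"
proof (rule unit_pre_faithful)
  have u: "lunit \<I> <| Y = \<I> |> lunit Y ** assoc \<I> \<I> Y" if "Y \<in> Obj C" for Y
    using that by (simp add: assoc_triangle unitors_unit)
  have "braid \<I> A X ** \<I> |> (A |> lunit X ** braid \<I> A X) ** assoc \<I> \<I> (A \<otimes> X)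
      = A |> (\<I> |> lunit X ** assoc \<I> \<I> X) ** braid (\<I> \<otimes> \<I>) A X"
    by (simp add: chain2[OF braid_nat_deep] braid_hexagon_left)
  also have "\<dots> = A |> (lunit \<I> <| X) ** braid (\<I> \<otimes> \<I>) A X" by (simp add: u)
  also have "\<dots> = braid \<I> A X ** lunit \<I> <| (A \<otimes> X)" using braid_nat[of "lunit \<I>" \<I> "tid A" A "tid X" X] by simp
  also have "\<dots> = braid \<I> A X ** \<I> |> lunit (A \<otimes> X) ** assoc \<I> \<I> (A \<otimes> X)" by (simp add: u)
  finally have "\<I> |> (A |> lunit X ** braid \<I> A X) ** assoc \<I> \<I> (A \<otimes> X) = \<I> |> lunit (A \<otimes> X) ** assoc \<I> \<I> (A \<otimes> X)"
    by (rule cancel_left) simp_all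
  then show "\<I> |> (A |> lunit X ** braid \<I> A X) = \<I> |> lunit (A \<otimes> X)"
    by (rule cancel_right) simp_all
qed auto

end

section \<open>The structure of a Hopf algebra as operators\<close>

context hopf_algebra
begin

lemma H_Obj [simp]: "H \<in> Obj C" by (rule carr_Obj)

lemma hopf_typ [simp]:
  "\<mu> \<in> Arr C" "Dom C \<mu> = H \<otimes> H" "Cod C \<mu> = H" "\<eta> \<in> Arr C" "Dom C \<eta> = \<I>" "Cod C \<eta> = H"
  "\<Delta> \<in> Arr C" "Dom C \<Delta> = H" "Cod C \<Delta> = H \<otimes> H" "\<epsilon> \<in> Arr C" "Dom C \<epsilon> = H" "Cod C \<epsilon> = \<I>"
  "s \<in> Arr C" "Dom C s = H" "Cod C s = H"
  using mult_Hom unt_Hom comult_Hom counit_Hom antipode_Hom by (auto simp: Hom_iff)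

text \<open>
  The structure maps of \<open>H\<close> acting on the first letters of a word with rest \<open>X\<close>. They are natural in \<open>X\<close> and
  satisfy the Hopf algebra axioms without associators.
\<close>
definition mult :: "'o \<Rightarrow> ('o, 'm) tarr" where "mult X = lft \<mu> <| X ** assoc_inv H H X"
definition unt :: "'o \<Rightarrow> ('o, 'm) tarr" where "unt X = lft \<eta> <| X ** tinv (lunit X)"
definition comult :: "'o \<Rightarrow> ('o, 'm) tarr" where "comult X = assoc H H X ** lft \<Delta> <| X"
definition counit :: "'o \<Rightarrow> ('o, 'm) tarr" where "counit X = lunit X ** lft \<epsilon> <| X"
definition anti :: "'o \<Rightarrow> ('o, 'm) tarr" where "anti X = lft s <| X"

lemma op_typ [simp]:
  "src (mult X) = H \<otimes> H \<otimes> X" "trg (mult X) = H \<otimes> X" "proper (mult X)"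
  "src (unt X) = X" "trg (unt X) = H \<otimes> X" "proper (unt X)"
  "src (comult X) = H \<otimes> X" "trg (comult X) = H \<otimes> H \<otimes> X" "proper (comult X)"
  "src (counit X) = H \<otimes> X" "trg (counit X) = X" "proper (counit X)"
  "src (anti X) = H \<otimes> X" "trg (anti X) = H \<otimes> X" "proper (anti X)"
  by (auto simp: mult_def unt_def comult_def counit_def anti_def)

lemma op_val [simp]:
  assumes "X \<in> Obj C" shows "val (mult X)" "val (unt X)" "val (comult X)" "val (counit X)" "val (anti X)"
  using assms by (auto simp: mult_def unt_def comult_def counit_def anti_def)

lemma mult_nat: "trg f = Y \<Longrightarrow> mult Y ** H |> H |> f = H |> f ** mult (src f)"
  by (rule eq_by_val[of _ _ f]) (auto simp: mult_def assoc_inv_nat struct_nat val_Obj)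
lemma unt_nat: "trg f = Y \<Longrightarrow> unt Y ** f = H |> f ** unt (src f)"
  by (rule eq_by_val[of _ _ f]) (auto simp: unt_def lunit_inv_nat struct_nat val_Obj)
lemma comult_nat: "trg f = Y \<Longrightarrow> comult Y ** H |> f = H |> H |> f ** comult (src f)"
  by (rule eq_by_val[of _ _ f]) (auto simp: comult_def struct_nat val_Obj)
lemma counit_nat: "trg f = Y \<Longrightarrow> counit Y ** H |> f = f ** counit (src f)"
  by (rule eq_by_val[of _ _ f]) (auto simp: counit_def chain2[OF lunit_nat] struct_nat val_Obj)
lemma anti_nat: "trg f = Y \<Longrightarrow> anti Y ** H |> f = H |> f ** anti (src f)"
  by (simp add: anti_def struct_nat)

lemma mult_assoc_op: assumes [simp]: "X \<in> Obj C" shows "mult X ** H |> mult X = mult X ** mult (H \<otimes> X)"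
proof -
  let ?k = "assoc H H (H \<otimes> X) ** assoc (H \<otimes> H) H X" and ?M = "lft \<mu>"
  have ass: "?M ** ?M <| H = ?M ** H |> ?M ** assoc H H H"
    using arg_cong[OF mult_assoc, of lft] ident_Hom assoc_Hom[of H H H]
    by (simp add: lft_cmp lft_tens tensor_typ cmp_typ assoc_lft Hom_iff tid_Obj)
  have "(mult X ** mult (H \<otimes> X)) ** ?k = (?M ** ?M <| H) <| X"
    by (simp add: mult_def chain2[OF assoc_left] assoc_left)
  also have "\<dots> = (?M ** H |> ?M ** assoc H H H) <| X" by (simp only: ass)
  also have "\<dots> = ?M <| X ** assoc_inv H H X ** H |> (?M <| X) ** assoc H (H \<otimes> H) X ** assoc H H H <| X"
    by (simp add: assoc_inv_nat chain2[OF assoc_inv_nat])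
  also have "\<dots> = (mult X ** H |> mult X) ** ?k"
    by (simp add: mult_def assoc_pentagon[symmetric])
  finally show ?thesis by (rule cancel_right[OF sym]) auto
qed

lemma mult_unit_op: assumes [simp]: "X \<in> Obj C" shows "mult X ** unt (H \<otimes> X) = tid (H \<otimes> X)"
proof -
  have e: "lft \<mu> ** lft \<eta> <| H = lunit H"
    using arg_cong[OF mult_unt_left, of lft] ident_Hom
    by (simp add: lft_cmp lft_tens tensor_typ cmp_typ lunit_lft Hom_iff tid_Obj)
  have "mult X ** unt (H \<otimes> X) ** lunit (H \<otimes> X) ** assoc \<I> H X = lft \<mu> <| X ** assoc_inv H H X ** lft \<eta> <| (H \<otimes> X) ** assoc \<I> H X"
    by (simp add: mult_def unt_def)
  also have "\<dots> = (lft \<mu> ** lft \<eta> <| H) <| X"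
    by (simp add: assoc_left)
  also have "\<dots> = lunit (H \<otimes> X) ** assoc \<I> H X" by (simp only: e lunit_tensor assms H_Obj)
  finally have "(mult X ** unt (H \<otimes> X)) ** lunit (H \<otimes> X) ** assoc \<I> H X = tid (H \<otimes> X) ** lunit (H \<otimes> X) ** assoc \<I> H X" by simp
  then show ?thesis by (rule cancel_right) auto
qed

lemma mult_unit_op': assumes [simp]: "X \<in> Obj C" shows "mult X ** H |> unt X = tid (H \<otimes> X)"
proof -
  have e: "lft \<mu> ** H |> lft \<eta> = runit H"
    using arg_cong[OF mult_unt_right, of lft] ident_Hom
    by (simp add: lft_cmp lft_tens tensor_typ cmp_typ runit_lft Hom_iff tid_Obj)
  have "mult X ** H |> unt X ** H |> lunit X ** assoc H \<I> X = lft \<mu> <| X ** assoc_inv H H X ** H |> (lft \<eta> <| X) ** assoc H \<I> X"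
    by (simp add: mult_def unt_def)
  also have "\<dots> = (lft \<mu> ** H |> lft \<eta>) <| X"
    by (simp add: assoc_inv_nat chain2[OF assoc_inv_nat])
  also have "\<dots> = H |> lunit X ** assoc H \<I> X" by (simp only: e assoc_triangle assms H_Obj)
  finally have "(mult X ** H |> unt X) ** H |> lunit X ** assoc H \<I> X = tid (H \<otimes> X) ** H |> lunit X ** assoc H \<I> X" by simp
  then show ?thesis by (rule cancel_right) auto
qed

lemma comult_coassoc_op: assumes [simp]: "X \<in> Obj C" shows "comult (H \<otimes> X) ** comult X = H |> comult X ** comult X"
proof -
  have e: "assoc H H H ** lft \<Delta> <| H ** lft \<Delta> = H |> lft \<Delta> ** lft \<Delta>"
    using arg_cong[OF comult_coassoc, of lft] ident_Hom assoc_Hom[of H H H]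
    by (simp add: lft_cmp lft_tens tensor_typ cmp_typ assoc_lft Hom_iff tid_Obj)
  have "comult (H \<otimes> X) ** comult X = assoc H H (H \<otimes> X) ** assoc (H \<otimes> H) H X ** (lft \<Delta> <| H) <| X ** lft \<Delta> <| X"
    by (simp add: comult_def chain2[OF assoc_left])
  also have "\<dots> = H |> assoc H H X ** assoc H (H \<otimes> H) X ** (assoc H H H ** lft \<Delta> <| H ** lft \<Delta>) <| X"
    by (simp add: chain2[OF assoc_pentagon[symmetric]])
  also have "\<dots> = H |> assoc H H X ** assoc H (H \<otimes> H) X ** (H |> lft \<Delta> ** lft \<Delta>) <| X"
    by (simp only: e)
  also have "\<dots> = H |> comult X ** comult X" by (simp add: comult_def struct_nat)
  finally show ?thesis .
qed

lemma counit_comult_op: assumes [simp]: "X \<in> Obj C" shows "counit (H \<otimes> X) ** comult X = tid (H \<otimes> X)"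
proof -
  have e: "lunit H ** lft \<epsilon> <| H ** lft \<Delta> = tid H"
    using arg_cong[OF comult_counit_left, of lft] ident_Hom lunit_Hom[of H]
    by (simp add: lft_cmp lft_tens tensor_typ cmp_typ lunit_lft Hom_iff tid_Obj)
  have "counit (H \<otimes> X) ** comult X = lunit (H \<otimes> X) ** assoc \<I> H X ** (lft \<epsilon> <| H) <| X ** lft \<Delta> <| X"
    by (simp add: counit_def comult_def chain2[OF assoc_left])
  also have "\<dots> = (lunit H ** lft \<epsilon> <| H ** lft \<Delta>) <| X" by (simp add: chain2[OF lunit_tensor])
  also have "\<dots> = tid (H \<otimes> X)" by (simp only: e) simp
  finally show ?thesis .
qed

lemma counit_comult_op': assumes [simp]: "X \<in> Obj C" shows "H |> counit X ** comult X = tid (H \<otimes> X)"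
proof -
  have e: "runit H ** H |> lft \<epsilon> ** lft \<Delta> = tid H"
    using arg_cong[OF comult_counit_right, of lft] ident_Hom runit_Hom[of H]
    by (simp add: lft_cmp lft_tens tensor_typ cmp_typ runit_lft Hom_iff tid_Obj)
  have "H |> counit X ** comult X = H |> lunit X ** assoc H \<I> X ** (H |> lft \<epsilon>) <| X ** lft \<Delta> <| X"
    by (simp add: counit_def comult_def struct_nat)
  also have "\<dots> = (runit H ** H |> lft \<epsilon> ** lft \<Delta>) <| X" by (simp add: chain2[OF assoc_triangle])
  also have "\<dots> = tid (H \<otimes> X)" by (simp only: e) simp
  finally show ?thesis .
qed

lemma comult_unit_op: assumes [simp]: "X \<in> Obj C" shows "comult X ** unt X = unt (H \<otimes> X) ** unt X"
proof -
  have e: "lft \<Delta> ** lft \<eta> = (lft \<eta> \<odot> lft \<eta>) ** tinv (lunit \<I>)"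
    using arg_cong[OF comult_unt, of lft] ident_Hom lunit_Hom[of \<I>] lunit_iso[of \<I>]
    by (simp add: lft_cmp lft_tens lft_inv[symmetric] inv_typ tensor_typ cmp_typ lunit_lft Hom_iff tid_Obj)
  have "\<I> |> lunit X ** assoc \<I> \<I> X ** tinv (lunit \<I>) <| X = \<I> |> lunit X ** \<I> |> tinv (lunit X)"
    by (simp add: chain2[OF assoc_triangle] unitors_unit)
  then have l: "assoc \<I> \<I> X ** tinv (lunit \<I>) <| X = \<I> |> tinv (lunit X)"
    by (rule cancel_left) simp_all
  have "comult X ** unt X = assoc H H X ** (lft \<Delta> ** lft \<eta>) <| X ** tinv (lunit X)" by (simp add: comult_def unt_def)
  also have "\<dots> = assoc H H X ** ((lft \<eta> \<odot> lft \<eta>) ** tinv (lunit \<I>)) <| X ** tinv (lunit X)" by (simp only: e)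
  also have "\<dots> = (lft \<eta> \<odot> (lft \<eta> \<odot> tid X)) ** (assoc \<I> \<I> X ** tinv (lunit \<I>) <| X) ** tinv (lunit X)"
    by (simp add: chain2[OF assoc_nat])
  also have "\<dots> = lft \<eta> <| (H \<otimes> X) ** \<I> |> unt X ** tinv (lunit X)"
    unfolding l by (simp add: interchange'(2)[of "lft \<eta>" "lft \<eta> <| X"] unt_def)
  also have "\<dots> = unt (H \<otimes> X) ** unt X"
    using lunit_inv_nat[of "unt X" "H \<otimes> X"] by (simp add: unt_def[of "H \<otimes> X"])
  finally show ?thesis .
qed

lemma counit_mult_op: assumes [simp]: "X \<in> Obj C" shows "counit X ** mult X = counit X ** H |> counit X"
proof -
  have e: "lft \<epsilon> ** lft \<mu> = lunit \<I> ** (lft \<epsilon> \<odot> lft \<epsilon>)"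
    using arg_cong[OF counit_mult, of lft] ident_Hom lunit_Hom[of \<I>]
    by (simp add: lft_cmp lft_tens tensor_typ cmp_typ lunit_lft Hom_iff tid_Obj)
  have "(counit X ** mult X) ** assoc H H X = lunit X ** (lft \<epsilon> ** lft \<mu>) <| X" by (simp add: counit_def mult_def)
  also have "\<dots> = lunit X ** runit \<I> <| X ** (lft \<epsilon> \<odot> lft \<epsilon>) <| X" by (simp only: e) (simp add: unitors_unit)
  also have "\<dots> = lunit X ** \<I> |> lunit X ** (lft \<epsilon> \<odot> (lft \<epsilon> \<odot> tid X)) ** assoc H H X"
    by (simp add: assoc_triangle[symmetric] assoc_nat)
  also have "\<dots> = (counit X ** H |> counit X) ** assoc H H X"
    using interchange'(1)[of "lft \<epsilon>" "lft \<epsilon> <| X"] by (simp add: counit_def struct_nat chain2[OF lunit_nat])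
  finally show ?thesis by (rule cancel_right) auto
qed

lemma counit_unit_op: assumes [simp]: "X \<in> Obj C" shows "counit X ** unt X = tid X"
proof -
  have e: "lft \<epsilon> ** lft \<eta> = tid \<I>"
    using arg_cong[OF counit_unt, of lft] by (simp add: lft_cmp tid_Obj)
  have "counit X ** unt X = lunit X ** (lft \<epsilon> ** lft \<eta>) <| X ** tinv (lunit X)" by (simp add: counit_def unt_def)
  then show ?thesis by (simp only: e) simp
qed

lemma antipode_left_op: assumes [simp]: "X \<in> Obj C" shows "mult X ** anti (H \<otimes> X) ** comult X = unt X ** counit X"
proof -
  have e: "lft \<mu> ** lft s <| H ** lft \<Delta> = lft \<eta> ** lft \<epsilon>"
    using arg_cong[OF antipode_left, of lft] ident_Hom
    by (simp add: lft_cmp lft_tens tensor_typ cmp_typ Hom_iff tid_Obj)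
  have "mult X ** anti (H \<otimes> X) ** comult X = (lft \<mu> ** lft s <| H ** lft \<Delta>) <| X"
    by (simp add: mult_def anti_def comult_def chain2[OF assoc_left])
  also have "\<dots> = unt X ** counit X" by (simp only: e) (simp add: unt_def counit_def)
  finally show ?thesis .
qed

lemma antipode_right_op: assumes [simp]: "X \<in> Obj C" shows "mult X ** H |> anti X ** comult X = unt X ** counit X"
proof -
  have e: "lft \<mu> ** H |> lft s ** lft \<Delta> = lft \<eta> ** lft \<epsilon>"
    using arg_cong[OF antipode_right, of lft] ident_Hom
    by (simp add: lft_cmp lft_tens tensor_typ cmp_typ Hom_iff tid_Obj)
  have "mult X ** H |> anti X ** comult X = (lft \<mu> ** H |> lft s ** lft \<Delta>) <| X"
    by (simp add: mult_def anti_def comult_def chain2[OF assoc_inv_nat])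
  also have "\<dots> = unt X ** counit X" by (simp only: e) (simp add: unt_def counit_def)
  finally show ?thesis .
qed

definition mid :: "'o \<Rightarrow> 'o \<Rightarrow> 'o \<Rightarrow> 'o \<Rightarrow> ('o, 'm) tarr" where
  "mid A B X Y = assoc_inv A X (B \<otimes> Y) ** A |> braid B X Y ** assoc A B (X \<otimes> Y)"

lemma mid_braid_typ:
  assumes "A \<in> Obj C" "B \<in> Obj C" "X \<in> Obj C" "Y \<in> Obj C"
  shows "mid_braid C c A B X Y \<in> Hom C ((A \<otimes> B) \<otimes> X \<otimes> Y) ((A \<otimes> X) \<otimes> B \<otimes> Y)"
    and "lft (mid_braid C c A B X Y) = mid A B X Y"
proof -
  have *: "\<a> A B X \<in> Hom C ((A \<otimes> B) \<otimes> X) (A \<otimes> B \<otimes> X)" if "A \<in> Obj C" "B \<in> Obj C" "X \<in> Obj C" for A B X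
    using assoc_Hom[OF that] .
  have **: "c A B \<in> Hom C (A \<otimes> B) (B \<otimes> A)" if "A \<in> Obj C" "B \<in> Obj C" for A B using braid_Hom[OF that] .
  show "mid_braid C c A B X Y \<in> Hom C ((A \<otimes> B) \<otimes> X \<otimes> Y) ((A \<otimes> X) \<otimes> B \<otimes> Y)"
    "lft (mid_braid C c A B X Y) = mid A B X Y"
    using assms * ** ident_Hom unfolding mid_braid_def mid_def braid_def
    by (simp_all add: lft_cmp lft_inv[symmetric] lft_tens tensor_typ cmp_typ inv_typ assoc_iso assoc_lft tbraid_lft Hom_iff tid_Obj)
qed

text \<open>
  Two pentagons move the middle braiding into the right-nested word, where it acts below the first letter.
\<close>
lemma comult_mult_op: assumes [simp]: "X \<in> Obj C"
  shows "comult X ** mult X = mult (H \<otimes> X) ** H |> H |> mult X ** H |> braid H H (H \<otimes> X) ** comult (H \<otimes> H \<otimes> X) ** H |> comult X"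
proof (rule cancel_right)
  let ?M = "lft \<mu>" and ?D = "lft \<Delta>"
  have e: "?D ** ?M = ?M <| H ** (H \<otimes> H) |> ?M ** mid H H H H ** ?D <| (H \<otimes> H) ** H |> ?D"
    using arg_cong[OF comult_mult, of lft] ident_Hom mid_braid_typ[of H H H H]
      interchange'(2)[of ?M ?M] interchange'(2)[of ?D ?D]
    by (simp add: lft_cmp lft_tens tensor_typ cmp_typ Hom_iff tid_Obj)
  let ?k = "assoc H H (H \<otimes> H \<otimes> X) ** (H \<otimes> H) |> assoc H H X"
  have p: "?k ** assoc (H \<otimes> H) (H \<otimes> H) X ** assoc_inv H H (H \<otimes> H) <| X
      = H |> H |> assoc H H X ** H |> assoc H (H \<otimes> H) X ** assoc H (H \<otimes> H \<otimes> H) X"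
    by (simp add: chain2[OF assoc_nat_deep] chain2[OF assoc_pentagon[symmetric]])
  have "?k ** assoc (H \<otimes> H) (H \<otimes> H) X ** mid H H H H <| X ** ?D <| (H \<otimes> H) <| X ** (H |> ?D) <| X
      = (?k ** assoc (H \<otimes> H) (H \<otimes> H) X ** assoc_inv H H (H \<otimes> H) <| X)
        ** (H |> braid H H H) <| X ** assoc H H (H \<otimes> H) <| X ** ?D <| (H \<otimes> H) <| X ** (H |> ?D) <| X"
    by (simp add: mid_def)
  also have "\<dots> = H |> (H |> assoc H H X ** assoc H (H \<otimes> H) X ** braid H H H <| X) ** assoc H (H \<otimes> H \<otimes> H) X
        ** assoc H H (H \<otimes> H) <| X ** ?D <| (H \<otimes> H) <| X ** (H |> ?D) <| X"
    unfolding p by (simp add: chain2[OF assoc_nat])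
  also have "\<dots> = H |> braid H H (H \<otimes> X) ** H |> H |> assoc H H X ** assoc H H ((H \<otimes> H) \<otimes> X) ** assoc (H \<otimes> H) (H \<otimes> H) X
        ** ?D <| (H \<otimes> H) <| X ** (H |> ?D) <| X"
    by (simp only: braid_whisker assms H_Obj) (simp add: chain3[OF assoc_pentagon])
  also have "\<dots> = H |> braid H H (H \<otimes> X) ** comult (H \<otimes> H \<otimes> X) ** H |> comult X ** assoc H H X"
    by (simp add: comult_def struct_nat)
  also have "\<dots> = ?k ** (H \<otimes> H) |> assoc_inv H H X ** assoc_inv H H (H \<otimes> H \<otimes> X) ** H |> braid H H (H \<otimes> X) ** comult (H \<otimes> H \<otimes> X) ** H |> comult X ** assoc H H X"
    by simp
  finally have core: "assoc (H \<otimes> H) (H \<otimes> H) X ** mid H H H H <| X ** ?D <| (H \<otimes> H) <| X ** (H |> ?D) <| X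
    = (H \<otimes> H) |> assoc_inv H H X ** assoc_inv H H (H \<otimes> H \<otimes> X) ** H |> braid H H (H \<otimes> X) ** comult (H \<otimes> H \<otimes> X) ** H |> comult X ** assoc H H X"
    by (rule cancel_left[where h = ?k]) (simp_all add: mid_def)
  have "(comult X ** mult X) ** assoc H H X = assoc H H X ** (?D ** ?M) <| X" by (simp add: comult_def mult_def)
  also have "\<dots> = ?M <| (H \<otimes> X) ** (H \<otimes> H) |> (?M <| X) ** assoc (H \<otimes> H) (H \<otimes> H) X ** mid H H H H <| X ** (?D <| (H \<otimes> H)) <| X ** (H |> ?D) <| X"
    unfolding e by (simp add: chain2[OF assoc_nat_left] chain2[OF assoc_nat] mid_def)
  also have "\<dots> = ?M <| (H \<otimes> X) ** assoc_inv H H (H \<otimes> X) ** H |> H |> mult X ** H |> braid H H (H \<otimes> X) ** comult (H \<otimes> H \<otimes> X) ** H |> comult X ** assoc H H X"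
    unfolding core by (simp add: mult_def chain2[OF assoc_inv_nat])
  finally show "(comult X ** mult X) ** assoc H H X = (mult (H \<otimes> X) ** H |> H |> mult X ** H |> braid H H (H \<otimes> X) ** comult (H \<otimes> H \<otimes> X) ** H |> comult X) ** assoc H H X"
    by (simp add: mult_def)
qed auto

end

section \<open>Whiskering and crossing the operators\<close>

context hopf_algebra
begin

text \<open>
  The \<open>_suf\<close> lemmas re-bracket an operator tensored with \<open>Y\<close> on the right into the operator on the longer word.
\<close>
lemma mult_suf: assumes [simp]: "X \<in> Obj C" "Y \<in> Obj C"
  shows "assoc H X Y ** mult X <| Y = mult (X \<otimes> Y) ** H |> assoc H X Y ** assoc H (H \<otimes> X) Y"
proof (rule cancel_right)
  show "(assoc H X Y ** mult X <| Y) ** assoc H H X <| Y = (mult (X \<otimes> Y) ** H |> assoc H X Y ** assoc H (H \<otimes> X) Y) ** assoc H H X <| Y"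
    by (simp add: mult_def struct_nat assoc_pentagon)
qed auto

lemma unt_suf: assumes [simp]: "X \<in> Obj C" "Y \<in> Obj C"
  shows "assoc H X Y ** unt X <| Y = unt (X \<otimes> Y)"
proof (rule cancel_right)
  have "assoc \<I> X Y = tinv (lunit (X \<otimes> Y)) ** lunit X <| Y"
    by (simp add: lunit_tensor[symmetric])
  then show "(assoc H X Y ** unt X <| Y) ** lunit X <| Y = unt (X \<otimes> Y) ** lunit X <| Y"
    by (simp add: unt_def struct_nat)
qed auto

lemma comult_suf: assumes [simp]: "X \<in> Obj C" "Y \<in> Obj C"
  shows "H |> assoc H X Y ** assoc H (H \<otimes> X) Y ** comult X <| Y = comult (X \<otimes> Y) ** assoc H X Y"
  by (simp add: comult_def chain3[OF assoc_pentagon] struct_nat)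

lemma counit_suf: assumes [simp]: "X \<in> Obj C" "Y \<in> Obj C"
  shows "counit (X \<otimes> Y) ** assoc H X Y = counit X <| Y"
  by (simp add: counit_def assoc_left chain2[OF lunit_tensor])

text \<open>
  \<open>H\<close> passes \<open>A\<close> compatibly with its structure: naturality of the braiding in \<open>H\<close>, with a hexagon where two
  copies of \<open>H\<close> pass.
\<close>
lemma braid_mult: assumes [simp]: "A \<in> Obj C" "X \<in> Obj C"
  shows "braid H A X ** mult (A \<otimes> X) = A |> mult X ** braid H A (H \<otimes> X) ** H |> braid H A X"
proof -
  let ?X1 = "H \<otimes> X"
  have "(braid H A X ** mult (A \<otimes> X)) ** assoc H H (A \<otimes> X) = A |> (lft \<mu> <| X) ** braid (H \<otimes> H) A X"
    using braid_nat[of "lft \<mu>" H "tid A" A "tid X" X] by (simp add: mult_def)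
  also have "\<dots> = A |> mult X ** A |> assoc H H X ** braid (H \<otimes> H) A X" by (simp add: mult_def)
  also have "\<dots> = (A |> mult X ** braid H A ?X1 ** H |> braid H A X) ** assoc H H (A \<otimes> X)"
    by (simp add: braid_hexagon_left)
  finally show ?thesis by (rule cancel_right) auto
qed

lemma braid_unt: assumes [simp]: "A \<in> Obj C" "X \<in> Obj C"
  shows "braid H A X ** unt (A \<otimes> X) = A |> unt X"
proof -
  have "(braid H A X ** unt (A \<otimes> X)) ** lunit (A \<otimes> X) = A |> (lft \<eta> <| X) ** braid \<I> A X"
    using braid_nat[of "lft \<eta>" H "tid A" A "tid X" X] by (simp add: unt_def)
  also have "\<dots> = A |> unt X ** A |> lunit X ** braid \<I> A X" by (simp add: unt_def)
  also have "\<dots> = A |> unt X ** lunit (A \<otimes> X)" by (simp add: braid_unit_left)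
  finally show ?thesis by (rule cancel_right) auto
qed

lemma braid_comult: assumes [simp]: "A \<in> Obj C" "X \<in> Obj C"
  shows "A |> comult X ** braid H A X = braid H A (H \<otimes> X) ** H |> braid H A X ** comult (A \<otimes> X)"
proof -
  have "A |> (lft \<Delta> <| X) ** braid H A X = braid (H \<otimes> H) A X ** lft \<Delta> <| (A \<otimes> X)"
    using braid_nat[of "lft \<Delta>" "H \<otimes> H" "tid A" A "tid X" X] by simp
  then have "A |> comult X ** braid H A X = A |> assoc H H X ** braid (H \<otimes> H) A X ** lft \<Delta> <| (A \<otimes> X)"
    by (simp add: comult_def)
  also have "\<dots> = braid H A (H \<otimes> X) ** H |> braid H A X ** comult (A \<otimes> X)"
    by (simp add: comult_def chain2[OF braid_hexagon_left])
  finally show ?thesis .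
qed

lemma braid_counit: assumes [simp]: "A \<in> Obj C" "X \<in> Obj C"
  shows "A |> counit X ** braid H A X = counit (A \<otimes> X)"
proof -
  have "A |> (lft \<epsilon> <| X) ** braid H A X = braid \<I> A X ** lft \<epsilon> <| (A \<otimes> X)"
    using braid_nat[of "lft \<epsilon>" \<I> "tid A" A "tid X" X] by simp
  then show ?thesis by (simp add: counit_def chain2[OF braid_unit_left])
qed

lemma braid_anti: assumes [simp]: "A \<in> Obj C" "X \<in> Obj C"
  shows "braid H A X ** anti (A \<otimes> X) = A |> anti X ** braid H A X"
  using braid_nat[of "lft s" H "tid A" A "tid X" X] by (simp add: anti_def)

lemma braid_anti': assumes [simp]: "X \<in> Obj C"
  shows "braid H H X ** H |> anti X = anti (H \<otimes> X) ** braid H H X"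
  using braid_nat[of "tid H" H "lft s" H "tid X" X] by (simp add: anti_def)

text \<open>
  Naturality of the crossing of \<open>H \<otimes> H\<close> past \<open>A\<close> with respect to the braiding of \<open>H\<close> with itself.
\<close>
lemma yang_baxter: assumes [simp]: "A \<in> Obj C" "X \<in> Obj C"
  shows "A |> braid H H X ** braid H A (H \<otimes> X) ** H |> braid H A X = braid H A (H \<otimes> X) ** H |> braid H A X ** braid H H (A \<otimes> X)"
proof -
  have n: "A |> (tbraid H H <| X) ** braid (H \<otimes> H) A X = braid (H \<otimes> H) A X ** tbraid H H <| (A \<otimes> X)"
    using braid_nat[of "tbraid H H" "H \<otimes> H" "tid A" A "tid X" X] by simp
  have "(A |> braid H H X ** braid H A (H \<otimes> X) ** H |> braid H A X) ** assoc H H (A \<otimes> X)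
    = A |> (braid H H X ** assoc H H X) ** braid (H \<otimes> H) A X" by (simp add: braid_hexagon_left)
  also have "\<dots> = A |> assoc H H X ** braid (H \<otimes> H) A X ** tbraid H H <| (A \<otimes> X)"
    by (simp add: braid_assoc n)
  also have "\<dots> = (braid H A (H \<otimes> X) ** H |> braid H A X ** braid H H (A \<otimes> X)) ** assoc H H (A \<otimes> X)"
    by (simp add: chain2[OF braid_hexagon_left] braid_assoc)
  finally show ?thesis by (rule cancel_right) auto
qed

text \<open>
  As rewrite rules these move arrows acting deeper in the word to the front of the chain, which gives
  composites of operators a normal form.
\<close>
lemmas op_nat = mult_nat unt_nat comult_nat counit_nat anti_nat braid_nat_deep
lemmas op_nat_chain = op_nat[THEN chain2]
lemmas op_nat_pre = mult_nat[THEN pre_eq2] comult_nat[THEN pre_eq2] counit_nat[THEN pre_eq2] anti_nat[THEN pre_eq2] braid_nat_deep[THEN pre_eq2]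
lemmas op_nat_pre2 = op_nat_pre[THEN pre_eq2]
lemmas op_nat_pre_chain = op_nat_pre[THEN chain2] op_nat_pre2 op_nat_pre2[THEN chain2]
lemmas op_nat_all = op_nat op_nat_chain op_nat_pre op_nat_pre_chain

section \<open>Identities of the antipode\<close>

text \<open>
  \<open>s(1) = s(1\<^sub>1) 1\<^sub>2 = \<epsilon>(1) 1\<close>.
\<close>
lemma antipode_unit: assumes [simp]: "X \<in> Obj C" shows "anti X ** unt X = unt X"
proof -
  have "anti X ** unt X = mult X ** H |> unt X ** anti X ** unt X" by (simp add: chain2[OF mult_unit_op'])
  also have "\<dots> = mult X ** anti (H \<otimes> X) ** H |> unt X ** unt X" by (simp add: chain2[OF anti_nat])
  also have "\<dots> = mult X ** anti (H \<otimes> X) ** comult X ** unt X" by (simp add: comult_unit_op unt_nat)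
  also have "\<dots> = unt X" using chain3[OF antipode_left_op[of X], of "unt X"] by (simp add: counit_unit_op)
  finally show ?thesis .
qed

text \<open>
  \<open>\<epsilon>(s h) = \<epsilon>(s(h\<^sub>1) h\<^sub>2) = \<epsilon>(h)\<close>.
\<close>
lemma counit_antipode: assumes [simp]: "X \<in> Obj C" shows "counit X ** anti X = counit X"
proof -
  have "counit X ** anti X = counit X ** anti X ** H |> counit X ** comult X" by (simp add: counit_comult_op')
  also have "\<dots> = counit X ** H |> counit X ** anti (H \<otimes> X) ** comult X" by (simp add: chain2[OF anti_nat])
  also have "\<dots> = counit X ** mult X ** anti (H \<otimes> X) ** comult X" by (simp add: chain2[OF counit_mult_op])
  also have "\<dots> = counit X" by (simp add: antipode_left_op chain2[OF counit_unit_op])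
  finally show ?thesis .
qed

text \<open>
  In elements \<open>s(g\<^sub>1 h) g\<^sub>2 = \<epsilon>(g) s(h)\<close>. Both sides equal \<open>s(g\<^sub>1 h\<^sub>1) g\<^sub>2 h\<^sub>2 s(h\<^sub>3)\<close>: either cancel
  \<open>h\<^sub>2 s(h\<^sub>3)\<close>, or read \<open>g\<^sub>1 h\<^sub>1\<close> and \<open>g\<^sub>2 h\<^sub>2\<close> as the comultiplication of \<open>g h\<^sub>1\<close> and cancel the antipode of
  the one against the other.
\<close>
lemma antipode_mult_comult: assumes [simp]: "Y \<in> Obj C"
  shows "mult Y ** anti (H \<otimes> Y) ** mult (H \<otimes> Y) ** H |> braid H H Y ** comult (H \<otimes> Y) = anti Y ** counit (H \<otimes> Y)"
proof -
  let ?Y1 = "H \<otimes> Y" and ?Y2 = "H \<otimes> H \<otimes> Y" and ?Y3 = "H \<otimes> H \<otimes> H \<otimes> Y"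
  \<comment> \<open>\<open>h\<^sub>2 s(h\<^sub>3)\<close> cancels\<close>
  have in1: "H |> mult Y ** comult ?Y1 ** H |> anti Y ** comult Y = H |> unt Y"
  proof -
    have "H |> mult Y ** comult ?Y1 ** H |> anti Y ** comult Y = H |> (mult Y ** H |> anti Y ** comult Y) ** comult Y"
      by (simp add: chain2[OF comult_nat] comult_coassoc_op)
    also have "\<dots> = H |> unt Y ** H |> counit Y ** comult Y" by (simp add: antipode_right_op)
    finally show ?thesis by (simp add: counit_comult_op')
  qed
  have "mult Y ** anti ?Y1 ** mult ?Y1 ** H |> braid H H Y ** comult ?Y1
    = mult Y ** anti ?Y1 ** mult ?Y1 ** H |> H |> (mult Y ** H |> unt Y) ** H |> braid H H Y ** comult ?Y1"
    by (simp only: mult_unit_op' assms) simp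
  also have "\<dots> = mult Y ** anti ?Y1 ** mult ?Y1 ** H |> H |> mult Y ** H |> braid H H ?Y1 ** comult ?Y2 ** H |> H |> unt Y"
    by (simp add: op_nat_all)
  also have "\<dots> = mult Y ** anti ?Y1 ** mult ?Y1 ** H |> H |> mult Y ** H |> braid H H ?Y1 ** comult ?Y2
       ** H |> (H |> mult Y ** comult ?Y1 ** H |> anti Y ** comult Y)"
    by (simp only: in1)
  also have "\<dots> = mult Y ** anti ?Y1 ** mult ?Y1 ** H |> H |> (mult Y ** H |> mult Y) ** H |> braid H H ?Y2 ** comult ?Y3
       ** H |> comult ?Y1 ** H |> (H |> anti Y ** comult Y)"
    by (simp add: op_nat_all)
  also have "\<dots> = mult Y ** anti ?Y1 ** mult ?Y1 ** H |> H |> (mult Y ** mult ?Y1) ** H |> braid H H ?Y2 ** comult ?Y3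
       ** H |> comult ?Y1 ** H |> (H |> anti Y ** comult Y)"
    by (simp only: mult_assoc_op assms)
  also have "\<dots> = mult Y ** H |> mult Y ** anti ?Y2 ** (mult ?Y2 ** H |> H |> mult ?Y1 ** H |> braid H H ?Y2 ** comult ?Y3
       ** H |> comult ?Y1) ** H |> (H |> anti Y ** comult Y)"
    by (simp add: op_nat_all)
  also have "\<dots> = mult Y ** H |> mult Y ** anti ?Y2 ** (comult ?Y1 ** mult ?Y1) ** H |> (H |> anti Y ** comult Y)"
    by (simp only: comult_mult_op tensor_Obj assms H_Obj)
  also have "\<dots> = mult Y ** (mult ?Y1 ** anti ?Y2 ** comult ?Y1) ** mult ?Y1 ** H |> (H |> anti Y ** comult Y)"
    by (simp add: chain2[OF mult_assoc_op])
  \<comment> \<open>the antipode law, now for the product \<open>g h\<^sub>1\<close>\<close>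
  also have "\<dots> = counit ?Y1 ** mult ?Y1 ** H |> (H |> anti Y ** comult Y)"
    by (simp add: antipode_left_op chain2[OF mult_unit_op])
  also have "\<dots> = counit ?Y1 ** H |> anti Y ** H |> (counit ?Y1 ** comult Y)"
    by (simp add: chain2[OF counit_mult_op] op_nat_pre op_nat_pre_chain)
  also have "\<dots> = anti Y ** counit ?Y1" by (simp add: counit_comult_op counit_nat)
  finally show ?thesis .
qed

text \<open>
  \<open>s(g h) = s(g\<^sub>1 h) g\<^sub>2 s(g\<^sub>3) = s(h) s(g)\<close>, the last step by \<open>antipode_mult_comult\<close>. Splitting off one factor at
  a time avoids convolution on \<open>H \<otimes> H\<close> and the coassociativity of its comultiplication.
\<close>
lemma antipode_mult: assumes [simp]: "Y \<in> Obj C"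
  shows "anti Y ** mult Y = mult Y ** braid H H Y ** anti (H \<otimes> Y) ** H |> anti Y"
proof -
  let ?Y1 = "H \<otimes> Y" and ?Y2 = "H \<otimes> H \<otimes> Y"
  let ?e = "H |> H |> anti Y ** H |> braid H H Y ** comult ?Y1"
  \<comment> \<open>the copy of \<open>g\<close> that passes \<open>h\<close> may be comultiplied after passing instead of before\<close>
  have in1: "H |> braid H H ?Y1 ** comult ?Y2 ** H |> braid H H Y ** comult ?Y1 = H |> H |> comult Y ** H |> braid H H Y ** comult ?Y1"
  proof -
    have "H |> braid H H ?Y1 ** comult ?Y2 ** H |> braid H H Y ** comult ?Y1
      = H |> (braid H H ?Y1 ** H |> braid H H Y ** comult ?Y1) ** comult ?Y1"
      by (simp add: chain2[OF comult_nat] comult_coassoc_op)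
    also have "\<dots> = H |> (H |> comult Y ** braid H H Y) ** comult ?Y1" by (simp only: braid_comult assms H_Obj)
    finally show ?thesis by simp
  qed
  have "mult Y ** braid H H Y ** anti ?Y1 ** H |> anti Y = mult Y ** anti ?Y1 ** H |> anti Y ** braid H H Y"
    by (simp add: braid_anti chain2[OF braid_anti] braid_anti' chain2[OF braid_anti'] anti_nat chain2[OF anti_nat])
  also have "\<dots> = mult Y ** (anti ?Y1 ** counit ?Y2) ** ?e"
    by (simp add: op_nat_chain counit_comult_op)
  also have "\<dots> = mult Y ** (mult ?Y1 ** anti ?Y2 ** mult ?Y2 ** H |> braid H H ?Y1 ** comult ?Y2) ** ?e"
    by (simp only: antipode_mult_comult tensor_Obj assms H_Obj)
  also have "\<dots> = mult Y ** H |> mult Y ** anti ?Y2 ** mult ?Y2 ** H |> braid H H ?Y1 ** comult ?Y2 ** ?e"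
    by (simp add: chain2[OF mult_assoc_op[symmetric]])
  also have "\<dots> = mult Y ** anti ?Y1 ** mult ?Y1 ** H |> H |> mult Y ** H |> H |> H |> anti Y
       ** (H |> braid H H ?Y1 ** comult ?Y2 ** H |> braid H H Y ** comult ?Y1)"
    by (simp add: op_nat_chain op_nat_pre_chain)
  also have "\<dots> = mult Y ** anti ?Y1 ** mult ?Y1 ** H |> H |> (mult Y ** H |> anti Y ** comult Y) ** H |> braid H H Y ** comult ?Y1"
    unfolding in1 by simp
  also have "\<dots> = mult Y ** anti ?Y1 ** mult ?Y1 ** H |> H |> unt Y ** H |> (H |> counit Y ** braid H H Y) ** comult ?Y1"
    by (simp add: antipode_right_op)
  also have "\<dots> = mult Y ** H |> unt Y ** anti Y ** mult Y"
    by (simp add: braid_counit counit_comult_op' op_nat op_nat_chain)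
  also have "\<dots> = anti Y ** mult Y" by (simp add: chain2[OF mult_unit_op'])
  finally show ?thesis by (rule sym)
qed

text \<open>
  In elements \<open>s(h\<^sub>1)\<^sub>1 h\<^sub>2 \<otimes> s(h\<^sub>1)\<^sub>2 = 1 \<otimes> s(h)\<close>. Multiplying the second factor by \<open>h\<^sub>3 s(h\<^sub>4)\<close> exhibits
  \<open>s(h\<^sub>1) h\<^sub>2\<close> under the comultiplication. This replaces the braided formula for the comultiplication of
  an antipode.
\<close>
lemma antipode_comult: assumes [simp]: "Y \<in> Obj C"
  shows "mult (H \<otimes> Y) ** H |> braid H H Y ** comult (H \<otimes> Y) ** anti (H \<otimes> Y) ** comult Y = unt (H \<otimes> Y) ** anti Y"
proof -
  let ?Y1 = "H \<otimes> Y" and ?Y2 = "H \<otimes> H \<otimes> Y" and ?Y3 = "H \<otimes> H \<otimes> H \<otimes> Y"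
  \<comment> \<open>\<open>h\<^sub>3 s(h\<^sub>4)\<close> cancels\<close>
  have in1: "H |> H |> mult Y ** H |> comult ?Y1 ** comult ?Y1 ** H |> anti Y ** comult Y = H |> H |> unt Y ** comult Y"
  proof -
    have "H |> H |> mult Y ** H |> comult ?Y1 ** comult ?Y1 ** H |> anti Y ** comult Y
      = H |> (H |> mult Y ** H |> H |> anti Y ** comult ?Y1 ** comult Y) ** comult Y"
      by (simp add: op_nat_all comult_coassoc_op chain2[OF pre_eq2[OF comult_coassoc_op]])
    also have "\<dots> = H |> (H |> (mult Y ** H |> anti Y ** comult Y) ** comult Y) ** comult Y"
      by (simp add: comult_coassoc_op)
    also have "\<dots> = H |> (H |> unt Y ** H |> counit Y ** comult Y) ** comult Y" by (simp add: antipode_right_op)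
    finally show ?thesis by (simp add: counit_comult_op')
  qed
  have "mult ?Y1 ** H |> braid H H Y ** comult ?Y1 ** anti ?Y1 ** comult Y
     = mult ?Y1 ** H |> H |> (mult Y ** H |> unt Y) ** H |> braid H H Y ** comult ?Y1 ** anti ?Y1 ** comult Y"
    by (simp only: mult_unit_op' assms) simp
  also have "\<dots> = mult ?Y1 ** H |> H |> mult Y ** H |> braid H H ?Y1 ** comult ?Y2 ** anti ?Y2 ** H |> H |> unt Y ** comult Y"
    by (simp add: op_nat_all)
  also have "\<dots> = mult ?Y1 ** H |> H |> mult Y ** H |> braid H H ?Y1 ** comult ?Y2 ** anti ?Y2 ** H |> H |> mult Y ** H |> comult ?Y1 ** comult ?Y1 ** H |> anti Y ** comult Y"
    by (simp only: in1)
  also have "\<dots> = mult ?Y1 ** H |> H |> (mult Y ** H |> mult Y) ** H |> braid H H ?Y2 ** comult ?Y3 ** H |> comult ?Y1 ** anti ?Y2 ** comult ?Y1 ** H |> anti Y ** comult Y"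
    by (simp add: op_nat_all)
  also have "\<dots> = mult ?Y1 ** H |> H |> (mult Y ** mult ?Y1) ** H |> braid H H ?Y2 ** comult ?Y3 ** H |> comult ?Y1 ** anti ?Y2 ** comult ?Y1 ** H |> anti Y ** comult Y"
    by (simp only: mult_assoc_op assms)
  also have "\<dots> = H |> mult Y ** (mult ?Y2 ** H |> H |> mult ?Y1 ** H |> braid H H ?Y2 ** comult ?Y3 ** H |> comult ?Y1) ** anti ?Y2 ** comult ?Y1 ** H |> anti Y ** comult Y"
    by (simp add: op_nat_all)
  also have "\<dots> = H |> mult Y ** comult ?Y1 ** (mult ?Y1 ** anti ?Y2 ** comult ?Y1) ** H |> anti Y ** comult Y"
    by (simp only: comult_mult_op[symmetric] tensor_Obj assms H_Obj tcmp_assoc)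
  also have "\<dots> = H |> mult Y ** unt ?Y2 ** unt ?Y1 ** anti Y ** counit ?Y1 ** comult Y"
    by (simp add: antipode_left_op chain2[OF comult_unit_op] chain2[OF counit_nat])
  also have "\<dots> = H |> (mult Y ** unt ?Y1) ** unt ?Y1 ** anti Y"
    by (simp add: counit_comult_op chain2[OF unt_nat[of "unt ?Y1"]])
  also have "\<dots> = unt ?Y1 ** anti Y" by (simp only: mult_unit_op assms) simp
  finally show ?thesis .
qed

end

section \<open>The opmonoidal monad of tensoring with a Hopf algebra\<close>

context hopf_algebra
begin

definition psi :: "'o \<Rightarrow> 'o \<Rightarrow> ('o, 'm) tarr" where
  "psi X Y = assoc_inv H X (H \<otimes> Y) ** H |> braid H X Y ** comult (X \<otimes> Y)"

lemma psi_typ [simp]: "src (psi X Y) = H \<otimes> X \<otimes> Y" "trg (psi X Y) = (H \<otimes> X) \<otimes> H \<otimes> Y" "proper (psi X Y)"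
  "X \<in> Obj C \<Longrightarrow> Y \<in> Obj C \<Longrightarrow> val (psi X Y)"
  by (auto simp: psi_def)

lemma assoc_psi: "X \<in> Obj C \<Longrightarrow> Y \<in> Obj C \<Longrightarrow> assoc H X (H \<otimes> Y) ** psi X Y = H |> braid H X Y ** comult (X \<otimes> Y)"
  by (simp add: psi_def)

lemma psi_nat:
  assumes "trg f = X" "trg g = Y"
  shows "psi X Y ** H |> (f \<odot> g) = (H |> f \<odot> H |> g) ** psi (src f) (src g)"
proof (rule teqI)
  assume v: "val (psi X Y ** H |> (f \<odot> g))"
  then have w: "val f" "val g" by auto
  have o: "X \<in> Obj C" "Y \<in> Obj C" "src f \<in> Obj C" "src g \<in> Obj C" using val_Obj[OF w(1)] val_Obj[OF w(2)] assms by auto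
  show "psi X Y ** H |> (f \<odot> g) = (H |> f \<odot> H |> g) ** psi (src f) (src g)"
  proof (rule cancel_left)
    have "assoc H X (H \<otimes> Y) ** psi X Y ** H |> (f \<odot> g) = H |> (braid H X Y ** H |> (f \<odot> g)) ** comult (src f \<otimes> src g)"
      using assms o by (simp add: chain2[OF assoc_psi] comult_nat)
    also have "braid H X Y ** H |> (f \<odot> g) = (f \<odot> (H |> g)) ** braid H (src f) (src g)"
      using assms by (simp add: braid_nat)
    also have "H |> ((f \<odot> (H |> g)) ** braid H (src f) (src g)) ** comult (src f \<otimes> src g)
      = assoc H X (H \<otimes> Y) ** (H |> f \<odot> H |> g) ** psi (src f) (src g)"
      using assms o by (simp add: chain2[OF assoc_nat] assoc_psi)
    finally show "assoc H X (H \<otimes> Y) ** psi X Y ** H |> (f \<odot> g) = assoc H X (H \<otimes> Y) ** (H |> f \<odot> H |> g) ** psi (src f) (src g)" .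
  qed (use assms o in auto)
qed (use assms in \<open>auto simp: val_Obj psi_def\<close>)

text \<open>
  Re-bracketing \<open>psi X Y \<otimes> Z\<close> gives the same crossing and comultiplication with a longer rest of the word.
\<close>
lemma psi_suf: assumes [simp]: "X \<in> Obj C" "Y \<in> Obj C" "Z \<in> Obj C"
  shows "H |> X |> assoc H Y Z ** assoc H X ((H \<otimes> Y) \<otimes> Z) ** assoc (H \<otimes> X) (H \<otimes> Y) Z ** psi X Y <| Z
    = H |> braid H X (Y \<otimes> Z) ** comult (X \<otimes> Y \<otimes> Z) ** H |> assoc X Y Z ** assoc H (X \<otimes> Y) Z"
proof -
  have "H |> X |> assoc H Y Z ** assoc H X ((H \<otimes> Y) \<otimes> Z) ** assoc (H \<otimes> X) (H \<otimes> Y) Z ** psi X Y <| Z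
    = H |> X |> assoc H Y Z ** H |> assoc X (H \<otimes> Y) Z ** assoc H (X \<otimes> H \<otimes> Y) Z ** (assoc H X (H \<otimes> Y) ** psi X Y) <| Z"
    by (simp add: chain2[OF assoc_pentagon[symmetric]])
  also have "\<dots> = H |> (X |> assoc H Y Z ** assoc X (H \<otimes> Y) Z ** braid H X Y <| Z) ** assoc H (H \<otimes> X \<otimes> Y) Z ** comult (X \<otimes> Y) <| Z"
    unfolding assoc_psi[OF assms(1,2)] by (simp add: chain2[OF assoc_nat])
  also have "\<dots> = H |> (braid H X (Y \<otimes> Z) ** H |> assoc X Y Z ** assoc H (X \<otimes> Y) Z) ** assoc H (H \<otimes> X \<otimes> Y) Z ** comult (X \<otimes> Y) <| Z"
    by (simp only: braid_whisker assms H_Obj)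
  also have "\<dots> = H |> braid H X (Y \<otimes> Z) ** comult (X \<otimes> Y \<otimes> Z) ** H |> assoc X Y Z ** assoc H (X \<otimes> Y) Z"
    by (simp add: comult_suf chain2[OF comult_nat])
  finally show ?thesis .
qed

text \<open>
  In right-nested form both sides are coassociativity followed by the crossings of \<open>H\<close> past \<open>X\<close> and \<open>Y\<close>.
\<close>
lemma psi_assoc: assumes [simp]: "X \<in> Obj C" "Y \<in> Obj C" "Z \<in> Obj C"
  shows "assoc (H \<otimes> X) (H \<otimes> Y) (H \<otimes> Z) ** psi X Y <| (H \<otimes> Z) ** psi (X \<otimes> Y) Z
    = (H \<otimes> X) |> psi Y Z ** psi X (Y \<otimes> Z) ** H |> assoc X Y Z"
proof -
  let ?h = "H |> X |> assoc H Y (H \<otimes> Z) ** assoc H X ((H \<otimes> Y) \<otimes> H \<otimes> Z)"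
  have "?h ** assoc (H \<otimes> X) (H \<otimes> Y) (H \<otimes> Z) ** psi X Y <| (H \<otimes> Z) ** psi (X \<otimes> Y) Z
      = H |> braid H X (Y \<otimes> H \<otimes> Z) ** comult (X \<otimes> Y \<otimes> H \<otimes> Z) ** H |> assoc X Y (H \<otimes> Z) ** assoc H (X \<otimes> Y) (H \<otimes> Z) ** psi (X \<otimes> Y) Z"
    by (simp add: chain4[OF psi_suf])
  also have "\<dots> = H |> braid H X (Y \<otimes> H \<otimes> Z) ** comult (X \<otimes> Y \<otimes> H \<otimes> Z) ** H |> (assoc X Y (H \<otimes> Z) ** braid H (X \<otimes> Y) Z) ** comult ((X \<otimes> Y) \<otimes> Z)"
    by (simp add: assoc_psi)
  also have "\<dots> = H |> braid H X (Y \<otimes> H \<otimes> Z) ** comult (X \<otimes> Y \<otimes> H \<otimes> Z) ** H |> (X |> braid H Y Z ** braid H X (Y \<otimes> Z) ** H |> assoc X Y Z) ** comult ((X \<otimes> Y) \<otimes> Z)"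
    by (simp only: braid_hexagon_right assms H_Obj)
  also have "\<dots> = H |> X |> H |> braid H Y Z ** H |> braid H X (H \<otimes> Y \<otimes> Z) ** H |> H |> braid H X (Y \<otimes> Z) ** (comult (H \<otimes> X \<otimes> Y \<otimes> Z) ** comult (X \<otimes> Y \<otimes> Z)) ** H |> assoc X Y Z"
    by (simp add: op_nat_all)
  also have "\<dots> = H |> X |> H |> braid H Y Z ** H |> (braid H X (H \<otimes> Y \<otimes> Z) ** H |> braid H X (Y \<otimes> Z) ** comult (X \<otimes> Y \<otimes> Z)) ** comult (X \<otimes> Y \<otimes> Z) ** H |> assoc X Y Z"
    by (simp add: chain2[OF comult_coassoc_op])
  also have "\<dots> = H |> X |> H |> braid H Y Z ** H |> (X |> comult (Y \<otimes> Z) ** braid H X (Y \<otimes> Z)) ** comult (X \<otimes> Y \<otimes> Z) ** H |> assoc X Y Z"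
    by (simp only: braid_comult assms tensor_Obj)
  also have "\<dots> = H |> X |> (assoc H Y (H \<otimes> Z) ** psi Y Z) ** assoc H X (H \<otimes> Y \<otimes> Z) ** psi X (Y \<otimes> Z) ** H |> assoc X Y Z"
    by (simp only: assoc_psi assms) (simp add: chain2[OF assoc_psi])
  also have "\<dots> = ?h ** (H \<otimes> X) |> psi Y Z ** psi X (Y \<otimes> Z) ** H |> assoc X Y Z"
    by (simp add: chain2[OF assoc_nat_deep])
  finally show ?thesis by (rule cancel_left) simp_all
qed

lemma psi_lunit: assumes [simp]: "X \<in> Obj C"
  shows "lunit (H \<otimes> X) ** counit \<I> <| (H \<otimes> X) ** psi \<I> X = H |> lunit X"
proof -
  have "lunit (H \<otimes> X) ** counit \<I> <| (H \<otimes> X) ** psi \<I> X = counit (H \<otimes> X) ** H |> (lunit (H \<otimes> X) ** braid H \<I> X) ** comult (\<I> \<otimes> X)"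
    by (simp add: counit_suf[symmetric] assoc_psi chain2[OF counit_nat])
  also have "\<dots> = counit (H \<otimes> X) ** H |> H |> lunit X ** comult (\<I> \<otimes> X)" by (simp only: braid_unit_right assms H_Obj)
  also have "\<dots> = H |> lunit X" by (simp add: counit_comult_op chain2[OF counit_nat])
  finally show ?thesis .
qed

lemma psi_runit: assumes [simp]: "X \<in> Obj C"
  shows "runit (H \<otimes> X) ** (H \<otimes> X) |> counit \<I> ** psi X \<I> = H |> runit X"
proof -
  have "runit (H \<otimes> X) ** (H \<otimes> X) |> counit \<I> ** psi X \<I> = H |> runit X ** H |> (X |> counit \<I> ** braid H X \<I>) ** comult (X \<otimes> \<I>)"
    by (simp add: runit_tensor[symmetric] chain2[OF assoc_nat_deep] assoc_psi)
  also have "\<dots> = H |> runit X ** H |> counit (X \<otimes> \<I>) ** comult (X \<otimes> \<I>)" by (simp only: braid_counit assms unit_Obj)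
  also have "\<dots> = H |> runit X" by (simp add: counit_comult_op')
  finally show ?thesis .
qed

text \<open>
  The bialgebra law, after the crossings have been moved past the two multiplications.
\<close>
lemma psi_mult: assumes [simp]: "X \<in> Obj C" "Y \<in> Obj C"
  shows "psi X Y ** mult (X \<otimes> Y) = (mult X \<odot> mult Y) ** psi (H \<otimes> X) (H \<otimes> Y) ** H |> psi X Y"
proof -
  have "assoc H X (H \<otimes> Y) ** (mult X \<odot> mult Y) ** psi (H \<otimes> X) (H \<otimes> Y) ** H |> psi X Y
      = assoc H X (H \<otimes> Y) ** mult X <| (H \<otimes> Y) ** (H \<otimes> H \<otimes> X) |> mult Y ** psi (H \<otimes> X) (H \<otimes> Y) ** H |> psi X Y"
    by (simp add: interchange'(2)[of "mult X" "mult Y"])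
  also have "\<dots> = mult (X \<otimes> H \<otimes> Y) ** H |> (assoc H X (H \<otimes> Y) ** (H \<otimes> X) |> mult Y) ** assoc H (H \<otimes> X) (H \<otimes> H \<otimes> Y) ** psi (H \<otimes> X) (H \<otimes> Y) ** H |> psi X Y"
    by (simp add: chain2[OF mult_suf] chain2[OF assoc_nat_deep])
  also have "\<dots> = mult (X \<otimes> H \<otimes> Y) ** H |> H |> X |> mult Y ** H |> (assoc H X (H \<otimes> H \<otimes> Y) ** braid H (H \<otimes> X) (H \<otimes> Y)) ** comult ((H \<otimes> X) \<otimes> H \<otimes> Y) ** H |> psi X Y"
    by (simp add: chain2[OF assoc_psi] assoc_nat_deep chain2[OF pre_eq2[OF assoc_nat_deep]])
  also have "\<dots> = mult (X \<otimes> H \<otimes> Y) ** H |> H |> X |> mult Y ** H |> (H |> braid H X (H \<otimes> Y) ** braid H H (X \<otimes> H \<otimes> Y) ** H |> assoc H X (H \<otimes> Y)) ** comult ((H \<otimes> X) \<otimes> H \<otimes> Y) ** H |> psi X Y"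
    by (simp only: braid_hexagon_right assms H_Obj tensor_Obj)
  also have "\<dots> = mult (X \<otimes> H \<otimes> Y) ** H |> H |> X |> mult Y ** H |> H |> braid H X (H \<otimes> Y) ** H |> braid H H (X \<otimes> H \<otimes> Y) ** comult (H \<otimes> X \<otimes> H \<otimes> Y) ** H |> (assoc H X (H \<otimes> Y) ** psi X Y)"
    by (simp add: op_nat op_nat_chain)
  also have "\<dots> = mult (X \<otimes> H \<otimes> Y) ** H |> H |> X |> mult Y ** H |> H |> braid H X (H \<otimes> Y) ** H |> braid H H (X \<otimes> H \<otimes> Y) ** comult (H \<otimes> X \<otimes> H \<otimes> Y) ** H |> (H |> braid H X Y ** comult (X \<otimes> Y))"
    by (simp only: assoc_psi assms)
  also have "\<dots> = mult (X \<otimes> H \<otimes> Y) ** H |> H |> (X |> mult Y ** braid H X (H \<otimes> Y) ** H |> braid H X Y) ** H |> braid H H (H \<otimes> X \<otimes> Y) ** comult (H \<otimes> H \<otimes> X \<otimes> Y) ** H |> comult (X \<otimes> Y)"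
    by (simp add: op_nat_all)
  also have "\<dots> = mult (X \<otimes> H \<otimes> Y) ** H |> H |> (braid H X Y ** mult (X \<otimes> Y)) ** H |> braid H H (H \<otimes> X \<otimes> Y) ** comult (H \<otimes> H \<otimes> X \<otimes> Y) ** H |> comult (X \<otimes> Y)"
    by (simp only: braid_mult assms)
  also have "\<dots> = H |> braid H X Y ** (mult (H \<otimes> X \<otimes> Y) ** H |> H |> mult (X \<otimes> Y) ** H |> braid H H (H \<otimes> X \<otimes> Y) ** comult (H \<otimes> H \<otimes> X \<otimes> Y) ** H |> comult (X \<otimes> Y))"
    by (simp add: op_nat_chain)
  also have "\<dots> = H |> braid H X Y ** comult (X \<otimes> Y) ** mult (X \<otimes> Y)" by (simp only: comult_mult_op assms tensor_Obj)
  also have "\<dots> = assoc H X (H \<otimes> Y) ** psi X Y ** mult (X \<otimes> Y)" by (simp add: chain2[OF assoc_psi])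
  finally show ?thesis by (rule cancel_left[OF sym]) auto
qed

lemma psi_unt: assumes [simp]: "X \<in> Obj C" "Y \<in> Obj C"
  shows "psi X Y ** unt (X \<otimes> Y) = unt X \<odot> unt Y"
proof -
  have "assoc H X (H \<otimes> Y) ** psi X Y ** unt (X \<otimes> Y) = H |> braid H X Y ** unt (H \<otimes> X \<otimes> Y) ** unt (X \<otimes> Y)"
    by (simp add: chain2[OF assoc_psi] comult_unit_op)
  also have "\<dots> = unt (X \<otimes> H \<otimes> Y) ** braid H X Y ** unt (X \<otimes> Y)"
    by (simp add: chain2[OF unt_nat[of "braid H X Y"]])
  also have "\<dots> = assoc H X (H \<otimes> Y) ** (unt X \<odot> unt Y)"
    by (simp add: braid_unt interchange'(2)[of "unt X" "unt Y"] chain2[OF unt_suf])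
  finally show ?thesis by (rule cancel_left) auto
qed

end

section \<open>The right adjoint as a monoidal comonad\<close>

context right_internal_hom
begin

lemma base_Obj' [simp]: "H \<in> Obj C" by (rule base_Obj)
lemma ihom_Obj' [simp]: "X \<in> Obj C \<Longrightarrow> G X \<in> Obj C" by (rule ihom_Obj)

lemma ev_typ [simp]: "X \<in> Obj C \<Longrightarrow> ev X \<in> Arr C" "X \<in> Obj C \<Longrightarrow> Dom C (ev X) = H \<otimes> G X" "X \<in> Obj C \<Longrightarrow> Cod C (ev X) = X"
  using ev_Hom[of X] by (auto simp: Hom_iff)

abbreviation tev :: "'o \<Rightarrow> ('o, 'm) tarr" where "tev X \<equiv> lft (ev X)"

lemma transpose:
  assumes "A \<in> Obj C" "X \<in> Obj C" "f \<in> Arr C" "Dom C f = H \<otimes> A" "Cod C f = X"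
  shows "hom_transpose C H G ev A X f \<in> Arr C" "Dom C (hom_transpose C H G ev A X f) = A"
    "Cod C (hom_transpose C H G ev A X f) = G X"
    "tev X ** H |> lft (hom_transpose C H G ev A X f) = lft f"
proof -
  have "f \<in> Hom C (H \<otimes> A) X" using assms by (simp add: Hom_iff)
  then have *: "\<exists>!g. g \<in> Hom C A (G X) \<and> ev X \<cdot> (\<one> H \<boxtimes> g) = f" using ev_universal assms by blast
  have t: "hom_transpose C H G ev A X f \<in> Hom C A (G X)" "ev X \<cdot> (\<one> H \<boxtimes> hom_transpose C H G ev A X f) = f"
    using theI'[OF *] unfolding hom_transpose_def by auto
  then show "hom_transpose C H G ev A X f \<in> Arr C" "Dom C (hom_transpose C H G ev A X f) = A"
    "Cod C (hom_transpose C H G ev A X f) = G X" by (auto simp: Hom_iff)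
  then show "tev X ** H |> lft (hom_transpose C H G ev A X f) = lft f"
    using arg_cong[OF t(2), of lft] assms ident_Hom[of H]
    by (simp add: lft_cmp lft_tens tensor_typ tid_Obj Hom_iff)
qed

lemma ev_cancel:
  assumes "tev X ** H |> t = tev X ** H |> u" "X \<in> Obj C" "val t" "val u" "src t = src u" "trg t = G X" "trg u = G X"
  shows "t = u"
proof -
  obtain a b where *: "t = lft a" "a \<in> Arr C" "u = lft b" "b \<in> Arr C" using assms(3,4) by (metis valE)
  have H: "\<one> H \<in> Arr C" "Dom C (\<one> H) = H" "Cod C (\<one> H) = H" using ident_Hom[of H] by (auto simp: Hom_iff)
  have "lft (ev X \<cdot> (\<one> H \<boxtimes> a)) = lft (ev X \<cdot> (\<one> H \<boxtimes> b))"
    using assms * H by (simp add: lft_cmp lft_tens tensor_typ tid_Obj)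
  then have "ev X \<cdot> (\<one> H \<boxtimes> a) = ev X \<cdot> (\<one> H \<boxtimes> b)"
    by (rule lft_inject) (use assms * H in \<open>simp add: tensor_typ cmp_typ\<close>)
  moreover have "a \<in> Hom C (src t) (G X)" "b \<in> Hom C (src t) (G X)" using * assms by (auto simp: Hom_iff)
  moreover have "ev X \<cdot> (\<one> H \<boxtimes> a) \<in> Hom C (H \<otimes> src t) X"
    using * assms H by (auto simp: Hom_iff tensor_typ cmp_typ)
  ultimately have "a = b" using ev_universal[of "src t" X "ev X \<cdot> (\<one> H \<boxtimes> a)"] assms val_Obj[of t] by auto
  then show ?thesis using * by simp
qed

lemma ev_cancel2:
  assumes "tev X ** H |> tev (G X) ** H |> H |> t = tev X ** H |> tev (G X) ** H |> H |> u"
    "X \<in> Obj C" "val t" "val u" "src t = src u" "trg t = G (G X)" "trg u = G (G X)"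
  shows "t = u"
proof (rule ev_cancel[of "G X"])
  show "tev (G X) ** H |> t = tev (G X) ** H |> u"
    by (rule ev_cancel[of X]) (use assms in auto)
qed (use assms in auto)

lemma ev_cancel3:
  assumes "tev X ** H |> tev (G X) ** H |> H |> tev (G (G X)) ** H |> H |> H |> t = tev X ** H |> tev (G X) ** H |> H |> tev (G (G X)) ** H |> H |> H |> u"
    "X \<in> Obj C" "val t" "val u" "src t = src u" "trg t = G (G (G X))" "trg u = G (G (G X))"
  shows "t = u"
proof (rule ev_cancel[of "G (G X)"])
  show "tev (G (G X)) ** H |> t = tev (G (G X)) ** H |> u"
    by (rule ev_cancel2[of X]) (use assms in auto)
qed (use assms in auto)

definition tG :: "('o, 'm) tarr \<Rightarrow> ('o, 'm) tarr" where
  "tG t = Tarr (G (src t)) (if val t then Some (hom_arr C H G ev (the (raw t))) else None) (G (trg t))"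

lemma hom_arr_typ:
  assumes "f \<in> Arr C"
  shows "hom_arr C H G ev f \<in> Arr C" "Dom C (hom_arr C H G ev f) = G (Dom C f)" "Cod C (hom_arr C H G ev f) = G (Cod C f)"
    "tev (Cod C f) ** H |> lft (hom_arr C H G ev f) = lft f ** tev (Dom C f)"
  using transpose[of "G (Dom C f)" "Cod C f" "f \<cdot> ev (Dom C f)"] assms
  by (simp_all add: hom_arr_def Dom_Obj Cod_Obj cmp_typ lft_cmp)

lemma lft_hom_arr: "f \<in> Arr C \<Longrightarrow> lft (hom_arr C H G ev f) = tG (lft f)"
  by (rule tarr.expand) (simp add: tG_def hom_arr_typ raw_lft)

lemma tG_typ [simp]: "src (tG t) = G (src t)" "trg (tG t) = G (trg t)" "val (tG t) \<longleftrightarrow> val t" "proper (tG t)"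
proof -
  show "src (tG t) = G (src t)" "trg (tG t) = G (trg t)" by (simp_all add: tG_def)
  show v: "val (tG t) \<longleftrightarrow> val t"
  proof
    assume "val t" then show "val (tG t)" by (auto elim!: valE simp: lft_hom_arr[symmetric] hom_arr_typ)
  qed (drule val_raw, simp add: tG_def split: if_splits)
  show "proper (tG t)" by (simp add: proper_def v) (simp add: tG_def)
qed

lemma ev_tG: "trg f = Y \<Longrightarrow> val f \<Longrightarrow> tev Y ** H |> tG f = f ** tev (src f)"
proof -
  assume Y: "trg f = Y" and "val f"
  from \<open>val f\<close> obtain a where "f = lft a" "a \<in> Arr C" by (rule valE)
  then show ?thesis using hom_arr_typ(4)[of a] Y by (simp add: lft_hom_arr)
qed

lemma tG_cmp: "src g = trg f \<Longrightarrow> tG (g ** f) = tG g ** tG f"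
proof (rule teqI)
  assume m: "src g = trg f" and "val (tG (g ** f))"
  then have v: "val g" "val f" by auto
  show "tG (g ** f) = tG g ** tG f"
    by (rule ev_cancel[of "trg g"]) (use m v in \<open>auto simp: val_Obj ev_tG chain2[OF ev_tG]\<close>)
qed auto

lemma tG_tid: "X \<in> Obj C \<Longrightarrow> tG (tid X) = tid (G X)"
  by (rule ev_cancel[of X]) (auto simp: ev_tG)

end

locale hopf_internal_hom = hopf_algebra C c H \<mu> \<eta> \<Delta> \<epsilon> s + right_internal_hom C H G ev
  for C :: "('o, 'm, 'x) monoidal_category_scheme" (structure) and c H \<mu> \<eta> \<Delta> \<epsilon> s G ev
begin

abbreviation "eps X \<equiv> hom_epsilon C G ev \<eta> X"
abbreviation "del X \<equiv> hom_delta C H G ev \<mu> X"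
abbreviation "phi A B \<equiv> hom_phi C H G ev c \<Delta> A B"
abbreviation "phi0 \<equiv> hom_phi0 C H G ev \<epsilon>"
abbreviation "G1 \<equiv> hom_arr C H G ev"

lemmas C_typ = cmp_typ tensor_typ inv_typ assoc_iso lunit_iso runit_iso

lemma unitor_typ:
  "A \<in> Obj C \<Longrightarrow> \<l> A \<in> Arr C" "A \<in> Obj C \<Longrightarrow> Dom C (\<l> A) = \<I> \<otimes> A" "A \<in> Obj C \<Longrightarrow> Cod C (\<l> A) = A"
  "A \<in> Obj C \<Longrightarrow> \<r> A \<in> Arr C" "A \<in> Obj C \<Longrightarrow> Dom C (\<r> A) = A \<otimes> \<I>" "A \<in> Obj C \<Longrightarrow> Cod C (\<r> A) = A"
  using lunit_Hom[of A] runit_Hom[of A] by (auto simp: Hom_iff)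

lemma lft_struct: "A \<in> Obj C \<Longrightarrow> lft (\<one> A) = tid A"
  "A \<in> Obj C \<Longrightarrow> B \<in> Obj C \<Longrightarrow> X \<in> Obj C \<Longrightarrow> lft (\<a> A B X) = assoc A B X"
  "A \<in> Obj C \<Longrightarrow> lft (\<l> A) = lunit A" "A \<in> Obj C \<Longrightarrow> lft (\<r> A) = runit A"
  by (simp_all add: tid_Obj assoc_lft lunit_lft runit_lft)

lemmas lft_rules = C_typ ident_typ assoc_typ unitor_typ lft_struct lft_cmp lft_tens lft_inv lft_hom_arr hom_arr_typ(1-3)

lemma
  assumes "X \<in> Obj C"
  shows eps_typ [simp]: "eps X \<in> Arr C" "Dom C (eps X) = G X" "Cod C (eps X) = X" and lft_eps: "lft (eps X) = tev X ** unt (G X)"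
  using assms unfolding hom_epsilon_def unt_def by (simp_all add: lft_rules)

lemma del_aux: assumes [simp]: "X \<in> Obj C"
  shows "del X \<in> Arr C" "Dom C (del X) = G X" "Cod C (del X) = G (G X)"
    "tev X ** H |> tev (G X) ** H |> H |> lft (del X) = tev X ** mult (G X)"
proof -
  let ?f = "ev X \<cdot> (\<mu> \<boxtimes> \<one> (G X)) \<cdot> inv (\<a> H H (G X))"
  have f: "?f \<in> Arr C" "Dom C ?f = H \<otimes> H \<otimes> G X" "Cod C ?f = X" "lft ?f = tev X ** mult (G X)"
    by (simp_all add: lft_rules mult_def)
  note g = transpose[of "H \<otimes> G X" X ?f, OF _ _ f(1-3), simplified]
  note d = transpose[of "G X" "G X" "hom_transpose C H G ev (H \<otimes> G X) X ?f", OF _ _ g(1-3), simplified]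
  show "del X \<in> Arr C" "Dom C (del X) = G X" "Cod C (del X) = G (G X)"
    unfolding hom_delta_def using d by simp_all
  show "tev X ** H |> tev (G X) ** H |> H |> lft (del X) = tev X ** mult (G X)"
    using pre_eq2[OF d(4), of H] g(4) f(4) d(1-3) unfolding hom_delta_def by simp
qed

lemmas del_typ [simp] = del_aux(1-3)
lemmas ev_del = del_aux(4)

lemma phi_aux: assumes [simp]: "A \<in> Obj C" "B \<in> Obj C"
  shows "phi A B \<in> Arr C" "Dom C (phi A B) = G A \<otimes> G B" "Cod C (phi A B) = G (A \<otimes> B)"
    "tev (A \<otimes> B) ** H |> lft (phi A B) = (tev A \<odot> tev B) ** psi (G A) (G B)"
proof -
  let ?f = "(ev A \<boxtimes> ev B) \<cdot> hopf_psi C H c \<Delta> (G A) (G B)"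
  have p: "hopf_psi C H c \<Delta> (G A) (G B) \<in> Arr C" "Dom C (hopf_psi C H c \<Delta> (G A) (G B)) = H \<otimes> G A \<otimes> G B"
    "Cod C (hopf_psi C H c \<Delta> (G A) (G B)) = (H \<otimes> G A) \<otimes> H \<otimes> G B"
    "lft (hopf_psi C H c \<Delta> (G A) (G B)) = psi (G A) (G B)"
    using mid_braid_typ[of H H "G A" "G B"]
    by (simp_all add: hopf_psi_def lft_rules Hom_iff mid_def psi_def comult_def)
  have f: "?f \<in> Arr C" "Dom C ?f = H \<otimes> G A \<otimes> G B" "Cod C ?f = A \<otimes> B" "lft ?f = (tev A \<odot> tev B) ** psi (G A) (G B)"
    by (simp_all add: lft_rules p)
  show "phi A B \<in> Arr C" "Dom C (phi A B) = G A \<otimes> G B" "Cod C (phi A B) = G (A \<otimes> B)"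
    "tev (A \<otimes> B) ** H |> lft (phi A B) = (tev A \<odot> tev B) ** psi (G A) (G B)"
    using transpose[of "G A \<otimes> G B" "A \<otimes> B" ?f, OF _ _ f(1-3)] f(4) unfolding hom_phi_def by simp_all
qed

lemmas phi_typ [simp] = phi_aux(1-3)
lemmas ev_phi = phi_aux(4)

lemma phi0_aux:
  shows "phi0 \<in> Arr C" "Dom C phi0 = \<I>" "Cod C phi0 = G \<I>" "tev \<I> ** H |> lft phi0 = counit \<I>"
proof -
  have f: "\<epsilon> \<cdot> \<r> H \<in> Arr C" "Dom C (\<epsilon> \<cdot> \<r> H) = H \<otimes> \<I>" "Cod C (\<epsilon> \<cdot> \<r> H) = \<I>" "lft (\<epsilon> \<cdot> \<r> H) = counit \<I>"
    using runit_nat[of "lft \<epsilon>" \<I>] by (simp_all add: lft_rules counit_def unitors_unit)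
  show "phi0 \<in> Arr C" "Dom C phi0 = \<I>" "Cod C phi0 = G \<I>" "tev \<I> ** H |> lft phi0 = counit \<I>"
    using transpose[of \<I> \<I> "\<epsilon> \<cdot> \<r> H", OF _ _ f(1-3)] f(4) unfolding hom_phi0_def by simp_all
qed

lemmas phi0_typ [simp] = phi0_aux(1-3)
lemmas ev_phi0 = phi0_aux(4)

text \<open>
  Evaluation turns every structure arrow of \<open>G\<close> into an operator of \<open>H\<close>. Applied after \<open>ev_cancel\<close> and its
  iterates, these rules and \<open>op_nats\<close> reduce a law of the comonad to the matching law of the monad.
\<close>
lemmas evs = ev_tG ev_tG[THEN chain2] ev_tG[THEN pre_eq2] ev_tG[THEN pre_eq2, THEN chain2]
  ev_tG[THEN pre_eq2, THEN pre_eq2] ev_tG[THEN pre_eq2, THEN pre_eq2, THEN chain2]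
  ev_del ev_del[THEN chain3] ev_del[THEN pre_eq3] ev_del[THEN pre_eq3, THEN chain3]
  ev_phi ev_phi[THEN chain2] ev_phi[THEN pre_eq2] ev_phi[THEN pre_eq2, THEN chain2]
  ev_phi0 ev_phi0[THEN chain2] ev_phi0[THEN pre_eq2] ev_phi0[THEN pre_eq2, THEN chain2]
lemmas op_nats = op_nat_all unt_nat[THEN pre_eq2] unt_nat[THEN pre_eq2, THEN chain2]

lemma hom_delta_nat:
  assumes [simp]: "val f" shows "lft (del (trg f)) ** tG f = tG (tG f) ** lft (del (src f))"
  by (rule ev_cancel2[of "trg f"]) (simp_all add: val_Obj evs op_nats)

lemma hom_delta_coassoc: assumes [simp]: "X \<in> Obj C"
  shows "tG (lft (del X)) ** lft (del X) = lft (del (G X)) ** lft (del X)"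
  by (rule ev_cancel3[of X]) (simp_all add: evs op_nats mult_assoc_op)

lemma hom_epsilon_delta: assumes [simp]: "X \<in> Obj C" shows "lft (eps (G X)) ** lft (del X) = tid (G X)"
  by (rule ev_cancel[of X]) (simp_all add: lft_eps evs op_nats mult_unit_op')

lemma hom_arr_epsilon_delta: assumes [simp]: "X \<in> Obj C" shows "tG (lft (eps X)) ** lft (del X) = tid (G X)"
  by (rule ev_cancel[of X]) (simp_all add: lft_eps evs op_nats mult_unit_op)

lemma hom_phi_nat: assumes [simp]: "val f" "val g"
  shows "lft (phi (trg f) (trg g)) ** (tG f \<odot> tG g) = tG (f \<odot> g) ** lft (phi (src f) (src g))"
proof -
  have "(tev (trg f) \<odot> tev (trg g)) ** (H |> tG f \<odot> H |> tG g) = (f \<odot> g) ** (tev (src f) \<odot> tev (src g))"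
    by (simp add: tens_cmp ev_tG val_Obj del: pre_cmp suf_cmp)
  then show ?thesis
    by - (rule ev_cancel[of "trg f \<otimes> trg g"], simp_all add: val_Obj evs psi_nat chain2[of "tev (trg f) \<odot> tev (trg g)"])
qed

lemma hom_phi_assoc: assumes [simp]: "A \<in> Obj C" "B \<in> Obj C" "X \<in> Obj C"
  shows "tG (assoc A B X) ** lft (phi (A \<otimes> B) X) ** lft (phi A B) <| G X
    = lft (phi A (B \<otimes> X)) ** G A |> lft (phi B X) ** assoc (G A) (G B) (G X)"
proof -
  have l: "(tev (A \<otimes> B) \<odot> tev X) ** (H |> lft (phi A B)) <| (H \<otimes> G X) = ((tev A \<odot> tev B) \<odot> tev X) ** psi (G A) (G B) <| (H \<otimes> G X)"
    using ev_phi[of A B] by (simp add: tens_cmp del: pre_cmp suf_cmp)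
  have r: "(tev A \<odot> tev (B \<otimes> X)) ** (H \<otimes> G A) |> H |> lft (phi B X) = (tev A \<odot> (tev B \<odot> tev X)) ** (H \<otimes> G A) |> psi (G B) (G X)"
    using ev_phi[of B X] by (simp add: tens_cmp del: pre_cmp suf_cmp)
  have "tev (A \<otimes> B \<otimes> X) ** H |> (tG (assoc A B X) ** lft (phi (A \<otimes> B) X) ** lft (phi A B) <| G X)
      = assoc A B X ** (tev (A \<otimes> B) \<odot> tev X) ** (H |> lft (phi A B)) <| (H \<otimes> G X) ** psi (G A \<otimes> G B) (G X)"
    using psi_nat[of "lft (phi A B)" "G (A \<otimes> B)" "tid (G X)" "G X"] by (simp add: evs)
  also have "\<dots> = (tev A \<odot> (tev B \<odot> tev X)) ** (H \<otimes> G A) |> psi (G B) (G X) ** psi (G A) (G B \<otimes> G X) ** H |> assoc (G A) (G B) (G X)"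
    by (simp add: chain2[OF l] chain2[OF assoc_nat] psi_assoc)
  also have "\<dots> = tev (A \<otimes> B \<otimes> X) ** H |> (lft (phi A (B \<otimes> X)) ** G A |> lft (phi B X) ** assoc (G A) (G B) (G X))"
    by (simp add: evs chain2[OF psi_nat[of "tid (G A)" "G A" "lft (phi B X)" "G (B \<otimes> X)"]] chain2[OF r])
  finally show ?thesis by (rule ev_cancel[of "A \<otimes> B \<otimes> X"]) auto
qed

lemma hom_phi_lunit: assumes [simp]: "A \<in> Obj C"
  shows "tG (lunit A) ** lft (phi \<I> A) ** lft phi0 <| G A = lunit (G A)"
proof -
  have l: "(tev \<I> \<odot> tev A) ** (H |> lft phi0) <| (H \<otimes> G A) = \<I> |> tev A ** counit \<I> <| (H \<otimes> G A)"
    using interchange'(1)[of "counit \<I>" "tev A"] ev_phi0 by (simp add: tens_cmp del: pre_cmp suf_cmp)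
  have "tev A ** H |> (tG (lunit A) ** lft (phi \<I> A) ** lft phi0 <| G A)
    = lunit A ** ((tev \<I> \<odot> tev A) ** (H |> lft phi0) <| (H \<otimes> G A)) ** psi \<I> (G A)"
    by (simp add: evs psi_nat)
  also have "\<dots> = tev A ** (lunit (H \<otimes> G A) ** counit \<I> <| (H \<otimes> G A) ** psi \<I> (G A))"
    unfolding l by (simp add: chain2[OF lunit_nat])
  also have "\<dots> = tev A ** H |> lunit (G A)" by (simp only: psi_lunit ihom_Obj' assms)
  finally show ?thesis by (rule ev_cancel[of A]) auto
qed

lemma hom_phi_runit: assumes [simp]: "A \<in> Obj C"
  shows "tG (runit A) ** lft (phi A \<I>) ** G A |> lft phi0 = runit (G A)"
proof -
  have l: "(tev A \<odot> tev \<I>) ** (H \<otimes> G A) |> H |> lft phi0 = tev A <| \<I> ** (H \<otimes> G A) |> counit \<I>"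
    using interchange'(2)[of "tev A" "counit \<I>"] ev_phi0 by (simp add: tens_cmp del: pre_cmp suf_cmp)
  have "tev A ** H |> (tG (runit A) ** lft (phi A \<I>) ** G A |> lft phi0)
    = runit A ** ((tev A \<odot> tev \<I>) ** (H \<otimes> G A) |> H |> lft phi0) ** psi (G A) \<I>"
    by (simp add: evs psi_nat)
  also have "\<dots> = tev A ** (runit (H \<otimes> G A) ** (H \<otimes> G A) |> counit \<I> ** psi (G A) \<I>)"
    unfolding l by (simp add: chain2[OF runit_nat])
  also have "\<dots> = tev A ** H |> runit (G A)" by (simp only: psi_runit ihom_Obj' assms)
  finally show ?thesis by (rule ev_cancel[of A]) auto
qed

lemma hom_delta_phi: assumes [simp]: "A \<in> Obj C" "B \<in> Obj C"
  shows "lft (del (A \<otimes> B)) ** lft (phi A B) = tG (lft (phi A B)) ** lft (phi (G A) (G B)) ** (lft (del A) \<odot> lft (del B))"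
proof -
  have d: "tev X ** H |> (tev (G X) ** H |> lft (del X)) = tev X ** mult (G X)" if "X \<in> Obj C" for X
    using ev_del[OF that] that by simp
  have e: "(tev A \<odot> tev B) ** (H |> tev (G A) \<odot> H |> tev (G B)) ** (H |> H |> lft (del A) \<odot> H |> H |> lft (del B))
    = (tev A \<odot> tev B) ** (mult (G A) \<odot> mult (G B))"
    using d[of A] d[of B] by (simp add: tens_cmp del: pre_cmp suf_cmp)
  have "tev (A \<otimes> B) ** H |> tev (G (A \<otimes> B)) ** H |> H |> (tG (lft (phi A B)) ** lft (phi (G A) (G B)) ** (lft (del A) \<odot> lft (del B)))
    = ((tev A \<odot> tev B) ** (H |> tev (G A) \<odot> H |> tev (G B)) ** (H |> H |> lft (del A) \<odot> H |> H |> lft (del B)))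
      ** psi (H \<otimes> G A) (H \<otimes> G B) ** H |> psi (G A) (G B)"
    by (simp add: evs psi_nat chain2[OF psi_nat] pre_eq2[OF psi_nat])
  also have "\<dots> = (tev A \<odot> tev B) ** psi (G A) (G B) ** mult (G A \<otimes> G B)"
    unfolding e by (simp add: psi_mult)
  also have "\<dots> = tev (A \<otimes> B) ** H |> tev (G (A \<otimes> B)) ** H |> H |> (lft (del (A \<otimes> B)) ** lft (phi A B))"
    by (simp add: evs op_nats)
  finally show ?thesis by - (rule ev_cancel2[of "A \<otimes> B"], erule sym, auto)
qed

lemma hom_delta_phi0: "lft (del \<I>) ** lft phi0 = tG (lft phi0) ** lft phi0"
  by (rule ev_cancel2[of \<I>]) (simp_all add: evs op_nats counit_mult_op)

lemma hom_epsilon_phi: assumes [simp]: "A \<in> Obj C" "B \<in> Obj C"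
  shows "lft (eps (A \<otimes> B)) ** lft (phi A B) = lft (eps A) \<odot> lft (eps B)"
proof -
  have "lft (eps (A \<otimes> B)) ** lft (phi A B) = (tev A \<odot> tev B) ** psi (G A) (G B) ** unt (G A \<otimes> G B)"
    by (simp add: lft_eps evs op_nats)
  then show ?thesis by (simp add: psi_unt tens_cmp lft_eps)
qed

lemma hom_epsilon_phi0: "lft (eps \<I>) ** lft phi0 = tid \<I>"
  by (simp add: lft_eps evs op_nats counit_unit_op)

lemma G_monoidal_comonad: "monoidal_comonad C G G1 (hom_delta C H G ev \<mu>) (hom_epsilon C G ev \<eta>)
    (hom_phi C H G ev c \<Delta>) (hom_phi0 C H G ev \<epsilon>)"
proof (unfold_locales, goal_cases)
  case 1
  have "G1 (g \<cdot> f) = G1 g \<cdot> G1 f" if "f \<in> Arr C" "g \<in> Arr C" "Dom C g = Cod C f" for f g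
    by (rule lft_inject) (use that tG_cmp[of "lft g" "lft f"] in \<open>simp_all add: lft_rules\<close>)
  moreover have "G1 (\<one> A) = \<one> (G A)" if "A \<in> Obj C" for A
    by (rule lft_inject) (use that tG_tid[of A] in \<open>simp_all add: lft_rules\<close>)
  ultimately show ?case by (auto simp: is_functor_def Hom_iff hom_arr_typ)
next
  case 2
  have "del (Cod C f) \<cdot> G1 f = G1 (G1 f) \<cdot> del (Dom C f)" if "f \<in> Arr C" for f
    by (rule lft_inject) (use that hom_delta_nat[of "lft f"] in \<open>simp_all add: lft_rules Dom_Obj Cod_Obj\<close>)
  then show ?case by (auto simp: is_nat_trans_def Hom_iff)
next
  case 3
  have "eps (Cod C f) \<cdot> G1 f = f \<cdot> eps (Dom C f)" if "f \<in> Arr C" for f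
    by (rule lft_inject) (use that in \<open>simp_all add: lft_rules Dom_Obj Cod_Obj lft_eps unt_nat chain2[OF ev_tG]\<close>)
  then show ?case by (auto simp: is_nat_trans_def Hom_iff)
next
  case (4 A) then show ?case by (intro lft_inject) (simp_all add: lft_rules hom_delta_coassoc)
next
  case (5 A) then show ?case by (intro lft_inject) (simp_all add: lft_rules hom_epsilon_delta)
next
  case (6 A) then show ?case by (intro lft_inject) (simp_all add: lft_rules hom_arr_epsilon_delta)
next
  case (7 A B) then show ?case by (simp add: Hom_iff)
next
  case (8 f A A' g B B')
  then show ?case using hom_phi_nat[of "lft f" "lft g"]
    by (intro lft_inject) (auto simp: lft_rules Hom_iff Dom_Obj Cod_Obj)
next
  case 9 show ?case by (simp add: Hom_iff)
next
  case (10 A B X) then show ?case by (intro lft_inject) (simp_all add: lft_rules hom_phi_assoc)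
next
  case (11 A) then show ?case by (intro lft_inject) (simp_all add: lft_rules hom_phi_lunit)
next
  case (12 A) then show ?case by (intro lft_inject) (simp_all add: lft_rules hom_phi_runit)
next
  case (13 A B) then show ?case by (intro lft_inject) (simp_all add: lft_rules hom_delta_phi)
next
  case 14 show ?case by (intro lft_inject) (simp_all add: lft_rules hom_delta_phi0)
next
  case (15 A B) then show ?case by (intro lft_inject) (simp_all add: lft_rules hom_epsilon_phi)
next
  case 16 show ?case by (intro lft_inject) (simp_all add: lft_rules hom_epsilon_phi0)
qed

end

section \<open>Duality by pairings\<close>

context star_autonomous_category
begin

abbreviation S1 where "S1 f \<equiv> S_arr C f"
abbreviation S1' where "S1' f \<equiv> S'_arr C f"

lemmas S_Obj' [simp] = S_Obj S'_Obj dualizing_Obj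

text \<open>
  The universal pairings \<open>S B \<otimes> B \<rightarrow> D\<close> and \<open>A \<otimes> S' A \<rightarrow> D\<close>. By naturality the given bijections are
  composition with them.
\<close>
definition pairS :: "'o \<Rightarrow> ('o, 'm) tarr" where "pairS B = lft (\<pi> (\<S> B) B (\<one> (\<S> B)))"
definition pairS' :: "'o \<Rightarrow> ('o, 'm) tarr" where "pairS' A = lft (\<pi>' A (\<S>' A) (\<one> (\<S>' A)))"

lemma pi_typ: assumes "A \<in> Obj C" "B \<in> Obj C" "f \<in> Hom C A (\<S> B)"
  shows "\<pi> A B f \<in> Hom C (A \<otimes> B) (dualizing C)"
  using varpi_bij[OF assms(1,2)] assms(3) by (auto simp: bij_betw_def)

lemma pi'_typ: assumes "A \<in> Obj C" "B \<in> Obj C" "f \<in> Hom C B (\<S>' A)"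
  shows "\<pi>' A B f \<in> Hom C (A \<otimes> B) (dualizing C)"
  using varpi'_bij[OF assms(1,2)] assms(3) by (auto simp: bij_betw_def)

lemma pairS_typ [simp]: assumes "B \<in> Obj C"
  shows "src (pairS B) = \<S> B \<otimes> B" "trg (pairS B) = dualizing C" "val (pairS B)" "proper (pairS B)"
  using pi_typ[OF S_Obj[OF assms] assms ident_Hom] assms by (simp_all add: pairS_def Hom_iff)

lemma pairS'_typ [simp]: assumes "A \<in> Obj C"
  shows "src (pairS' A) = A \<otimes> \<S>' A" "trg (pairS' A) = dualizing C" "val (pairS' A)" "proper (pairS' A)"
  using pi'_typ[OF assms S'_Obj[OF assms] ident_Hom] assms by (simp_all add: pairS'_def Hom_iff)

lemma lft_pi: assumes "B \<in> Obj C" "f \<in> Arr C" "Dom C f = A" "Cod C f = \<S> B"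
  shows "lft (\<pi> A B f) = pairS B ** lft f <| B"
proof -
  have "\<pi> A B f = \<pi> (\<S> B) B (\<one> (\<S> B)) \<cdot> (f \<boxtimes> \<one> B)"
    using varpi_natural[of B f A "\<S> B" "\<one> (\<S> B)"] ident_left[of f A "\<S> B"] assms ident_Hom[of "\<S> B"] by (simp add: Hom_iff)
  then show ?thesis using pi_typ[OF S_Obj[OF assms(1)] assms(1) ident_Hom] assms
    by (simp add: lft_cmp tensor_typ ident_typ Hom_iff pairS_def lft_tens tid_Obj)
qed

lemma lft_pi': assumes "A \<in> Obj C" "f \<in> Arr C" "Dom C f = B" "Cod C f = \<S>' A"
  shows "lft (\<pi>' A B f) = pairS' A ** A |> lft f"
proof -
  have "\<pi>' A B f = \<pi>' A (\<S>' A) (\<one> (\<S>' A)) \<cdot> (\<one> A \<boxtimes> f)"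
    using varpi'_natural[of A f B "\<S>' A" "\<one> (\<S>' A)"] ident_left[of f B "\<S>' A"] assms ident_Hom[of "\<S>' A"] by (simp add: Hom_iff)
  then show ?thesis using pi'_typ[OF assms(1) S'_Obj[OF assms(1)] ident_Hom] assms
    by (simp add: lft_cmp tensor_typ ident_typ Hom_iff pairS'_def lft_tens tid_Obj)
qed

lemma pairS_cancel:
  assumes "pairS B ** t <| B = pairS B ** u <| B" "B \<in> Obj C" "val t" "val u" "src t = src u" "trg t = \<S> B" "trg u = \<S> B"
  shows "t = u"
proof -
  obtain a b where *: "t = lft a" "a \<in> Arr C" "u = lft b" "b \<in> Arr C" using assms by (metis valE)
  have ab: "a \<in> Hom C (src t) (\<S> B)" "b \<in> Hom C (src t) (\<S> B)" and o: "src t \<in> Obj C"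
    using * assms val_Obj[of t] by (auto simp: Hom_iff)
  have "lft (\<pi> (src t) B a) = lft (\<pi> (src t) B b)" using assms * by (simp add: lft_pi)
  then have "\<pi> (src t) B a = \<pi> (src t) B b"
    by (rule lft_inject) (use pi_typ[OF o assms(2) ab(1)] in \<open>simp add: Hom_iff\<close>)
  then have "a = b" using varpi_bij[OF o assms(2)] ab by (auto simp: bij_betw_def dest: inj_onD)
  then show ?thesis using * by simp
qed

lemma pairS'_cancel:
  assumes "pairS' A ** A |> t = pairS' A ** A |> u" "A \<in> Obj C" "val t" "val u" "src t = src u" "trg t = \<S>' A" "trg u = \<S>' A"
  shows "t = u"
proof -
  obtain a b where *: "t = lft a" "a \<in> Arr C" "u = lft b" "b \<in> Arr C" using assms by (metis valE)
  have ab: "a \<in> Hom C (src t) (\<S>' A)" "b \<in> Hom C (src t) (\<S>' A)" and o: "src t \<in> Obj C"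
    using * assms val_Obj[of t] by (auto simp: Hom_iff)
  have "lft (\<pi>' A (src t) a) = lft (\<pi>' A (src t) b)" using assms * by (simp add: lft_pi')
  then have "\<pi>' A (src t) a = \<pi>' A (src t) b"
    by (rule lft_inject) (use pi'_typ[OF assms(2) o ab(1)] in \<open>simp add: Hom_iff\<close>)
  then have "a = b" using varpi'_bij[OF assms(2) o] ab by (auto simp: bij_betw_def dest: inj_onD)
  then show ?thesis using * by simp
qed

lemma varpi_inv:
  assumes "A \<in> Obj C" "B \<in> Obj C" "f \<in> Arr C" "Dom C f = A \<otimes> B" "Cod C f = dualizing C"
  shows "varpi_inv C A B f \<in> Arr C" "Dom C (varpi_inv C A B f) = A" "Cod C (varpi_inv C A B f) = \<S> B"
    "pairS B ** lft (varpi_inv C A B f) <| B = lft f"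
proof -
  have b: "bij_betw (\<pi> A B) (Hom C A (\<S> B)) (Hom C (A \<otimes> B) (dualizing C))" by (rule varpi_bij) fact+
  have f: "f \<in> Hom C (A \<otimes> B) (dualizing C)" using assms by (simp add: Hom_iff)
  have h: "varpi_inv C A B f \<in> Hom C A (\<S> B)" unfolding varpi_inv_def
    using b f by (auto simp: bij_betw_def intro: the_inv_into_into)
  then show t: "varpi_inv C A B f \<in> Arr C" "Dom C (varpi_inv C A B f) = A" "Cod C (varpi_inv C A B f) = \<S> B"
    by (auto simp: Hom_iff)
  have "\<pi> A B (varpi_inv C A B f) = f" unfolding varpi_inv_def
    using b f by (auto simp: bij_betw_def intro: f_the_inv_into_f)
  then show "pairS B ** lft (varpi_inv C A B f) <| B = lft f" using lft_pi[of B "varpi_inv C A B f" A] t assms by simp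
qed

lemma varpi'_inv:
  assumes "A \<in> Obj C" "B \<in> Obj C" "f \<in> Arr C" "Dom C f = A \<otimes> B" "Cod C f = dualizing C"
  shows "varpi'_inv C A B f \<in> Arr C" "Dom C (varpi'_inv C A B f) = B" "Cod C (varpi'_inv C A B f) = \<S>' A"
    "pairS' A ** A |> lft (varpi'_inv C A B f) = lft f"
proof -
  have b: "bij_betw (\<pi>' A B) (Hom C B (\<S>' A)) (Hom C (A \<otimes> B) (dualizing C))" by (rule varpi'_bij) fact+
  have f: "f \<in> Hom C (A \<otimes> B) (dualizing C)" using assms by (simp add: Hom_iff)
  have h: "varpi'_inv C A B f \<in> Hom C B (\<S>' A)" unfolding varpi'_inv_def
    using b f by (auto simp: bij_betw_def intro: the_inv_into_into)
  then show t: "varpi'_inv C A B f \<in> Arr C" "Dom C (varpi'_inv C A B f) = B" "Cod C (varpi'_inv C A B f) = \<S>' A"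
    by (auto simp: Hom_iff)
  have "\<pi>' A B (varpi'_inv C A B f) = f" unfolding varpi'_inv_def
    using b f by (auto simp: bij_betw_def intro: f_the_inv_into_f)
  then show "pairS' A ** A |> lft (varpi'_inv C A B f) = lft f" using lft_pi'[of A "varpi'_inv C A B f" B] t assms by simp
qed

text \<open>
  The characterisation of \<open>S_arr f\<close> quantifies over all arrows \<open>h\<close> into the dual; naturality reduces it to
  the identity \<open>h\<close>, where it says that \<open>f\<close> and \<open>S f\<close> are adjoint for the pairings.
\<close>
lemma S1_typ:
  assumes f: "f \<in> Arr C"
  shows "S1 f \<in> Arr C" "Dom C (S1 f) = \<S> (Cod C f)" "Cod C (S1 f) = \<S> (Dom C f)"
    "pairS (Dom C f) ** lft (S1 f) <| Dom C f = pairS (Cod C f) ** \<S> (Cod C f) |> lft f"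
proof -
  define X Y where XY: "X = Dom C f" "Y = Cod C f"
  have o [simp]: "X \<in> Obj C" "Y \<in> Obj C" using f XY by (auto simp: Dom_Obj Cod_Obj)
  have pY: "\<pi> (\<S> Y) Y (\<one> (\<S> Y)) \<in> Hom C (\<S> Y \<otimes> Y) (dualizing C)" by (rule pi_typ) (auto simp: ident_Hom)
  let ?k = "\<pi> (\<S> Y) Y (\<one> (\<S> Y)) \<cdot> (\<one> (\<S> Y) \<boxtimes> f)"
  have k: "?k \<in> Arr C" "Dom C ?k = \<S> Y \<otimes> X" "Cod C ?k = dualizing C" "lft ?k = pairS Y ** \<S> Y |> lft f"
    using pY f XY[symmetric] by (simp_all add: Hom_iff cmp_typ tensor_typ ident_typ lft_cmp lft_tens tid_Obj pairS_def)
  let ?P = "\<lambda>g. g \<in> Hom C (\<S> Y) (\<S> X) \<and> (\<forall>A\<in>Obj C. \<forall>h\<in>Hom C A (\<S> Y). \<pi> A X (g \<cdot> h) = \<pi> A Y h \<cdot> (\<one> A \<boxtimes> f))"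
  have char: "?P g \<longleftrightarrow> g \<in> Hom C (\<S> Y) (\<S> X) \<and> pairS X ** lft g <| X = pairS Y ** \<S> Y |> lft f" for g
  proof (intro iffI conjI ballI; (elim conjE)?)
    assume g: "g \<in> Hom C (\<S> Y) (\<S> X)" and a: "\<forall>A\<in>Obj C. \<forall>h\<in>Hom C A (\<S> Y). \<pi> A X (g \<cdot> h) = \<pi> A Y h \<cdot> (\<one> A \<boxtimes> f)"
    have "\<pi> (\<S> Y) X (g \<cdot> \<one> (\<S> Y)) = ?k" using a ident_Hom[of "\<S> Y"] by auto
    then have "\<pi> (\<S> Y) X g = ?k" using ident_right[OF g] by simp
    then show "pairS X ** lft g <| X = pairS Y ** \<S> Y |> lft f" using k(4) g lft_pi[of X g "\<S> Y"] by (simp add: Hom_iff)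
  next
    fix A h assume g: "g \<in> Hom C (\<S> Y) (\<S> X)" and e: "pairS X ** lft g <| X = pairS Y ** \<S> Y |> lft f"
      and A: "A \<in> Obj C" and h: "h \<in> Hom C A (\<S> Y)"
    have gh: "g \<cdot> h \<in> Hom C A (\<S> X)" using cmp_Hom[OF h g] .
    have ph: "\<pi> A Y h \<in> Hom C (A \<otimes> Y) (dualizing C)" by (rule pi_typ) (use A h in auto)
    show "\<pi> A X (g \<cdot> h) = \<pi> A Y h \<cdot> (\<one> A \<boxtimes> f)"
    proof (rule lft_inject)
      have "lft (\<pi> A X (g \<cdot> h)) = pairS X ** lft g <| X ** lft h <| X"
        using gh g h lft_pi[of X "g \<cdot> h" A] by (simp add: Hom_iff lft_cmp)
      also have "\<dots> = pairS Y ** lft h <| Y ** A |> lft f"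
        using h f XY[symmetric] by (simp add: chain2[OF e] struct_nat Hom_iff)
      also have "\<dots> = lft (\<pi> A Y h \<cdot> (\<one> A \<boxtimes> f))"
        using h ph f XY[symmetric] A lft_pi[of Y h A] by (simp add: Hom_iff lft_cmp tensor_typ ident_typ lft_tens tid_Obj)
      finally show "lft (\<pi> A X (g \<cdot> h)) = lft (\<pi> A Y h \<cdot> (\<one> A \<boxtimes> f))" .
      show "\<pi> A X (g \<cdot> h) \<in> Arr C" using pi_typ[OF A _ gh] by (simp add: Hom_iff)
    qed
  qed auto
  note v = varpi_inv[OF _ _ k(1-3), simplified]
  have w: "?P (varpi_inv C (\<S> Y) X ?k)" unfolding char using v k(4) by (simp add: Hom_iff)
  have ex: "\<exists>!g. ?P g"
  proof (rule ex1I[of ?P, OF w])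
    fix g assume g: "?P g"
    have "lft g = lft (varpi_inv C (\<S> Y) X ?k)" using g w unfolding char by - (rule pairS_cancel[of X], auto simp: Hom_iff)
    then show "g = varpi_inv C (\<S> Y) X ?k" by (rule lft_inject) (use g in \<open>simp add: Hom_iff\<close>)
  qed
  have "?P (S1 f)" using theI'[OF ex] unfolding S_arr_def XY .
  then have "S1 f \<in> Hom C (\<S> Y) (\<S> X)" "pairS X ** lft (S1 f) <| X = pairS Y ** \<S> Y |> lft f" unfolding char by auto
  then show "S1 f \<in> Arr C" "Dom C (S1 f) = \<S> (Cod C f)" "Cod C (S1 f) = \<S> (Dom C f)"
    "pairS (Dom C f) ** lft (S1 f) <| Dom C f = pairS (Cod C f) ** \<S> (Cod C f) |> lft f"
    by (auto simp: Hom_iff XY)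
qed

lemma S1'_typ:
  assumes f: "f \<in> Arr C"
  shows "S1' f \<in> Arr C" "Dom C (S1' f) = \<S>' (Cod C f)" "Cod C (S1' f) = \<S>' (Dom C f)"
    "pairS' (Dom C f) ** Dom C f |> lft (S1' f) = pairS' (Cod C f) ** lft f <| \<S>' (Cod C f)"
proof -
  define X Y where XY: "X = Dom C f" "Y = Cod C f"
  have o [simp]: "X \<in> Obj C" "Y \<in> Obj C" using f XY by (auto simp: Dom_Obj Cod_Obj)
  have pY: "\<pi>' Y (\<S>' Y) (\<one> (\<S>' Y)) \<in> Hom C (Y \<otimes> \<S>' Y) (dualizing C)" by (rule pi'_typ) (auto simp: ident_Hom)
  let ?k = "\<pi>' Y (\<S>' Y) (\<one> (\<S>' Y)) \<cdot> (f \<boxtimes> \<one> (\<S>' Y))"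
  have k: "?k \<in> Arr C" "Dom C ?k = X \<otimes> \<S>' Y" "Cod C ?k = dualizing C" "lft ?k = pairS' Y ** lft f <| \<S>' Y"
    using pY f XY[symmetric] by (simp_all add: Hom_iff cmp_typ tensor_typ ident_typ lft_cmp lft_tens tid_Obj pairS'_def)
  let ?P = "\<lambda>g. g \<in> Hom C (\<S>' Y) (\<S>' X) \<and> (\<forall>B\<in>Obj C. \<forall>h\<in>Hom C B (\<S>' Y). \<pi>' X B (g \<cdot> h) = \<pi>' Y B h \<cdot> (f \<boxtimes> \<one> B))"
  have char: "?P g \<longleftrightarrow> g \<in> Hom C (\<S>' Y) (\<S>' X) \<and> pairS' X ** X |> lft g = pairS' Y ** lft f <| \<S>' Y" for g
  proof (intro iffI conjI ballI; (elim conjE)?)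
    assume g: "g \<in> Hom C (\<S>' Y) (\<S>' X)" and a: "\<forall>A\<in>Obj C. \<forall>h\<in>Hom C A (\<S>' Y). \<pi>' X A (g \<cdot> h) = \<pi>' Y A h \<cdot> (f \<boxtimes> \<one> A)"
    have "\<pi>' X (\<S>' Y) (g \<cdot> \<one> (\<S>' Y)) = ?k" using a ident_Hom[of "\<S>' Y"] by auto
    then have "\<pi>' X (\<S>' Y) g = ?k" using ident_right[OF g] by simp
    then show "pairS' X ** X |> lft g = pairS' Y ** lft f <| \<S>' Y" using k(4) g lft_pi'[of X g "\<S>' Y"] by (simp add: Hom_iff)
  next
    fix A h assume g: "g \<in> Hom C (\<S>' Y) (\<S>' X)" and e: "pairS' X ** X |> lft g = pairS' Y ** lft f <| \<S>' Y"
      and A: "A \<in> Obj C" and h: "h \<in> Hom C A (\<S>' Y)"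
    have gh: "g \<cdot> h \<in> Hom C A (\<S>' X)" using cmp_Hom[OF h g] .
    have ph: "\<pi>' Y A h \<in> Hom C (Y \<otimes> A) (dualizing C)" by (rule pi'_typ) (use A h in auto)
    show "\<pi>' X A (g \<cdot> h) = \<pi>' Y A h \<cdot> (f \<boxtimes> \<one> A)"
    proof (rule lft_inject)
      have "lft (\<pi>' X A (g \<cdot> h)) = pairS' X ** X |> lft g ** X |> lft h"
        using gh g h lft_pi'[of X "g \<cdot> h" A] by (simp add: Hom_iff lft_cmp)
      also have "\<dots> = pairS' Y ** Y |> lft h ** lft f <| A"
        using h f XY[symmetric] by (simp add: chain2[OF e] struct_nat Hom_iff)
      also have "\<dots> = lft (\<pi>' Y A h \<cdot> (f \<boxtimes> \<one> A))"
        using h ph f XY[symmetric] A lft_pi'[of Y h A] by (simp add: Hom_iff lft_cmp tensor_typ ident_typ lft_tens tid_Obj)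
      finally show "lft (\<pi>' X A (g \<cdot> h)) = lft (\<pi>' Y A h \<cdot> (f \<boxtimes> \<one> A))" .
      show "\<pi>' X A (g \<cdot> h) \<in> Arr C" using pi'_typ[OF _ A gh] by (simp add: Hom_iff)
    qed
  qed auto
  note v = varpi'_inv[OF _ _ k(1-3), simplified]
  have w: "?P (varpi'_inv C X (\<S>' Y) ?k)" unfolding char using v k(4) by (simp add: Hom_iff)
  have ex: "\<exists>!g. ?P g"
  proof (rule ex1I[of ?P, OF w])
    fix g assume g: "?P g"
    have "lft g = lft (varpi'_inv C X (\<S>' Y) ?k)" using g w unfolding char by - (rule pairS'_cancel[of X], auto simp: Hom_iff)
    then show "g = varpi'_inv C X (\<S>' Y) ?k" by (rule lft_inject) (use g in \<open>simp add: Hom_iff\<close>)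
  qed
  have "?P (S1' f)" using theI'[OF ex] unfolding S'_arr_def XY .
  then have "S1' f \<in> Hom C (\<S>' Y) (\<S>' X)" "pairS' X ** X |> lft (S1' f) = pairS' Y ** lft f <| \<S>' Y" unfolding char by auto
  then show "S1' f \<in> Arr C" "Dom C (S1' f) = \<S>' (Cod C f)" "Cod C (S1' f) = \<S>' (Dom C f)"
    "pairS' (Dom C f) ** Dom C f |> lft (S1' f) = pairS' (Cod C f) ** lft f <| \<S>' (Cod C f)"
    by (auto simp: Hom_iff XY)
qed

definition tS :: "('o, 'm) tarr \<Rightarrow> ('o, 'm) tarr" where
  "tS t = Tarr (\<S> (trg t)) (if val t then Some (S1 (the (raw t))) else None) (\<S> (src t))"
definition tS' :: "('o, 'm) tarr \<Rightarrow> ('o, 'm) tarr" where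
  "tS' t = Tarr (\<S>' (trg t)) (if val t then Some (S1' (the (raw t))) else None) (\<S>' (src t))"

lemma lft_S1: "f \<in> Arr C \<Longrightarrow> lft (S1 f) = tS (lft f)"
  by (rule tarr.expand) (simp add: tS_def S1_typ raw_lft)
lemma lft_S1': "f \<in> Arr C \<Longrightarrow> lft (S1' f) = tS' (lft f)"
  by (rule tarr.expand) (simp add: tS'_def S1'_typ raw_lft)

lemma tS_typ [simp]: "src (tS t) = \<S> (trg t)" "trg (tS t) = \<S> (src t)" "val (tS t) \<longleftrightarrow> val t" "proper (tS t)"
proof -
  show "src (tS t) = \<S> (trg t)" "trg (tS t) = \<S> (src t)" by (simp_all add: tS_def)
  show v: "val (tS t) \<longleftrightarrow> val t"
  proof
    assume "val t" then show "val (tS t)" by (auto elim!: valE simp: lft_S1[symmetric] S1_typ)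
  qed (drule val_raw, simp add: tS_def split: if_splits)
  show "proper (tS t)" by (simp add: proper_def v) (simp add: tS_def)
qed

lemma tS'_typ [simp]: "src (tS' t) = \<S>' (trg t)" "trg (tS' t) = \<S>' (src t)" "val (tS' t) \<longleftrightarrow> val t" "proper (tS' t)"
proof -
  show "src (tS' t) = \<S>' (trg t)" "trg (tS' t) = \<S>' (src t)" by (simp_all add: tS'_def)
  show v: "val (tS' t) \<longleftrightarrow> val t"
  proof
    assume "val t" then show "val (tS' t)" by (auto elim!: valE simp: lft_S1'[symmetric] S1'_typ)
  qed (drule val_raw, simp add: tS'_def split: if_splits)
  show "proper (tS' t)" by (simp add: proper_def v) (simp add: tS'_def)
qed

lemma pairS_tS: assumes "src f = X" "val f" shows "pairS X ** tS f <| X = pairS (trg f) ** \<S> (trg f) |> f"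
proof -
  from assms(2) obtain a where "f = lft a" "a \<in> Arr C" by (rule valE)
  then show ?thesis using S1_typ(4)[of a] assms(1) by (simp add: lft_S1)
qed

lemma pairS'_tS': assumes "src f = X" "val f" shows "pairS' X ** X |> tS' f = pairS' (trg f) ** f <| \<S>' (trg f)"
proof -
  from assms(2) obtain a where "f = lft a" "a \<in> Arr C" by (rule valE)
  then show ?thesis using S1'_typ(4)[of a] assms(1) by (simp add: lft_S1')
qed

lemma pi_ident_typ: assumes "B \<in> Obj C"
  shows "\<pi> (\<S> B) B (\<one> (\<S> B)) \<in> Arr C" "Dom C (\<pi> (\<S> B) B (\<one> (\<S> B))) = \<S> B \<otimes> B" "Cod C (\<pi> (\<S> B) B (\<one> (\<S> B))) = dualizing C"
  using pi_typ[OF S_Obj[OF assms] assms ident_Hom] assms by (simp_all add: Hom_iff)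

lemma pi'_ident_typ: assumes "B \<in> Obj C"
  shows "\<pi>' B (\<S>' B) (\<one> (\<S>' B)) \<in> Arr C" "Dom C (\<pi>' B (\<S>' B) (\<one> (\<S>' B))) = B \<otimes> \<S>' B" "Cod C (\<pi>' B (\<S>' B) (\<one> (\<S>' B))) = dualizing C"
  using pi'_typ[OF assms S'_Obj[OF assms] ident_Hom] assms by (simp_all add: Hom_iff)

lemma omega: assumes [simp]: "A \<in> Obj C" "B \<in> Obj C" "X \<in> Obj C" and f: "f \<in> Arr C" "Dom C f = A" "Cod C f = \<S> (B \<otimes> X)"
  shows "omega C A B X f \<in> Arr C" "Dom C (omega C A B X f) = A \<otimes> B" "Cod C (omega C A B X f) = \<S> X"
    "pairS X ** lft (omega C A B X f) <| X = pairS (B \<otimes> X) ** lft f <| (B \<otimes> X) ** assoc A B X"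
proof -
  let ?k = "\<pi> A (B \<otimes> X) f \<cdot> \<a> A B X"
  have "\<pi> A (B \<otimes> X) f \<in> Hom C (A \<otimes> B \<otimes> X) (dualizing C)" by (rule pi_typ) (use f in \<open>auto simp: Hom_iff\<close>)
  then have k: "?k \<in> Arr C" "Dom C ?k = (A \<otimes> B) \<otimes> X" "Cod C ?k = dualizing C"
    "lft ?k = pairS (B \<otimes> X) ** lft f <| (B \<otimes> X) ** assoc A B X"
    using lft_pi[of "B \<otimes> X" f A] f by (simp_all add: Hom_iff cmp_typ lft_cmp assoc_typ assoc_lft)
  note v = varpi_inv[OF _ _ k(1-3), simplified]
  show "omega C A B X f \<in> Arr C" "Dom C (omega C A B X f) = A \<otimes> B" "Cod C (omega C A B X f) = \<S> X"
    "pairS X ** lft (omega C A B X f) <| X = pairS (B \<otimes> X) ** lft f <| (B \<otimes> X) ** assoc A B X"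
    unfolding omega_def using v k(4) by simp_all
qed

lemma e_typ [simp]: assumes "B \<in> Obj C" "X \<in> Obj C"
  shows "e_arr C B X \<in> Arr C" "Dom C (e_arr C B X) = \<S> (B \<otimes> X) \<otimes> B" "Cod C (e_arr C B X) = \<S> X"
  using assms unfolding e_arr_def by (simp_all add: omega ident_typ)
lemma pairS_e: assumes "B \<in> Obj C" "X \<in> Obj C"
  shows "pairS X ** lft (e_arr C B X) <| X = pairS (B \<otimes> X) ** assoc (\<S> (B \<otimes> X)) B X"
  using assms unfolding e_arr_def by (simp add: omega ident_typ tid_Obj[symmetric])

lemma e'_aux: assumes [simp]: "X \<in> Obj C" "Y \<in> Obj C"
  shows "e'_arr C X Y \<in> Arr C" "Dom C (e'_arr C X Y) = Y \<otimes> \<S>' (X \<otimes> Y)" "Cod C (e'_arr C X Y) = \<S>' X"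
    "pairS' X ** X |> lft (e'_arr C X Y) = pairS' (X \<otimes> Y) ** assoc_inv X Y (\<S>' (X \<otimes> Y))"
proof -
  let ?Z = "\<S>' (X \<otimes> Y)"
  let ?k = "\<pi>' (X \<otimes> Y) ?Z (\<one> ?Z) \<cdot> inv (\<a> X Y ?Z)"
  have k: "?k \<in> Arr C" "Dom C ?k = X \<otimes> Y \<otimes> ?Z" "Cod C ?k = dualizing C" "lft ?k = pairS' (X \<otimes> Y) ** assoc_inv X Y ?Z"
    by (simp_all add: cmp_typ pi'_ident_typ inv_typ assoc_iso assoc_typ lft_cmp lft_inv assoc_lft pairS'_def)
  note v = varpi'_inv[OF _ _ k(1-3), simplified]
  show "e'_arr C X Y \<in> Arr C" "Dom C (e'_arr C X Y) = Y \<otimes> \<S>' (X \<otimes> Y)" "Cod C (e'_arr C X Y) = \<S>' X"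
    "pairS' X ** X |> lft (e'_arr C X Y) = pairS' (X \<otimes> Y) ** assoc_inv X Y (\<S>' (X \<otimes> Y))"
    unfolding e'_arr_def using v k(4) by simp_all
qed
lemmas e'_typ [simp] = e'_aux(1-3)
lemmas pairS'_e' = e'_aux(4)

lemma alpha_aux: assumes [simp]: "A \<in> Obj C"
  shows "adj_unit C A \<in> Arr C" "Dom C (adj_unit C A) = A" "Cod C (adj_unit C A) = \<S> (\<S>' A)"
    "pairS (\<S>' A) ** lft (adj_unit C A) <| \<S>' A = pairS' A"
  unfolding adj_unit_def using varpi_inv[of A "\<S>' A" "\<pi>' A (\<S>' A) (\<one> (\<S>' A))"] pi'_ident_typ[of A]
  by (simp_all add: pairS'_def)
lemmas alpha_typ [simp] = alpha_aux(1-3)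
lemmas pairS_alpha = alpha_aux(4)

lemma beta_aux: assumes [simp]: "A \<in> Obj C"
  shows "adj_counit C A \<in> Arr C" "Dom C (adj_counit C A) = A" "Cod C (adj_counit C A) = \<S>' (\<S> A)"
    "pairS' (\<S> A) ** \<S> A |> lft (adj_counit C A) = pairS A"
  unfolding adj_counit_def using varpi'_inv[of "\<S> A" A "\<pi> (\<S> A) A (\<one> (\<S> A))"] pi_ident_typ[of A]
  by (simp_all add: pairS_def)
lemmas beta_typ [simp] = beta_aux(1-3)
lemmas pairS'_beta = beta_aux(4)

lemma pairS_unit: "pairS \<I> = runit (\<S> \<I>)"
proof -
  have "\<pi> (\<S> \<I>) \<I> (\<one> (\<S> \<I>)) = \<one> (\<S> \<I>) \<cdot> \<r> (\<S> \<I>)" by (rule varpi_unit) (simp add: ident_Hom)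
  also have "\<dots> = \<r> (\<S> \<I>)" by (rule ident_left[OF runit_Hom]) simp
  finally show ?thesis by (simp add: pairS_def runit_lft)
qed

text \<open>
  Paired with \<open>S I\<close>, the arrow \<open>n\<close> is the left unitor, that is, \<open>n\<close> names the identity of \<open>S I = D\<close>. The
  inverse of \<open>\<omega>\<close> in its definition is computed from an explicit preimage.
\<close>
lemma n_aux: "n_unit C \<in> Arr C" "Dom C (n_unit C) = \<I>" "Cod C (n_unit C) = \<S> (\<S> \<I>)"
    "pairS (\<S> \<I>) ** lft (n_unit C) <| \<S> \<I> = lunit (\<S> \<I>)"
proof -
  let ?D = "\<S> \<I>"
  have lt: "\<l> ?D \<in> Arr C" "Dom C (\<l> ?D) = \<I> \<otimes> ?D" "Cod C (\<l> ?D) = ?D" "\<r> ?D \<in> Arr C" "Dom C (\<r> ?D) = ?D \<otimes> \<I>" "Cod C (\<r> ?D) = ?D"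
    "iso_arrow C (\<r> ?D)"
    using lunit_Hom[of ?D] runit_Hom[of ?D] runit_iso[of ?D] by (auto simp: Hom_iff)
  let ?m = "\<r> ?D \<cdot> (\<l> ?D \<boxtimes> \<one> \<I>) \<cdot> inv (\<a> \<I> ?D \<I>)"
  have m: "?m \<in> Arr C" "Dom C ?m = \<I> \<otimes> ?D \<otimes> \<I>" "Cod C ?m = dualizing C" "lft ?m = runit ?D ** lunit ?D <| \<I> ** assoc_inv \<I> ?D \<I>"
    using lt by (simp_all add: S_unit cmp_typ tensor_typ inv_typ assoc_iso assoc_typ ident_typ lft_cmp lft_inv lft_tens tid_Obj runit_lft lunit_lft assoc_lft)
  define r where "r = varpi_inv C \<I> (?D \<otimes> \<I>) ?m"
  note r = varpi_inv[OF _ _ m(1-3), simplified, folded r_def]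
  have om: "omega C \<I> ?D \<I> r = \<l> ?D"
  proof (rule lft_inject)
    have "pairS \<I> ** lft (omega C \<I> ?D \<I> r) <| \<I> = (pairS (?D \<otimes> \<I>) ** lft r <| (?D \<otimes> \<I>)) ** assoc \<I> ?D \<I>"
      using r(1-3) by (simp add: omega)
    also have "\<dots> = runit ?D ** lunit ?D <| \<I>" unfolding r(4) m(4) by simp
    also have "\<dots> = pairS \<I> ** lft (\<l> ?D) <| \<I>" by (simp add: pairS_unit lunit_lft)
    finally have "pairS \<I> ** lft (omega C \<I> ?D \<I> r) <| \<I> = pairS \<I> ** lft (\<l> ?D) <| \<I>" .
    then show "lft (omega C \<I> ?D \<I> r) = lft (\<l> ?D)" by (rule pairS_cancel) (use r lt in \<open>simp_all add: omega\<close>)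
  qed (use r in \<open>simp add: omega\<close>)
  have inj: "inj_on (omega C \<I> ?D \<I>) (Hom C \<I> (\<S> (?D \<otimes> \<I>)))"
  proof (rule inj_onI)
    fix f g assume fg: "f \<in> Hom C \<I> (\<S> (?D \<otimes> \<I>))" "g \<in> Hom C \<I> (\<S> (?D \<otimes> \<I>))" and e: "omega C \<I> ?D \<I> f = omega C \<I> ?D \<I> g"
    then have "(pairS (?D \<otimes> \<I>) ** lft f <| (?D \<otimes> \<I>)) ** assoc \<I> ?D \<I> = (pairS (?D \<otimes> \<I>) ** lft g <| (?D \<otimes> \<I>)) ** assoc \<I> ?D \<I>"
      using omega(4)[of \<I> ?D \<I> f] omega(4)[of \<I> ?D \<I> g] by (simp add: Hom_iff)
    then have "pairS (?D \<otimes> \<I>) ** lft f <| (?D \<otimes> \<I>) = pairS (?D \<otimes> \<I>) ** lft g <| (?D \<otimes> \<I>)"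
      by (rule cancel_right) (use fg in \<open>auto simp: Hom_iff\<close>)
    then have "lft f = lft g" by (rule pairS_cancel) (use fg in \<open>auto simp: Hom_iff\<close>)
    then show "f = g" by (rule lft_inject) (use fg in \<open>auto simp: Hom_iff\<close>)
  qed
  have "\<one> ?D \<cdot> \<l> ?D = \<l> ?D" by (rule ident_left[OF lunit_Hom]) simp
  then have rho: "rho C ?D \<I> (\<one> ?D) = r"
    unfolding rho_def omega_inv_def using the_inv_into_f_eq[OF inj om] r by (simp add: Hom_iff)
  have n: "n_unit C = S1 (inv (\<r> ?D)) \<cdot> r" by (simp add: n_unit_def rho)
  have si: "S1 (inv (\<r> ?D)) \<in> Arr C" "Dom C (S1 (inv (\<r> ?D))) = \<S> (?D \<otimes> \<I>)" "Cod C (S1 (inv (\<r> ?D))) = \<S> ?D"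
    "lft (S1 (inv (\<r> ?D))) = tS (tinv (runit ?D))"
    using lt S1_typ[of "inv (\<r> ?D)"] by (simp_all add: inv_typ lft_S1 lft_inv runit_lft)
  show "n_unit C \<in> Arr C" "Dom C (n_unit C) = \<I>" "Cod C (n_unit C) = \<S> (\<S> \<I>)"
    using r si by (simp_all add: n cmp_typ)
  have "pairS ?D ** lft (n_unit C) <| ?D = pairS ?D ** tS (tinv (runit ?D)) <| ?D ** lft r <| ?D"
    using r si by (simp add: n lft_cmp)
  also have "\<dots> = (pairS (?D \<otimes> \<I>) ** lft r <| (?D \<otimes> \<I>)) ** \<I> |> tinv (runit ?D)"
    using r(1-3) by (simp add: chain2[OF pairS_tS] interchange_rev)
  also have "\<dots> = runit ?D ** lunit ?D <| \<I> ** assoc_inv \<I> ?D \<I> ** \<I> |> tinv (runit ?D)" unfolding r(4) m(4) by simp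
  also have "\<dots> = lunit ?D ** runit (\<I> \<otimes> ?D) ** assoc_inv \<I> ?D \<I> ** \<I> |> tinv (runit ?D)" by (simp add: chain2[OF runit_nat])
  also have "\<dots> = lunit ?D" by (simp add: runit_tensor[symmetric])
  finally show "pairS (\<S> \<I>) ** lft (n_unit C) <| \<S> \<I> = lunit (\<S> \<I>)" .
qed
lemmas n_typ [simp] = n_aux(1-3)
lemmas pairS_n = n_aux(4)

end

section \<open>The transformations between duals\<close>

locale star_hopf = star_autonomous_category C + hopf_internal_hom C c H \<mu> \<eta> \<Delta> \<epsilon> s G ev
  for C :: "('o, 'm, 'x) star_category_scheme" (structure) and c H \<mu> \<eta> \<Delta> \<epsilon> s G ev +
  assumes s_iso: "iso_arrow C s"
begin

abbreviation "nu X \<equiv> hom_nu C H G ev c s X"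
abbreviation "nu' X \<equiv> hom_nu' C H G ev c s X"

lemma c_typ: "A \<in> Obj C \<Longrightarrow> B \<in> Obj C \<Longrightarrow> c A B \<in> Arr C" "A \<in> Obj C \<Longrightarrow> B \<in> Obj C \<Longrightarrow> Dom C (c A B) = A \<otimes> B"
  "A \<in> Obj C \<Longrightarrow> B \<in> Obj C \<Longrightarrow> Cod C (c A B) = B \<otimes> A"
  using braid_Hom[of A B] by (auto simp: Hom_iff)

lemmas lft_rules' = lft_rules c_typ tbraid_lft[symmetric] braid_iso S1_typ(1-3) S1'_typ(1-3) lft_S1 lft_S1' s_iso

lemma anti_iso [simp]: "X \<in> Obj C \<Longrightarrow> tiso (anti X)"
  by (simp add: anti_def s_iso)
lemma tinv_anti: "X \<in> Obj C \<Longrightarrow> tinv (anti X) = tinv (lft s) <| X"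
  unfolding anti_def by (rule tinv_unique) (simp_all add: s_iso)

lemma anti_inv_nat: "trg f = Y \<Longrightarrow> val f \<Longrightarrow> tinv (anti Y) ** H |> f = H |> f ** tinv (anti (src f))"
  by (rule iso_conj[symmetric]) (auto simp: anti_nat val_Obj)

lemma braid_inv_nat: assumes "trg f = A'" "trg g = B'" "trg h = X'" "val f" "val g" "val h"
  shows "tinv (braid A' B' X') ** (g \<odot> (f \<odot> h)) = (f \<odot> (g \<odot> h)) ** tinv (braid (src f) (src g) (src h))"
  by (rule iso_conj[symmetric]) (use assms in \<open>auto simp: braid_nat val_Obj\<close>)

lemma nuT_aux: assumes [simp]: "X \<in> Obj C"
  shows "nuT C H c s X \<in> Arr C" "Dom C (nuT C H c s X) = H \<otimes> \<S> (H \<otimes> X)" "Cod C (nuT C H c s X) = \<S> X"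
    "pairS X ** lft (nuT C H c s X) <| X = pairS (H \<otimes> X) ** \<S> (H \<otimes> X) |> anti X ** braid H (\<S> (H \<otimes> X)) X ** assoc H (\<S> (H \<otimes> X)) X"
  by (simp_all add: nuT_def lft_rules' chain2[OF pairS_e] braid_assoc chain2[OF assoc_nat] anti_def)

lemma nu'T_aux: assumes [simp]: "X \<in> Obj C"
  shows "nu'T C H c s X \<in> Arr C" "Dom C (nu'T C H c s X) = H \<otimes> \<S>' (H \<otimes> X)" "Cod C (nu'T C H c s X) = \<S>' X"
    "pairS' X ** X |> lft (nu'T C H c s X) = pairS' (H \<otimes> X) ** assoc_inv H X (\<S>' (H \<otimes> X)) ** tinv (anti (X \<otimes> \<S>' (H \<otimes> X))) ** tinv (braid H X (\<S>' (H \<otimes> X)))"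
proof -
  let ?Z = "\<S>' (H \<otimes> X)"
  show "nu'T C H c s X \<in> Arr C" "Dom C (nu'T C H c s X) = H \<otimes> \<S>' (H \<otimes> X)" "Cod C (nu'T C H c s X) = \<S>' X"
    by (simp_all add: nu'T_def lft_rules')
  have l: "lft (nu'T C H c s X) = lft (e'_arr C X H) ** H |> tS' (tinv (tbraid H X)) ** tinv (lft s) <| ?Z"
    using interchange'(1)[of "tinv (lft s)" "tS' (tinv (tbraid H X))"] by (simp add: nu'T_def lft_rules')
  have b: "tinv (braid H X ?Z) = assoc H X ?Z ** tinv (tbraid H X) <| ?Z ** assoc_inv X H ?Z"
    by (rule tinv_unique) (simp_all add: braid_def)
  have bn: "tinv (braid H X ?Z) ** X |> tinv (anti ?Z) = tinv (anti (X \<otimes> ?Z)) ** tinv (braid H X ?Z)"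
    using braid_inv_nat[of "tinv (lft s)" H "tid X" X "tid ?Z" ?Z] by (simp add: tinv_anti s_iso)
  have tn: "assoc_inv X H (\<S>' (X \<otimes> H)) ** X |> H |> tS' (tinv (tbraid H X)) = (X \<otimes> H) |> tS' (tinv (tbraid H X)) ** assoc_inv X H ?Z"
    using assoc_inv_nat[of "tid X" X "tid H" H "tS' (tinv (tbraid H X))" "\<S>' (X \<otimes> H)"] by simp
  have "pairS' X ** X |> lft (nu'T C H c s X)
    = pairS' (X \<otimes> H) ** (X \<otimes> H) |> tS' (tinv (tbraid H X)) ** assoc_inv X H ?Z ** X |> tinv (anti ?Z)"
    by (simp add: l chain2[OF pairS'_e'] tinv_anti chain2[OF tn])
  also have "\<dots> = pairS' (H \<otimes> X) ** assoc_inv H X ?Z ** tinv (braid H X ?Z) ** X |> tinv (anti ?Z)"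
    by (simp add: chain2[OF pairS'_tS'] b)
  finally show "pairS' X ** X |> lft (nu'T C H c s X) = pairS' (H \<otimes> X) ** assoc_inv H X (\<S>' (H \<otimes> X)) ** tinv (anti (X \<otimes> \<S>' (H \<otimes> X))) ** tinv (braid H X (\<S>' (H \<otimes> X)))"
    by (simp add: bn)
qed

lemma nu_aux: assumes [simp]: "X \<in> Obj C"
  shows "nu X \<in> Arr C" "Dom C (nu X) = \<S> X" "Cod C (nu X) = G (\<S> (G X))"
    "tev (\<S> (G X)) ** H |> lft (nu X) = lft (nuT C H c s (G X)) ** H |> tS (tev X)"
proof -
  let ?f = "nuT C H c s (G X) \<cdot> (\<one> H \<boxtimes> S_arr C (ev X))"
  have f: "?f \<in> Arr C" "Dom C ?f = H \<otimes> \<S> X" "Cod C ?f = \<S> (G X)" "lft ?f = lft (nuT C H c s (G X)) ** H |> tS (tev X)"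
    by (simp_all add: lft_rules' nuT_aux)
  show "nu X \<in> Arr C" "Dom C (nu X) = \<S> X" "Cod C (nu X) = G (\<S> (G X))"
    "tev (\<S> (G X)) ** H |> lft (nu X) = lft (nuT C H c s (G X)) ** H |> tS (tev X)"
    using transpose[of "\<S> X" "\<S> (G X)" ?f, OF _ _ f(1-3)] f(4) unfolding hom_nu_def by simp_all
qed
lemmas nu_typ [simp] = nu_aux(1-3)

lemma nu'_aux: assumes [simp]: "X \<in> Obj C"
  shows "nu' X \<in> Arr C" "Dom C (nu' X) = \<S>' X" "Cod C (nu' X) = G (\<S>' (G X))"
    "tev (\<S>' (G X)) ** H |> lft (nu' X) = lft (nu'T C H c s (G X)) ** H |> tS' (tev X)"
proof -
  let ?f = "nu'T C H c s (G X) \<cdot> (\<one> H \<boxtimes> S'_arr C (ev X))"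
  have f: "?f \<in> Arr C" "Dom C ?f = H \<otimes> \<S>' X" "Cod C ?f = \<S>' (G X)" "lft ?f = lft (nu'T C H c s (G X)) ** H |> tS' (tev X)"
    by (simp_all add: lft_rules' nu'T_aux)
  show "nu' X \<in> Arr C" "Dom C (nu' X) = \<S>' X" "Cod C (nu' X) = G (\<S>' (G X))"
    "tev (\<S>' (G X)) ** H |> lft (nu' X) = lft (nu'T C H c s (G X)) ** H |> tS' (tev X)"
    using transpose[of "\<S>' X" "\<S>' (G X)" ?f, OF _ _ f(1-3)] f(4) unfolding hom_nu'_def by simp_all
qed
lemmas nu'_typ [simp] = nu'_aux(1-3)

text \<open>
  In elements, \<open>\<nu>(f)(h)(a) = f(a(s h))\<close>, where \<open>h\<close> passes \<open>f\<close> by the braiding.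
\<close>
lemma pairS_nu: assumes [simp]: "X \<in> Obj C"
  shows "pairS (G X) ** tev (\<S> (G X)) <| G X ** (H |> lft (nu X)) <| G X
    = pairS X ** \<S> X |> tev X ** \<S> X |> anti (G X) ** braid H (\<S> X) (G X) ** assoc H (\<S> X) (G X)"
proof -
  have "pairS (G X) ** tev (\<S> (G X)) <| G X ** (H |> lft (nu X)) <| G X
    = pairS (G X) ** (tev (\<S> (G X)) ** H |> lft (nu X)) <| G X" by simp
  also have "\<dots> = (pairS (H \<otimes> G X) ** tS (tev X) <| (H \<otimes> G X)) ** \<S> X |> anti (G X) ** braid H (\<S> X) (G X) ** assoc H (\<S> X) (G X)"
    unfolding nu_aux(4)[OF assms]
    by (simp add: nuT_aux chain2[OF nuT_aux(4)] assoc_nat braid_nat chain2[OF braid_nat] chain2[OF interchange_rev])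
  also have "\<dots> = pairS X ** \<S> X |> tev X ** \<S> X |> anti (G X) ** braid H (\<S> X) (G X) ** assoc H (\<S> X) (G X)"
    by (simp add: pairS_tS)
  finally show ?thesis .
qed

text \<open>
  In elements, the pairing of \<open>a\<close> with \<open>\<nu>'(f)(h)\<close> is \<open>f(a(s\<^sup>-\<^sup>1 h))\<close>, where \<open>h\<close> passes \<open>a\<close> by the inverse
  braiding.
\<close>
lemma pairS'_nu: assumes [simp]: "X \<in> Obj C"
  shows "pairS' (G X) ** G X |> tev (\<S>' (G X)) ** G X |> H |> lft (nu' X)
    = pairS' X ** tev X <| \<S>' X ** assoc_inv H (G X) (\<S>' X) ** tinv (anti (G X \<otimes> \<S>' X)) ** tinv (braid H (G X) (\<S>' X))"
proof -
  let ?g = "tS' (tev X)"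
  have t: "assoc_inv H (G X) (\<S>' (H \<otimes> G X)) ** H |> G X |> ?g = (H \<otimes> G X) |> ?g ** assoc_inv H (G X) (\<S>' X)"
    using assoc_inv_nat[of "tid H" H "tid (G X)" "G X" ?g] by simp
  have b: "tinv (braid H (G X) (\<S>' (H \<otimes> G X))) ** G X |> H |> ?g = H |> G X |> ?g ** tinv (braid H (G X) (\<S>' X))"
    using braid_inv_nat[of "tid H" H "tid (G X)" "G X" ?g] by simp
  have "pairS' (G X) ** G X |> tev (\<S>' (G X)) ** G X |> H |> lft (nu' X)
    = pairS' (G X) ** G X |> (tev (\<S>' (G X)) ** H |> lft (nu' X))" by simp
  also have "\<dots> = (pairS' (H \<otimes> G X) ** (H \<otimes> G X) |> ?g) ** assoc_inv H (G X) (\<S>' X) ** tinv (anti (G X \<otimes> \<S>' X)) ** tinv (braid H (G X) (\<S>' X))"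
    unfolding nu'_aux(4)[OF assms]
    by (simp add: nu'T_aux chain2[OF nu'T_aux(4)] b anti_inv_nat chain2[OF anti_inv_nat] chain2[OF t])
  also have "\<dots> = pairS' X ** tev X <| \<S>' X ** assoc_inv H (G X) (\<S>' X) ** tinv (anti (G X \<otimes> \<S>' X)) ** tinv (braid H (G X) (\<S>' X))"
    by (simp add: pairS'_tS')
  finally show ?thesis .
qed

lemma ev_pairS_cancel:
  assumes "pairS Y ** tev (\<S> Y) <| Y ** (H |> t) <| Y = pairS Y ** tev (\<S> Y) <| Y ** (H |> u) <| Y"
    "Y \<in> Obj C" "val t" "val u" "src t = src u" "trg t = G (\<S> Y)" "trg u = G (\<S> Y)"
  shows "t = u"
proof (rule ev_cancel[of "\<S> Y"])
  show "tev (\<S> Y) ** H |> t = tev (\<S> Y) ** H |> u"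
    by (rule pairS_cancel[of Y]) (use assms in \<open>auto simp: val_Obj\<close>)
qed (use assms in auto)

lemma ev_pairS'_cancel:
  assumes "pairS' Y ** Y |> tev (\<S>' Y) ** Y |> H |> t = pairS' Y ** Y |> tev (\<S>' Y) ** Y |> H |> u"
    "Y \<in> Obj C" "val t" "val u" "src t = src u" "trg t = G (\<S>' Y)" "trg u = G (\<S>' Y)"
  shows "t = u"
proof (rule ev_cancel[of "\<S>' Y"])
  show "tev (\<S>' Y) ** H |> t = tev (\<S>' Y) ** H |> u"
    by (rule pairS'_cancel[of Y]) (use assms in \<open>auto simp: val_Obj\<close>)
qed (use assms in auto)

text \<open>
  Normal form for pairings with \<open>S\<close>: an arrow on the dual is moved to the front, where the pairing transposes it.
\<close>
lemmas left_nat = interchange_rev chain2[OF interchange_rev] assoc_nat chain2[OF assoc_nat] assoc_nat_deep chain2[OF assoc_nat_deep]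
  braid_nat chain2[OF braid_nat] braid_nat_deep chain2[OF braid_nat_deep] op_nats
  assoc_nat_deep[THEN pre_eq2] assoc_nat_deep[THEN pre_eq2, THEN chain2]
lemmas pairS_nuk = pairS_nu pairS_nu[THEN chain3]
lemmas pairS'_nuk = pairS'_nu pairS'_nu[THEN chain3]

section \<open>The axioms on \<open>S\<close>\<close>

lemma hom_nu_nat: assumes [simp]: "val f"
  shows "lft (nu (src f)) ** tS f = tG (tS (tG f)) ** lft (nu (trg f))"
proof -
  have o [simp]: "src f \<in> Obj C" "trg f \<in> Obj C" by (simp_all add: val_Obj)
  let ?X = "src f" and ?Z = "trg f"
  have "pairS (G ?X) ** tev (\<S> (G ?X)) <| G ?X ** (H |> (lft (nu ?X) ** tS f)) <| G ?X
     = (pairS ?X ** tS f <| ?X) ** \<S> ?Z |> tev ?X ** \<S> ?Z |> anti (G ?X) ** braid H (\<S> ?Z) (G ?X) ** assoc H (\<S> ?Z) (G ?X)"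
    by (simp add: pairS_nuk left_nat)
  also have "\<dots> = pairS ?Z ** \<S> ?Z |> (tev ?Z ** H |> tG f) ** \<S> ?Z |> anti (G ?X) ** braid H (\<S> ?Z) (G ?X) ** assoc H (\<S> ?Z) (G ?X)"
    by (simp add: pairS_tS chain2[OF pairS_tS] evs)
  also have "\<dots> = pairS (G ?Z) ** tev (\<S> (G ?Z)) <| G ?Z ** (H |> lft (nu ?Z)) <| G ?Z ** (H \<otimes> \<S> ?Z) |> tG f"
    by (simp add: pairS_nuk left_nat)
  also have "\<dots> = (pairS (G ?X) ** tS (tG f) <| G ?X) ** tev (\<S> (G ?Z)) <| G ?X ** (H |> lft (nu ?Z)) <| G ?X"
    by (simp add: pairS_tS interchange_rev chain2[OF interchange_rev])
  also have "\<dots> = pairS (G ?X) ** (tev (\<S> (G ?X)) ** H |> (tG (tS (tG f)) ** lft (nu ?Z))) <| G ?X"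
    by (simp add: evs)
  finally show ?thesis by - (rule ev_pairS_cancel[of "G (src f)"], simp_all add: val_Obj)
qed

lemma hom_nu_epsilon: assumes [simp]: "A \<in> Obj C" shows "lft (eps (\<S> (G A))) ** lft (nu A) = tS (lft (eps A))"
proof (rule pairS_cancel[of "G A"])
  have "lft (eps (\<S> (G A))) ** lft (nu A) = tev (\<S> (G A)) ** H |> lft (nu A) ** unt (\<S> A)"
    by (simp add: lft_eps unt_nat)
  then show "pairS (G A) ** (lft (eps (\<S> (G A))) ** lft (nu A)) <| G A = pairS (G A) ** tS (lft (eps A)) <| G A"
    by (simp add: pairS_nuk unt_suf braid_unt pre_eq2[OF antipode_unit] pairS_tS lft_eps)
qed auto

text \<open>
  Evaluated at \<open>g\<close>, \<open>h\<close> and paired with \<open>a\<close>, one side is \<open>f(a(s(g h)))\<close> and the other \<open>f(a(s(h) s(g)))\<close>.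
  On the second side \<open>g\<close> passes the result of the action of \<open>h\<close>, hence both \<open>f\<close> and \<open>h\<close>; the Yang-Baxter
  equation brings the crossings of the two sides into the same order.
\<close>
lemma hom_nu_delta: assumes [simp]: "A \<in> Obj C"
  shows "lft (del (\<S> (G A))) ** lft (nu A) = tG (tG (tS (lft (del A)))) ** tG (lft (nu (G A))) ** lft (nu A)"
proof (rule ev_cancel2[of "\<S> (G A)"])
  let ?S = "\<S> A" and ?G = "G A"
  have am: "anti ?G ** mult ?G = mult ?G ** anti (H \<otimes> ?G) ** H |> anti ?G ** braid H H ?G"
    by (simp add: antipode_mult braid_anti chain2[OF braid_anti] braid_anti' chain2[OF braid_anti'] anti_nat chain2[OF anti_nat])
  have "pairS ?G ** (tev (\<S> ?G) ** H |> lft (nu A) ** mult ?S) <| ?G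
    = pairS A ** ?S |> tev A ** ?S |> anti ?G ** (braid H ?S ?G ** mult (?S \<otimes> ?G)) ** H |> assoc H ?S ?G ** assoc H (H \<otimes> ?S) ?G"
    by (simp add: pairS_nuk mult_suf)
  also have "\<dots> = pairS A ** ?S |> tev A ** ?S |> (anti ?G ** mult ?G) ** braid H ?S (H \<otimes> ?G) ** H |> braid H ?S ?G ** H |> assoc H ?S ?G ** assoc H (H \<otimes> ?S) ?G"
    unfolding braid_mult[OF S_Obj[OF assms] ihom_Obj[OF assms]] by simp
  also have "\<dots> = pairS A ** ?S |> tev A ** ?S |> mult ?G ** ?S |> anti (H \<otimes> ?G) ** ?S |> H |> anti ?G
      ** (?S |> braid H H ?G ** braid H ?S (H \<otimes> ?G) ** H |> braid H ?S ?G) ** H |> assoc H ?S ?G ** assoc H (H \<otimes> ?S) ?G"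
    unfolding am by simp
  also have "\<dots> = pairS A ** ?S |> tev A ** ?S |> mult ?G ** ?S |> anti (H \<otimes> ?G) ** ?S |> H |> anti ?G
      ** (braid H ?S (H \<otimes> ?G) ** H |> braid H ?S ?G ** braid H H (?S \<otimes> ?G)) ** H |> assoc H ?S ?G ** assoc H (H \<otimes> ?S) ?G"
    by (simp only: yang_baxter S_Obj ihom_Obj assms)
  finally have l: "pairS ?G ** (tev (\<S> ?G) ** H |> lft (nu A) ** mult ?S) <| ?G = \<dots>" .
  have evd: "?S |> tev A ** ?S |> H |> tev ?G ** ?S |> H |> H |> lft (del A) = ?S |> tev A ** ?S |> mult ?G"
    using pre_eq3[OF ev_del[of A], of ?S] by simp
  have "pairS ?G ** (tS (lft (del A)) ** tev (\<S> (G ?G)) ** H |> lft (nu ?G) ** H |> tev (\<S> ?G) ** H |> H |> lft (nu A)) <| ?G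
    = pairS (G ?G) ** tev (\<S> (G ?G)) <| G ?G ** (H |> lft (nu ?G)) <| G ?G ** (H |> tev (\<S> ?G)) <| G ?G ** (H |> H |> lft (nu A)) <| G ?G ** (H \<otimes> H \<otimes> ?S) |> lft (del A)"
    by (simp add: chain2[OF pairS_tS] interchange_rev chain2[OF interchange_rev])
  also have "\<dots> = pairS ?G ** tev (\<S> ?G) <| ?G ** (H |> lft (nu A)) <| ?G ** (H \<otimes> ?S) |> tev ?G ** (H \<otimes> ?S) |> anti (G ?G) ** braid H (H \<otimes> ?S) (G ?G) ** assoc H (H \<otimes> ?S) (G ?G) ** (H \<otimes> H \<otimes> ?S) |> lft (del A)"
    by (simp add: pairS_nuk left_nat)
  also have "\<dots> = pairS A ** (?S |> tev A ** ?S |> H |> tev ?G ** ?S |> H |> H |> lft (del A)) ** ?S |> H |> anti ?G ** ?S |> anti (H \<otimes> ?G)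
      ** braid H ?S (H \<otimes> ?G) ** H |> braid H ?S ?G ** braid H H (?S \<otimes> ?G) ** H |> assoc H ?S ?G ** assoc H (H \<otimes> ?S) ?G"
    by (simp add: pairS_nuk left_nat braid_hexagon_right chain2[OF braid_hexagon_right])
  also have "\<dots> = pairS ?G ** (tev (\<S> ?G) ** H |> lft (nu A) ** mult ?S) <| ?G"
    unfolding l evd by (simp add: left_nat)
  finally have r: "tS (lft (del A)) ** tev (\<S> (G ?G)) ** H |> lft (nu ?G) ** H |> tev (\<S> ?G) ** H |> H |> lft (nu A) = tev (\<S> ?G) ** H |> lft (nu A) ** mult ?S"
    by (rule pairS_cancel) simp_all
  show "tev (\<S> ?G) ** H |> tev (G (\<S> ?G)) ** H |> H |> (lft (del (\<S> ?G)) ** lft (nu A))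
    = tev (\<S> ?G) ** H |> tev (G (\<S> ?G)) ** H |> H |> (tG (tG (tS (lft (del A)))) ** tG (lft (nu ?G)) ** lft (nu A))"
    by (simp add: evs op_nats r)
qed auto

text \<open>
  The identity \<open>antipode_comult\<close> with the letter \<open>W\<close> carried in between the two factors.
\<close>
lemma psi_antipode: assumes [simp]: "W \<in> Obj C" "X \<in> Obj C"
  shows "mult W <| (H \<otimes> X) ** psi (H \<otimes> W) X ** H |> assoc_inv H W X ** anti (H \<otimes> W \<otimes> X) ** comult (W \<otimes> X)
    = unt W <| (H \<otimes> X) ** W |> anti X ** braid H W X"
proof -
  have u: "H |> braid H W X ** unt (H \<otimes> W \<otimes> X) = unt (W \<otimes> H \<otimes> X) ** braid H W X" by (simp add: unt_nat)
  have "assoc H W (H \<otimes> X) ** mult W <| (H \<otimes> X) ** psi (H \<otimes> W) X ** H |> assoc_inv H W X ** anti (H \<otimes> W \<otimes> X) ** comult (W \<otimes> X)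
    = mult (W \<otimes> H \<otimes> X) ** H |> (assoc H W (H \<otimes> X) ** braid H (H \<otimes> W) X) ** comult ((H \<otimes> W) \<otimes> X) ** H |> assoc_inv H W X ** anti (H \<otimes> W \<otimes> X) ** comult (W \<otimes> X)"
    by (simp add: chain2[OF mult_suf] chain2[OF assoc_psi])
  also have "\<dots> = mult (W \<otimes> H \<otimes> X) ** H |> H |> braid H W X ** H |> braid H H (W \<otimes> X) ** comult (H \<otimes> W \<otimes> X) ** anti (H \<otimes> W \<otimes> X) ** comult (W \<otimes> X)"
    by (simp add: braid_hexagon_right chain2[OF comult_nat])
  also have "\<dots> = H |> braid H W X ** (mult (H \<otimes> W \<otimes> X) ** H |> braid H H (W \<otimes> X) ** comult (H \<otimes> W \<otimes> X) ** anti (H \<otimes> W \<otimes> X) ** comult (W \<otimes> X))"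
    by (simp add: op_nats)
  also have "\<dots> = H |> braid H W X ** unt (H \<otimes> W \<otimes> X) ** anti (W \<otimes> X)"
    by (simp only: antipode_comult tensor_Obj assms)
  also have "\<dots> = unt (W \<otimes> H \<otimes> X) ** W |> anti X ** braid H W X"
    by (simp add: chain2[OF u] braid_anti)
  also have "\<dots> = assoc H W (H \<otimes> X) ** unt W <| (H \<otimes> X) ** W |> anti X ** braid H W X"
    by (simp add: chain2[OF unt_suf])
  finally show ?thesis by (rule cancel_left) auto
qed

lemma ev_psi_antipode: assumes [simp]: "A \<in> Obj C" "B \<in> Obj C"
  shows "(tev A \<odot> tev B) ** psi (G A) (G B) ** anti (G A \<otimes> G B) ** H |> (tev (G A) <| G B) ** H |> ((H |> lft (del A)) <| G B)
      ** H |> assoc_inv H (G A) (G B) ** comult (G A \<otimes> G B)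
    = lft (eps A) <| B ** G A |> tev B ** G A |> anti (G B) ** braid H (G A) (G B)"
proof -
  let ?A = "G A" and ?B = "G B"
  have n1: "psi ?A ?B ** H |> (tev ?A <| ?B) = (H |> tev ?A) <| (H \<otimes> ?B) ** psi (H \<otimes> G ?A) ?B"
    using psi_nat[of "tev ?A" ?A "tid ?B" ?B] by simp
  have n2: "psi (H \<otimes> G ?A) ?B ** H |> ((H |> lft (del A)) <| ?B) = (H |> H |> lft (del A)) <| (H \<otimes> ?B) ** psi (H \<otimes> ?A) ?B"
    using psi_nat[of "H |> lft (del A)" "H \<otimes> G ?A" "tid ?B" ?B] by simp
  have d: "tev A ** H |> (tev ?A ** H |> lft (del A)) = tev A ** mult ?A" using ev_del[of A] by simp
  have e1: "(tev A \<odot> tev B) ** (H |> (tev ?A ** H |> lft (del A))) <| (H \<otimes> ?B) = (tev A \<odot> tev B) ** mult ?A <| (H \<otimes> ?B)"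
    using d by (simp add: tens_cmp del: pre_cmp suf_cmp)
  have e2: "(tev A \<odot> tev B) ** unt ?A <| (H \<otimes> ?B) = lft (eps A) <| B ** ?A |> tev B"
    by (simp add: tens_cmp lft_eps del: pre_cmp suf_cmp)
  have "(tev A \<odot> tev B) ** psi ?A ?B ** anti (?A \<otimes> ?B) ** H |> (tev ?A <| ?B) ** H |> ((H |> lft (del A)) <| ?B)
      ** H |> assoc_inv H ?A ?B ** comult (?A \<otimes> ?B)
    = ((tev A \<odot> tev B) ** (H |> (tev ?A ** H |> lft (del A))) <| (H \<otimes> ?B)) ** psi (H \<otimes> ?A) ?B ** H |> assoc_inv H ?A ?B ** anti (H \<otimes> ?A \<otimes> ?B) ** comult (?A \<otimes> ?B)"
    by (simp add: chain2[OF anti_nat] chain2[OF n1] chain2[OF n2])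
  also have "\<dots> = ((tev A \<odot> tev B) ** unt ?A <| (H \<otimes> ?B)) ** ?A |> anti ?B ** braid H ?A ?B"
    unfolding e1 by (simp add: psi_antipode)
  finally show ?thesis unfolding e2 by simp
qed

text \<open>
  Tested against \<open>f\<close>, \<open>a\<close>, \<open>b\<close> this is \<open>f(a(1), b(s h)) = f(a(s(h\<^sub>1)\<^sub>1 h\<^sub>2), b(s(h\<^sub>1)\<^sub>2))\<close>.
\<close>
lemma hom_nu_e: assumes [simp]: "A \<in> Obj C" "B \<in> Obj C"
  shows "lft (nu B) ** lft (e_arr C A B) ** \<S> (A \<otimes> B) |> lft (eps A)
    = tG (lft (e_arr C (G A) (G B))) ** tG (tS (lft (phi A B)) <| G A) ** lft (phi (\<S> (G (A \<otimes> B))) (G A)) ** (lft (nu (A \<otimes> B)) \<odot> lft (del A))"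
proof (rule ev_pairS_cancel[of "G B"])
  let ?S = "\<S> (A \<otimes> B)" and ?A = "G A" and ?B = "G B" and ?P = "\<S> (G (A \<otimes> B))"
  have L: "pairS ?B ** tev (\<S> ?B) <| ?B ** (H |> (lft (nu B) ** lft (e_arr C A B) ** ?S |> lft (eps A))) <| ?B
    = pairS (A \<otimes> B) ** ?S |> (lft (eps A) <| B ** ?A |> tev B ** ?A |> anti ?B ** braid H ?A ?B) ** braid H ?S (?A \<otimes> ?B) ** H |> assoc ?S ?A ?B ** assoc H (?S \<otimes> ?A) ?B"
    by (simp add: pairS_nuk left_nat chain2[OF pairS_e] braid_hexagon_right chain2[OF braid_hexagon_right])
  have n: "(tev ?P \<odot> tev ?A) ** (H |> lft (nu (A \<otimes> B)) \<odot> H |> lft (del A))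
    = tev ?P <| ?A ** (H |> lft (nu (A \<otimes> B))) <| ?A ** (H \<otimes> ?S) |> tev ?A ** (H \<otimes> ?S) |> H |> lft (del A)"
  proof -
    have "(tev ?P \<odot> tev ?A) ** (H |> lft (nu (A \<otimes> B)) \<odot> H |> lft (del A))
      = (tev ?P ** H |> lft (nu (A \<otimes> B))) \<odot> (tev ?A ** H |> lft (del A))" by (rule tens_cmp) simp_all
    then show ?thesis
      using interchange'(2)[of "tev ?P ** H |> lft (nu (A \<otimes> B))" "tev ?A ** H |> lft (del A)"] by simp
  qed
  have R: "tev (\<S> ?B) ** H |> (tG (lft (e_arr C ?A ?B)) ** tG (tS (lft (phi A B)) <| ?A) ** lft (phi ?P ?A) ** (lft (nu (A \<otimes> B)) \<odot> lft (del A)))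
    = lft (e_arr C ?A ?B) ** tS (lft (phi A B)) <| ?A ** tev ?P <| ?A ** (H |> lft (nu (A \<otimes> B))) <| ?A ** (H \<otimes> ?S) |> tev ?A ** (H \<otimes> ?S) |> H |> lft (del A) ** psi ?S ?A"
    by (simp add: evs psi_nat chain2[OF n])
  have ps: "assoc H ?S ((H \<otimes> ?A) \<otimes> ?B) ** assoc (H \<otimes> ?S) (H \<otimes> ?A) ?B ** psi ?S ?A <| ?B
    = H |> ?S |> assoc_inv H ?A ?B ** H |> braid H ?S (?A \<otimes> ?B) ** comult (?S \<otimes> ?A \<otimes> ?B) ** H |> assoc ?S ?A ?B ** assoc H (?S \<otimes> ?A) ?B"
  proof (rule cancel_left)
    show "H |> ?S |> assoc H ?A ?B ** assoc H ?S ((H \<otimes> ?A) \<otimes> ?B) ** assoc (H \<otimes> ?S) (H \<otimes> ?A) ?B ** psi ?S ?A <| ?B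
      = H |> ?S |> assoc H ?A ?B ** H |> ?S |> assoc_inv H ?A ?B ** H |> braid H ?S (?A \<otimes> ?B) ** comult (?S \<otimes> ?A \<otimes> ?B) ** H |> assoc ?S ?A ?B ** assoc H (?S \<otimes> ?A) ?B"
      by (simp add: psi_suf)
  qed auto
  have "pairS ?B ** (tev (\<S> ?B) ** H |> (tG (lft (e_arr C ?A ?B)) ** tG (tS (lft (phi A B)) <| ?A) ** lft (phi ?P ?A) ** (lft (nu (A \<otimes> B)) \<odot> lft (del A)))) <| ?B
    = (pairS (?A \<otimes> ?B) ** tS (lft (phi A B)) <| (?A \<otimes> ?B)) ** tev ?P <| (?A \<otimes> ?B) ** (H |> lft (nu (A \<otimes> B))) <| (?A \<otimes> ?B) ** (H \<otimes> ?S) |> (tev ?A <| ?B) ** (H \<otimes> ?S) |> ((H |> lft (del A)) <| ?B) ** assoc (H \<otimes> ?S) (H \<otimes> ?A) ?B ** psi ?S ?A <| ?B"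
    unfolding R by (simp add: chain2[OF pairS_e] assoc_nat chain2[OF assoc_nat])
  also have "\<dots> = pairS (A \<otimes> B) ** ?S |> (tev (A \<otimes> B) ** H |> lft (phi A B)) ** ?S |> anti (?A \<otimes> ?B) ** ?S |> H |> (tev ?A <| ?B) ** ?S |> H |> ((H |> lft (del A)) <| ?B)
      ** braid H ?S ((H \<otimes> ?A) \<otimes> ?B) ** (assoc H ?S ((H \<otimes> ?A) \<otimes> ?B) ** assoc (H \<otimes> ?S) (H \<otimes> ?A) ?B ** psi ?S ?A <| ?B)"
    by (simp add: pairS_tS interchange_rev chain2[OF interchange_rev] pairS_nuk left_nat)
  also have "\<dots> = pairS (A \<otimes> B) ** ?S |> (tev (A \<otimes> B) ** H |> lft (phi A B)) ** ?S |> anti (?A \<otimes> ?B) ** ?S |> H |> (tev ?A <| ?B) ** ?S |> H |> ((H |> lft (del A)) <| ?B)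
      ** ?S |> H |> assoc_inv H ?A ?B ** (braid H ?S (H \<otimes> ?A \<otimes> ?B) ** H |> braid H ?S (?A \<otimes> ?B) ** comult (?S \<otimes> ?A \<otimes> ?B)) ** H |> assoc ?S ?A ?B ** assoc H (?S \<otimes> ?A) ?B"
    unfolding ps by (simp add: braid_nat_deep chain2[OF braid_nat_deep])
  also have "\<dots> = pairS (A \<otimes> B) ** ?S |> ((tev A \<odot> tev B) ** psi ?A ?B ** anti (?A \<otimes> ?B) ** H |> (tev ?A <| ?B) ** H |> ((H |> lft (del A)) <| ?B)
      ** H |> assoc_inv H ?A ?B ** comult (?A \<otimes> ?B)) ** braid H ?S (?A \<otimes> ?B) ** H |> assoc ?S ?A ?B ** assoc H (?S \<otimes> ?A) ?B"
    unfolding ev_phi[OF assms] braid_comult[OF S_Obj[OF tensor_Obj[OF assms]] tensor_Obj[OF ihom_Obj[OF assms(1)] ihom_Obj[OF assms(2)]], symmetric] by simp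
  finally show "pairS ?B ** tev (\<S> ?B) <| ?B ** (H |> (lft (nu B) ** lft (e_arr C A B) ** ?S |> lft (eps A))) <| ?B
    = pairS ?B ** tev (\<S> ?B) <| ?B ** (H |> (tG (lft (e_arr C ?A ?B)) ** tG (tS (lft (phi A B)) <| ?A) ** lft (phi ?P ?A) ** (lft (nu (A \<otimes> B)) \<odot> lft (del A)))) <| ?B"
    unfolding L by (simp add: ev_psi_antipode)
qed auto

text \<open>
  On the unit object the transformation \<open>\<nu>\<close> is \<open>\<epsilon>\<close>, since \<open>\<phi>\<^sub>0\<close> is built from \<open>\<epsilon>\<close> and \<open>\<epsilon>(s h) = \<epsilon>(h)\<close>.
\<close>
lemma nu_unit_counit: "tS (lft phi0) ** tev (\<S> (G \<I>)) ** H |> lft (nu \<I>) = counit (\<S> \<I>)"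
proof -
  let ?D = "\<S> \<I>"
  have "pairS \<I> ** (tS (lft phi0) ** tev (\<S> (G \<I>)) ** H |> lft (nu \<I>)) <| \<I>
    = pairS (G \<I>) ** tev (\<S> (G \<I>)) <| G \<I> ** (H |> lft (nu \<I>)) <| G \<I> ** (H \<otimes> ?D) |> lft phi0"
    by (simp add: chain2[OF pairS_tS] interchange_rev chain2[OF interchange_rev])
  also have "\<dots> = pairS \<I> ** ?D |> (tev \<I> ** H |> lft phi0) ** ?D |> anti \<I> ** braid H ?D \<I> ** assoc H ?D \<I>"
    by (simp add: pairS_nuk left_nat)
  also have "\<dots> = pairS \<I> ** ?D |> (counit \<I> ** anti \<I>) ** braid H ?D \<I> ** assoc H ?D \<I>"
    by (simp add: ev_phi0)
  also have "\<dots> = pairS \<I> ** counit ?D <| \<I>"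
    by (simp only: counit_antipode unit_Obj) (simp add: chain2[OF braid_counit] counit_suf)
  finally show ?thesis by (rule pairS_cancel[of \<I>]) auto
qed

text \<open>
  The antipode occurs twice on the right-hand side, and the counit absorbs both occurrences.
\<close>
lemma hom_nu_n_unit: "tG (lft (n_unit C)) ** lft phi0
   = tG (tS (lft (nu \<I>))) ** tG (tS (tG (tS (lft phi0)))) ** lft (nu (\<S> \<I>)) ** lft (n_unit C)"
proof -
  let ?D = "\<S> \<I>" and ?t = "tG (tS (lft phi0))"
  have r: "counit ?D ** runit H <| ?D = lunit ?D ** counit \<I> <| ?D"
    by (simp add: counit_suf[symmetric] chain2[OF counit_nat[symmetric]] assoc_triangle[symmetric])
       (simp add: chain2[OF counit_nat])
  have e: "\<I> |> tev ?D ** \<I> |> H |> ?t = \<I> |> (tS (lft phi0) ** tev (\<S> (G \<I>)))"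
    by (simp add: evs)
  have "pairS ?D ** tev (\<S> ?D) <| ?D ** (H |> (tG (tS (lft (nu \<I>))) ** tG (tS ?t) ** lft (nu ?D) ** lft (n_unit C))) <| ?D
    = pairS ?D ** (tev (\<S> ?D) ** H |> (tG (tS (lft (nu \<I>))) ** tG (tS ?t) ** lft (nu ?D) ** lft (n_unit C))) <| ?D"
    by simp
  also have "\<dots> = pairS ?D ** (tS (lft (nu \<I>)) ** tS ?t ** tev (\<S> (G ?D)) ** H |> lft (nu ?D) ** H |> lft (n_unit C)) <| ?D"
    by (simp add: evs del: suf_cmp)
  also have "\<dots> = pairS (G ?D) ** tev (\<S> (G ?D)) <| G ?D ** (H |> lft (nu ?D)) <| G ?D ** (H |> lft (n_unit C)) <| G ?D ** (H \<otimes> \<I>) |> ?t ** (H \<otimes> \<I>) |> lft (nu \<I>)"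
    by (simp add: chain2[OF pairS_tS] interchange_rev chain2[OF interchange_rev])
  also have "\<dots> = (pairS ?D ** lft (n_unit C) <| ?D) ** (\<I> |> tev ?D ** \<I> |> H |> ?t) ** \<I> |> H |> lft (nu \<I>) ** \<I> |> anti ?D ** braid H \<I> ?D ** assoc H \<I> ?D"
    by (simp add: pairS_nuk left_nat)
  also have "\<dots> = lunit ?D ** \<I> |> (tS (lft phi0) ** tev (\<S> (G \<I>)) ** H |> lft (nu \<I>)) ** \<I> |> anti ?D ** braid H \<I> ?D ** assoc H \<I> ?D"
    unfolding pairS_n e by simp
  also have "\<dots> = counit ?D ** anti ?D ** lunit (H \<otimes> ?D) ** braid H \<I> ?D ** assoc H \<I> ?D"
    unfolding nu_unit_counit by (simp add: chain2[OF lunit_nat])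
  also have "\<dots> = counit ?D ** runit H <| ?D"
    by (simp add: chain2[OF counit_antipode] chain2[OF braid_unit_right] assoc_triangle)
  also have "\<dots> = pairS ?D ** (tev (\<S> ?D) ** H |> (tG (lft (n_unit C)) ** lft phi0)) <| ?D"
    unfolding r by (simp add: evs chain2[OF pairS_n])
  finally show ?thesis by - (rule ev_pairS_cancel[of "\<S> \<I>"], simp_all)
qed

text \<open>
  For \<open>\<nu>\<close> the element \<open>h\<close> passes \<open>a\<close> by the braiding and is hit by \<open>s\<close>; for \<open>\<nu>'\<close> it passes back by the inverse
  braiding and is hit by the inverse of \<open>s\<close>.
\<close>
lemma hom_nu_adj_unit: assumes [simp]: "A \<in> Obj C"
  shows "tG (tS (lft (nu' A))) ** lft (nu (\<S>' (G A))) ** lft (adj_unit C (G A)) = tG (lft (adj_unit C A))"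
proof -
  let ?Q = "\<S>' A" and ?G = "G A" and ?R = "\<S>' (G A)"
  have "pairS ?Q ** tev (\<S> ?Q) <| ?Q ** (H |> (tG (tS (lft (nu' A))) ** lft (nu ?R) ** lft (adj_unit C ?G))) <| ?Q
    = pairS ?Q ** (tev (\<S> ?Q) ** H |> (tG (tS (lft (nu' A))) ** lft (nu ?R) ** lft (adj_unit C ?G))) <| ?Q" by simp
  also have "\<dots> = pairS ?Q ** (tS (lft (nu' A)) ** tev (\<S> (G ?R)) ** H |> lft (nu ?R) ** H |> lft (adj_unit C ?G)) <| ?Q"
    by (simp add: evs del: suf_cmp)
  also have "\<dots> = pairS (G ?R) ** tev (\<S> (G ?R)) <| G ?R ** (H |> lft (nu ?R)) <| G ?R ** (H |> lft (adj_unit C ?G)) <| G ?R ** (H \<otimes> ?G) |> lft (nu' A)"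
    by (simp add: chain2[OF pairS_tS] interchange_rev chain2[OF interchange_rev])
  also have "\<dots> = (pairS ?R ** lft (adj_unit C ?G) <| ?R) ** ?G |> tev ?R ** ?G |> H |> lft (nu' A) ** ?G |> anti ?Q ** braid H ?G ?Q ** assoc H ?G ?Q"
    by (simp add: pairS_nuk left_nat)
  also have "\<dots> = pairS' A ** tev A <| ?Q"
    by (simp add: pairS_alpha pairS'_nuk braid_anti[symmetric] chain2[OF braid_anti[symmetric]])
  also have "\<dots> = pairS ?Q ** (tev (\<S> ?Q) ** H |> tG (lft (adj_unit C A))) <| ?Q"
    by (simp add: evs chain2[OF pairS_alpha])
  finally show ?thesis by - (rule ev_pairS_cancel[of "\<S>' A"], simp_all)
qed

section \<open>The axioms on \<open>S'\<close>\<close>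

lemma assoc_inv_nat_deep: "trg h = X' \<Longrightarrow> val h \<Longrightarrow> A \<in> Obj C \<Longrightarrow> B \<in> Obj C \<Longrightarrow> assoc_inv A B X' ** A |> B |> h = (A \<otimes> B) |> h ** assoc_inv A B (src h)"
  using assoc_inv_nat[of "tid A" A "tid B" B h X'] by simp
lemma assoc_inv_nat_mid: "trg g = B' \<Longrightarrow> val g \<Longrightarrow> A \<in> Obj C \<Longrightarrow> X \<in> Obj C \<Longrightarrow> assoc_inv A B' X ** A |> (g <| X) = (A |> g) <| X ** assoc_inv A (src g) X"
  using assoc_inv_nat[of "tid A" A g B' "tid X" X] by simp
lemma braid_inv_nat_deep: "trg h = X' \<Longrightarrow> val h \<Longrightarrow> A \<in> Obj C \<Longrightarrow> B \<in> Obj C \<Longrightarrow> tinv (braid A B X') ** B |> A |> h = A |> B |> h ** tinv (braid A B (src h))"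
  using braid_inv_nat[of "tid A" A "tid B" B h X'] by simp
lemma braid_inv_nat_left: "trg g = B' \<Longrightarrow> val g \<Longrightarrow> A \<in> Obj C \<Longrightarrow> X \<in> Obj C \<Longrightarrow> tinv (braid A B' X) ** g <| (A \<otimes> X) = A |> (g <| X) ** tinv (braid A (src g) X)"
  using braid_inv_nat[of "tid A" A g B' "tid X" X] by simp

text \<open>
  Normal form for pairings with \<open>S'\<close>, mirroring \<open>left_nat\<close>: now arrows on the dual act in the last letter.
\<close>
lemmas right_nat = interchange chain2[OF interchange] assoc_inv_nat_deep chain2[OF assoc_inv_nat_deep] assoc_inv_nat_mid chain2[OF assoc_inv_nat_mid]
  braid_inv_nat_deep chain2[OF braid_inv_nat_deep] braid_inv_nat_left chain2[OF braid_inv_nat_left] anti_inv_nat chain2[OF anti_inv_nat]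

lemma hom_nu'_nat: assumes [simp]: "val f"
  shows "lft (nu' (src f)) ** tS' f = tG (tS' (tG f)) ** lft (nu' (trg f))"
proof -
  have o [simp]: "src f \<in> Obj C" "trg f \<in> Obj C" by (simp_all add: val_Obj)
  let ?X = "src f" and ?Z = "trg f"
  have "pairS' (G ?X) ** G ?X |> tev (\<S>' (G ?X)) ** G ?X |> H |> (tG (tS' (tG f)) ** lft (nu' ?Z))
     = (pairS' (G ?X) ** G ?X |> tS' (tG f)) ** G ?X |> tev (\<S>' (G ?Z)) ** G ?X |> H |> lft (nu' ?Z)"
    by (simp add: evs)
  also have "\<dots> = pairS' (G ?Z) ** G ?Z |> tev (\<S>' (G ?Z)) ** G ?Z |> H |> lft (nu' ?Z) ** tG f <| (H \<otimes> \<S>' ?Z)"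
    by (simp add: pairS'_tS' right_nat)
  also have "\<dots> = pairS' ?Z ** (tev ?Z ** H |> tG f) <| \<S>' ?Z ** assoc_inv H (G ?X) (\<S>' ?Z) ** tinv (anti (G ?X \<otimes> \<S>' ?Z)) ** tinv (braid H (G ?X) (\<S>' ?Z))"
    by (simp add: pairS'_nuk right_nat)
  also have "\<dots> = (pairS' ?X ** ?X |> tS' f) ** tev ?X <| \<S>' ?Z ** assoc_inv H (G ?X) (\<S>' ?Z) ** tinv (anti (G ?X \<otimes> \<S>' ?Z)) ** tinv (braid H (G ?X) (\<S>' ?Z))"
    by (simp add: ev_tG pairS'_tS' del: tcmp_assoc suf_cmp) simp
  also have "\<dots> = pairS' (G ?X) ** G ?X |> tev (\<S>' (G ?X)) ** G ?X |> H |> (lft (nu' ?X) ** tS' f)"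
    by (simp add: pairS'_nuk right_nat)
  finally show ?thesis by - (rule ev_pairS'_cancel[of "G (src f)"], erule sym, auto simp: val_Obj)
qed

lemma hom_nu'_epsilon: assumes [simp]: "A \<in> Obj C" shows "lft (eps (\<S>' (G A))) ** lft (nu' A) = tS' (lft (eps A))"
proof (rule pairS'_cancel[of "G A"])
  let ?Q = "\<S>' A"
  have e: "lft (eps (\<S>' (G A))) ** lft (nu' A) = tev (\<S>' (G A)) ** H |> lft (nu' A) ** unt ?Q"
    by (simp add: lft_eps unt_nat)
  have b: "tinv (braid H (G A) ?Q) ** G A |> unt ?Q = unt (G A \<otimes> ?Q)"
    by (simp add: braid_unt[symmetric])
  have s: "tinv (anti (G A \<otimes> ?Q)) ** unt (G A \<otimes> ?Q) = unt (G A \<otimes> ?Q)"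
    using arg_cong[OF antipode_unit[of "G A \<otimes> ?Q"], of "\<lambda>t. tinv (anti (G A \<otimes> ?Q)) ** t"] by simp
  have a: "assoc_inv H (G A) ?Q ** unt (G A \<otimes> ?Q) = unt (G A) <| ?Q"
    by (simp add: unt_suf[symmetric])
  show "pairS' (G A) ** G A |> (lft (eps (\<S>' (G A))) ** lft (nu' A)) = pairS' (G A) ** G A |> tS' (lft (eps A))"
    unfolding e by (simp add: pairS'_nuk b s a pairS'_tS' lft_eps)
qed auto

lemma braid_inv_mult: assumes [simp]: "A \<in> Obj C" "X \<in> Obj C"
  shows "tinv (braid H A X) ** A |> mult X = mult (A \<otimes> X) ** H |> tinv (braid H A X) ** tinv (braid H A (H \<otimes> X))"
proof -
  have "mult (A \<otimes> X) ** H |> tinv (braid H A X) ** tinv (braid H A (H \<otimes> X))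
    = tinv (braid H A X) ** (braid H A X ** mult (A \<otimes> X)) ** H |> tinv (braid H A X) ** tinv (braid H A (H \<otimes> X))" by simp
  also have "\<dots> = tinv (braid H A X) ** A |> mult X" unfolding braid_mult[OF assms] by simp
  finally show ?thesis by (rule sym)
qed

text \<open>
  \<open>antipode_mult\<close> solved for the inverse antipode, which therefore reverses products up to the inverse braiding.
\<close>
lemma anti_inv_mult: assumes [simp]: "Y \<in> Obj C"
  shows "tinv (anti Y) ** mult Y = mult Y ** H |> tinv (anti Y) ** tinv (anti (H \<otimes> Y)) ** tinv (braid H H Y)"
proof (rule cancel_right)
  have "(tinv (anti Y) ** mult Y) ** braid H H Y ** anti (H \<otimes> Y) ** H |> anti Y = tinv (anti Y) ** (anti Y ** mult Y)"
    by (simp add: antipode_mult)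
  then show "(tinv (anti Y) ** mult Y) ** braid H H Y ** anti (H \<otimes> Y) ** H |> anti Y
    = (mult Y ** H |> tinv (anti Y) ** tinv (anti (H \<otimes> Y)) ** tinv (braid H H Y)) ** braid H H Y ** anti (H \<otimes> Y) ** H |> anti Y"
    by simp
qed auto

lemma assoc_inv_mult: assumes [simp]: "X \<in> Obj C" "Y \<in> Obj C"
  shows "assoc_inv H X Y ** mult (X \<otimes> Y) = mult X <| Y ** assoc_inv H (H \<otimes> X) Y ** H |> assoc_inv H X Y"
proof -
  have "mult X <| Y ** assoc_inv H (H \<otimes> X) Y ** H |> assoc_inv H X Y = assoc_inv H X Y ** (assoc H X Y ** mult X <| Y) ** assoc_inv H (H \<otimes> X) Y ** H |> assoc_inv H X Y" by simp
  also have "\<dots> = assoc_inv H X Y ** mult (X \<otimes> Y)" unfolding mult_suf[OF assms] by simp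
  finally show ?thesis by (rule sym)
qed

lemma braid_inv_hex: assumes [simp]: "A \<in> Obj C" "X \<in> Obj C"
  shows "tinv (braid H (H \<otimes> A) X) ** assoc_inv H A (H \<otimes> X) = H |> assoc_inv H A X ** tinv (braid H H (A \<otimes> X)) ** H |> tinv (braid H A X)"
  using arg_cong[OF braid_hexagon_right[of H H A X], of tinv] by (simp add: tinv_dist)

lemma anti_inv_braid_inv: assumes [simp]: "X \<in> Obj C"
  shows "tinv (anti (H \<otimes> X)) ** tinv (braid H H X) = tinv (braid H H X) ** H |> tinv (anti X)"
    and "H |> tinv (anti X) ** tinv (braid H H X) = tinv (braid H H X) ** tinv (anti (H \<otimes> X))"
  using arg_cong[OF braid_anti[of H X], of tinv] arg_cong[OF braid_anti'[of X], of tinv] by (simp_all add: tinv_dist)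

text \<open>
  As \<open>hom_nu_delta\<close>, with \<open>f(a(s\<^sup>-\<^sup>1(g h)))\<close>; the hexagon for the inverse crossing takes the place of
  the Yang-Baxter equation.
\<close>
lemma hom_nu'_delta: assumes [simp]: "A \<in> Obj C"
  shows "lft (del (\<S>' (G A))) ** lft (nu' A) = tG (tG (tS' (lft (del A)))) ** tG (lft (nu' (G A))) ** lft (nu' A)"
proof (rule ev_cancel2[of "\<S>' (G A)"])
  let ?Q = "\<S>' A" and ?G = "G A"
  have "pairS' ?G ** ?G |> (tev (\<S>' ?G) ** H |> lft (nu' A) ** mult ?Q)
    = pairS' A ** tev A <| ?Q ** mult ?G <| ?Q ** assoc_inv H (H \<otimes> ?G) ?Q ** H |> assoc_inv H ?G ?Q
      ** tinv (braid H H (?G \<otimes> ?Q)) ** H |> tinv (anti (?G \<otimes> ?Q)) ** H |> tinv (braid H ?G ?Q) ** tinv (anti (?G \<otimes> H \<otimes> ?Q)) ** tinv (braid H ?G (H \<otimes> ?Q))"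
    by (simp add: pairS'_nuk braid_inv_mult chain2[OF anti_inv_mult] chain2[OF assoc_inv_mult] anti_inv_braid_inv anti_inv_braid_inv[THEN chain2] right_nat)
  note l = this
  have evd: "(tev A <| ?Q ** (H |> tev ?G) <| ?Q ** (H |> H |> lft (del A)) <| ?Q) = tev A <| ?Q ** mult ?G <| ?Q"
    using arg_cong[OF ev_del[of A], of "\<lambda>t. t <| ?Q"] by simp
  have "pairS' ?G ** ?G |> (tS' (lft (del A)) ** tev (\<S>' (G ?G)) ** H |> lft (nu' ?G) ** H |> tev (\<S>' ?G) ** H |> H |> lft (nu' A))
    = pairS' (G ?G) ** G ?G |> tev (\<S>' (G ?G)) ** G ?G |> H |> lft (nu' ?G) ** G ?G |> H |> tev (\<S>' ?G) ** G ?G |> H |> H |> lft (nu' A) ** lft (del A) <| (H \<otimes> H \<otimes> ?Q)"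
    by (simp add: chain2[OF pairS'_tS'] interchange chain2[OF interchange])
  also have "\<dots> = pairS' ?G ** ?G |> tev (\<S>' ?G) ** ?G |> H |> lft (nu' A) ** tev ?G <| (H \<otimes> ?Q) ** (H |> lft (del A)) <| (H \<otimes> ?Q) ** assoc_inv H ?G (H \<otimes> ?Q)
      ** tinv (anti (?G \<otimes> H \<otimes> ?Q)) ** tinv (braid H ?G (H \<otimes> ?Q))"
    by (simp add: pairS'_nuk right_nat)
  also have "\<dots> = pairS' A ** (tev A <| ?Q ** (H |> tev ?G) <| ?Q ** (H |> H |> lft (del A)) <| ?Q) ** assoc_inv H (H \<otimes> ?G) ?Q ** H |> assoc_inv H ?G ?Q
      ** tinv (braid H H (?G \<otimes> ?Q)) ** H |> tinv (anti (?G \<otimes> ?Q)) ** H |> tinv (braid H ?G ?Q) ** tinv (anti (?G \<otimes> H \<otimes> ?Q)) ** tinv (braid H ?G (H \<otimes> ?Q))"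
    by (simp add: pairS'_nuk right_nat chain2[OF braid_inv_hex] anti_inv_braid_inv anti_inv_braid_inv[THEN chain2])
  also have "\<dots> = pairS' ?G ** ?G |> (tev (\<S>' ?G) ** H |> lft (nu' A) ** mult ?Q)"
    unfolding l evd by simp
  finally have r: "tS' (lft (del A)) ** tev (\<S>' (G ?G)) ** H |> lft (nu' ?G) ** H |> tev (\<S>' ?G) ** H |> H |> lft (nu' A) = tev (\<S>' ?G) ** H |> lft (nu' A) ** mult ?Q"
    by (rule pairS'_cancel) simp_all
  show "tev (\<S>' ?G) ** H |> tev (G (\<S>' ?G)) ** H |> H |> (lft (del (\<S>' ?G)) ** lft (nu' A))
    = tev (\<S>' ?G) ** H |> tev (G (\<S>' ?G)) ** H |> H |> (tG (tG (tS' (lft (del A)))) ** tG (lft (nu' ?G)) ** lft (nu' A))"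
    by (simp add: evs op_nats r)
qed auto

lemma hom_nu'_adj_counit: assumes [simp]: "A \<in> Obj C"
  shows "tG (tS' (lft (nu A))) ** lft (nu' (\<S> (G A))) ** lft (adj_counit C (G A)) = tG (lft (adj_counit C A))"
proof -
  let ?Q = "\<S> A" and ?G = "G A" and ?R = "\<S> (G A)"
  have "pairS' ?Q ** ?Q |> tev (\<S>' ?Q) ** ?Q |> H |> (tG (tS' (lft (nu A))) ** lft (nu' ?R) ** lft (adj_counit C ?G))
    = (pairS' ?Q ** ?Q |> tS' (lft (nu A))) ** ?Q |> tev (\<S>' (G ?R)) ** ?Q |> H |> lft (nu' ?R) ** ?Q |> H |> lft (adj_counit C ?G)"
    by (simp add: evs)
  also have "\<dots> = pairS' (G ?R) ** G ?R |> tev (\<S>' (G ?R)) ** G ?R |> H |> lft (nu' ?R) ** G ?R |> H |> lft (adj_counit C ?G) ** lft (nu A) <| (H \<otimes> ?G)"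
    by (simp add: pairS'_tS' interchange chain2[OF interchange])
  also have "\<dots> = (pairS' ?R ** ?R |> lft (adj_counit C ?G)) ** tev ?R <| ?G ** (H |> lft (nu A)) <| ?G ** assoc_inv H ?Q ?G ** tinv (anti (?Q \<otimes> ?G)) ** tinv (braid H ?Q ?G)"
    by (simp add: pairS'_nuk right_nat)
  also have "\<dots> = pairS A ** ?Q |> tev A"
    by (simp add: pairS'_beta pairS_nuk braid_anti[symmetric] chain2[OF braid_anti[symmetric]])
  also have "\<dots> = pairS' ?Q ** ?Q |> (tev (\<S>' ?Q) ** H |> tG (lft (adj_counit C A)))"
    by (simp add: evs chain2[OF pairS'_beta])
  finally show ?thesis by - (rule ev_pairS'_cancel[of "\<S> A"], simp_all)
qed

lemma G_star_autonomous_comonad: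
  "star_autonomous_comonad C G (hom_arr C H G ev)
     (hom_delta C H G ev \<mu>) (hom_epsilon C G ev \<eta>)
     (hom_phi C H G ev c \<Delta>) (hom_phi0 C H G ev \<epsilon>)
     (hom_nu C H G ev c s) (hom_nu' C H G ev c s)"
proof (intro star_autonomous_comonad.intro star_autonomous_comonad_axioms.intro)
  show "star_autonomous_category C" by unfold_locales
  show "monoidal_comonad C G (hom_arr C H G ev) (hom_delta C H G ev \<mu>) (hom_epsilon C G ev \<eta>)
     (hom_phi C H G ev c \<Delta>) (hom_phi0 C H G ev \<epsilon>)" by (rule G_monoidal_comonad)
  have "nu (Dom C f) \<cdot> S1 f = G1 (S1 (G1 f)) \<cdot> nu (Cod C f)" if "f \<in> Arr C" for f
    by (rule lft_inject) (use that hom_nu_nat[of "lft f"] in \<open>simp_all add: lft_rules' Dom_Obj Cod_Obj\<close>)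
  then show "is_nat_trans (op_cat C) C (S_obj C) (S_arr C) (\<lambda>A. G (\<S> (G A))) (\<lambda>f. G1 (S1 (G1 f))) (hom_nu C H G ev c s)"
    by (auto simp: is_nat_trans_def op_cat_def Hom_iff)
  have "nu' (Dom C f) \<cdot> S1' f = G1 (S1' (G1 f)) \<cdot> nu' (Cod C f)" if "f \<in> Arr C" for f
    by (rule lft_inject) (use that hom_nu'_nat[of "lft f"] in \<open>simp_all add: lft_rules' Dom_Obj Cod_Obj\<close>)
  then show "is_nat_trans (op_cat C) C (S'_obj C) (S'_arr C) (\<lambda>A. G (\<S>' (G A))) (\<lambda>f. G1 (S1' (G1 f))) (hom_nu' C H G ev c s)"
    by (auto simp: is_nat_trans_def op_cat_def Hom_iff)
  show "G1 (n_unit C) \<cdot> phi0 = G1 (S1 (nu \<I>)) \<cdot> G1 (S1 (G1 (S1 phi0))) \<cdot> nu (\<S> \<I>) \<cdot> n_unit C"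
    by (rule lft_inject) (simp_all add: lft_rules' hom_nu_n_unit)
  fix A assume [simp]: "A \<in> Obj C"
  show "eps (\<S> (G A)) \<cdot> nu A = S1 (eps A)" by (rule lft_inject) (simp_all add: lft_rules' hom_nu_epsilon)
  show "eps (\<S>' (G A)) \<cdot> nu' A = S1' (eps A)" by (rule lft_inject) (simp_all add: lft_rules' hom_nu'_epsilon)
  show "del (\<S> (G A)) \<cdot> nu A = G1 (G1 (S1 (del A))) \<cdot> G1 (nu (G A)) \<cdot> nu A"
    by (rule lft_inject) (simp_all add: lft_rules' hom_nu_delta)
  show "del (\<S>' (G A)) \<cdot> nu' A = G1 (G1 (S1' (del A))) \<cdot> G1 (nu' (G A)) \<cdot> nu' A"
    by (rule lft_inject) (simp_all add: lft_rules' hom_nu'_delta)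
  show "G1 (S1 (nu' A)) \<cdot> nu (\<S>' (G A)) \<cdot> adj_unit C (G A) = G1 (adj_unit C A)"
    by (rule lft_inject) (simp_all add: lft_rules' hom_nu_adj_unit)
  show "G1 (S1' (nu A)) \<cdot> nu' (\<S> (G A)) \<cdot> adj_counit C (G A) = G1 (adj_counit C A)"
    by (rule lft_inject) (simp_all add: lft_rules' hom_nu'_adj_counit)
  fix B assume [simp]: "B \<in> Obj C"
  show "nu B \<cdot> e_arr C A B \<cdot> (\<one> (\<S> (A \<otimes> B)) \<boxtimes> eps A)
    = G1 (e_arr C (G A) (G B)) \<cdot> G1 (S1 (phi A B) \<boxtimes> \<one> (G A)) \<cdot> phi (\<S> (G (A \<otimes> B))) (G A) \<cdot> (nu (A \<otimes> B) \<boxtimes> del A)"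
    by (rule lft_inject) (simp_all add: lft_rules' hom_nu_e)
qed

end

theorem mainTheorem3:
  fixes C :: "('o, 'm, 'x) star_category_scheme"
    and c :: "'o \<Rightarrow> 'o \<Rightarrow> 'm"
    and H :: "'o" and \<mu> \<eta> \<Delta> \<epsilon> s :: "'m"
    and G :: "'o \<Rightarrow> 'o" and ev :: "'o \<Rightarrow> 'm"
  assumes "star_autonomous_category C"
    and "braided_monoidal_category C c"
    and "hopf_algebra C c H \<mu> \<eta> \<Delta> \<epsilon> s"
    and "iso_arrow C s"
    and "right_internal_hom C H G ev"
  shows "star_autonomous_comonad C G (hom_arr C H G ev)
           (hom_delta C H G ev \<mu>) (hom_epsilon C G ev \<eta>)
           (hom_phi C H G ev c \<Delta>) (hom_phi0 C H G ev \<epsilon>)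
           (hom_nu C H G ev c s) (hom_nu' C H G ev c s)"
proof -
  interpret star_hopf C c H \<mu> \<eta> \<Delta> \<epsilon> s G ev
    using assms by (intro star_hopf.intro hopf_internal_hom.intro star_hopf_axioms.intro)
  show ?thesis by (rule G_star_autonomous_comonad)
qed

end
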